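(* Let $A\subset\overline\Omega$ and $u\in\tilde W^{1,p}(\Omega)$. Then $u$ belongs to the closure $\overline{\mathcal{Y}_{p,\Omega}(A)}$ of $\mathcal{Y}_{p,\Omega}(A)$ in $W^{1,p}(\Omega)$ if and only if $\tilde u\ge1$ $\mathrm{Cap}_{p,\Omega}$-quasi everywhere on $A$.
   Context: Throughout, $\Omega\subset\mathbb{R}^N$ is a nonempty open set and $p\in(1,\infty)$. $W^{1,p}(\Omega)$ is the usual Sobolev space with norm $\|u\|^p_{W^{1,p}(\Omega)}=\int_\Omega |u|^p+|\nabla u|^p\,dx$; $\tilde W^{1,p}(\Omega)$ is the closure in $W^{1,p}(\Omega)$ of $\{u|_\Omega: u\in C_c(\overline\Omega),\ u|_\Omega\in W^{1,p}(\Omega)\}$; for $A\subset\overline\Omega$, $\mathcal{Y}_{p,\Omega}(A)=\{u\in\tilde W^{1,p}(\Omega):\ \exists\, O \text{ open in } \overline\Omega \text{ (relative topology) with } A\subset O,\ u\ge 1 \text{ a.e. on } O\cap\Omega\}$ and $\mathrm{Cap}_{p,\Omega}(A)=\inf\{\|u\|^p_{W^{1,p}(\Omega)}: u\in\mathcal{Y}_{p,\Omega}(A)\}$ ($\inf\emptyset=\infty$). A set $P\subset\overline\Omega$ is $\mathrm{Cap}_{p,\Omega}$-polar if $\mathrm{Cap}_{p,\Omega}(P)=0$; "quasi everywhere" means outside a polar set. A function $f$ on $D\subset\overline\Omega$ is $\mathrm{Cap}_{p,\Omega}$-quasi continuous if for every $\varepsilon>0$ there is $V$ open in $\overline\Omega$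 with $\mathrm{Cap}_{p,\Omega}(V)<\varepsilon$ and $f|_{D\setminus V}$ continuous. For $u\in\tilde W^{1,p}(\Omega)$, $\tilde u:\overline\Omega\to\mathbb{R}$ denotes a $\mathrm{Cap}_{p,\Omega}$-quasi continuous function equal to $u$ a.e. on $\Omega$; such a function exists and is unique up to a polar set. *)

theory Defs
  imports "HOL-Analysis.Analysis"
begin

text \<open>Smooth (C-infinity) real functions on an open set U: differentiable, and every
  directional derivative is again smooth (coinductive = all orders).\<close>
coinductive smooth_on :: "'a::euclidean_space set \<Rightarrow> ('a \<Rightarrow> real) \<Rightarrow> bool" for U where
  "f differentiable_on U \<Longrightarrow> (\<forall>v. smooth_on U (\<lambda>x. frechet_derivative f (at x) v))
     \<Longrightarrow> smooth_on U f"

definition test_fun :: "'a::euclidean_space set \<Rightarrow> ('a \<Rightarrow> real) \<Rightarrow> bool" where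
  "test_fun \<Omega> \<phi> \<longleftrightarrow> smooth_on UNIV \<phi> \<and> compact (closure {x. \<phi> x \<noteq> 0})
      \<and> closure {x. \<phi> x \<noteq> 0} \<subseteq> \<Omega>"

definition weak_grad :: "'a::euclidean_space set \<Rightarrow> ('a \<Rightarrow> real) \<Rightarrow> ('a \<Rightarrow> 'a) \<Rightarrow> bool" where
  "weak_grad \<Omega> u g \<longleftrightarrow> g \<in> borel_measurable (lebesgue_on \<Omega>) \<and>
     (\<forall>\<phi>. test_fun \<Omega> \<phi> \<longrightarrow> (\<forall>i\<in>Basis.
        (LINT x|lebesgue_on \<Omega>. u x * frechet_derivative \<phi> (at x) i)
          = - (LINT x|lebesgue_on \<Omega>. (g x \<bullet> i) * \<phi> x)))"

text \<open>Membership in W^{1,p}(Omega) (functions represented pointwise; equality is a.e.).\<close>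
definition sobolev :: "'a::euclidean_space set \<Rightarrow> real \<Rightarrow> ('a \<Rightarrow> real) \<Rightarrow> bool" where
  "sobolev \<Omega> p u \<longleftrightarrow> u \<in> borel_measurable (lebesgue_on \<Omega>) \<and>
     integrable (lebesgue_on \<Omega>) (\<lambda>x. \<bar>u x\<bar> powr p) \<and>
     (\<exists>g. weak_grad \<Omega> u g \<and> integrable (lebesgue_on \<Omega>) (\<lambda>x. norm (g x) powr p))"

definition wgrad :: "'a::euclidean_space set \<Rightarrow> real \<Rightarrow> ('a \<Rightarrow> real) \<Rightarrow> ('a \<Rightarrow> 'a)" where
  "wgrad \<Omega> p u = (SOME g. weak_grad \<Omega> u g \<and> integrable (lebesgue_on \<Omega>) (\<lambda>x. norm (g x) powr p))"

definition sob_normp :: "'a::euclidean_space set \<Rightarrow> real \<Rightarrow> ('a \<Rightarrow> real) \<Rightarrow> real" where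
  "sob_normp \<Omega> p u = (LINT x|lebesgue_on \<Omega>. \<bar>u x\<bar> powr p)
                     + (LINT x|lebesgue_on \<Omega>. norm (wgrad \<Omega> p u x) powr p)"

definition sob_closure :: "'a::euclidean_space set \<Rightarrow> real \<Rightarrow> ('a \<Rightarrow> real) set \<Rightarrow> ('a \<Rightarrow> real) set" where
  "sob_closure \<Omega> p S = {u. sobolev \<Omega> p u \<and>
      (\<forall>\<epsilon>>0. \<exists>v\<in>S. sob_normp \<Omega> p (\<lambda>x. u x - v x) < \<epsilon>)}"

definition Wt :: "'a::euclidean_space set \<Rightarrow> real \<Rightarrow> ('a \<Rightarrow> real) set" where
  "Wt \<Omega> p = sob_closure \<Omega> p {u. sobolev \<Omega> p u \<and>
      (\<exists>v. continuous_on (closure \<Omega>) v \<and> compact (closure {x\<in>closure \<Omega>. v x \<noteq> 0})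
           \<and> (AE x in lebesgue_on \<Omega>. u x = v x))}"

definition Ycap :: "'a::euclidean_space set \<Rightarrow> real \<Rightarrow> 'a set \<Rightarrow> ('a \<Rightarrow> real) set" where
  "Ycap \<Omega> p A = {u\<in>Wt \<Omega> p. \<exists>U. openin (top_of_set (closure \<Omega>)) U \<and> A \<subseteq> U \<and>
      (AE x in lebesgue_on (U \<inter> \<Omega>). u x \<ge> 1)}"

definition Cap :: "'a::euclidean_space set \<Rightarrow> real \<Rightarrow> 'a set \<Rightarrow> ennreal" where
  "Cap \<Omega> p A = (INF u\<in>Ycap \<Omega> p A. ennreal (sob_normp \<Omega> p u))"

definition quasi_cont :: "'a::euclidean_space set \<Rightarrow> real \<Rightarrow> 'a set \<Rightarrow> ('a \<Rightarrow> real) \<Rightarrow> bool" where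
  "quasi_cont \<Omega> p D f \<longleftrightarrow> (\<forall>\<epsilon>>0. \<exists>V. openin (top_of_set (closure \<Omega>)) V \<and>
      Cap \<Omega> p V < ennreal \<epsilon> \<and> continuous_on (D - V) f)"

end

theory Submission
  imports Defs
begin

text \<open>
  If \<open>y\<close> lies in \<open>Ycap \<Omega> p A\<close> and is close to \<open>u\<close>, then near \<open>{x \<in> A. ut x < 1 - \<delta>}\<close>, and off an open
  set \<open>V\<close> of small capacity outside of which \<open>ut\<close> is continuous, one has \<open>\<bar>u - y\<bar> \<ge> \<delta>\<close>. Hence
  \<open>\<bar>u - y\<bar> / \<delta>\<close> plus an admissible function of \<open>V\<close> is admissible for that set, whose capacity is
  therefore zero. Conversely, if \<open>ut \<ge> 1\<close> on \<open>A\<close> off a polar set \<open>P\<close>, take a continuous \<open>c\<close> near \<open>u\<close> with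
  \<open>\<bar>c\<bar> \<le> B\<close>, a small \<open>t > 0\<close>, and small nonnegative \<open>w\<close> and \<open>w'\<close> that are at least 1 near \<open>V\<close> and \<open>P\<close>;
  then \<open>c + \<bar>(1 + t) * u - c\<bar> + (1 + B) * (w + w')\<close> is admissible for \<open>A\<close> and close to \<open>u\<close>.

  Both constructions need nonnegative majorants in \<open>Wt\<close> of comparable norm. These are sums
  \<open>\<Sum>k. \<bar>f (k + 1) - f k\<bar>\<close> of continuous functions, so that the chain rule is only needed for
  continuous \<open>u\<close>. There it is proved with difference quotients: for \<open>F t = sqrt (t\<^sup>2 + \<epsilon>\<^sup>2)\<close> the
  quotient \<open>(F a - F b) / (a - b)\<close> is an explicit continuous function of \<open>(a, b)\<close>, and a weak derivative
  may be tested against continuous functions of compact support. Uniqueness of weak gradients,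
  on which the meaning of \<open>sob_normp\<close> rests, follows from the density of test functions among
  these.
\<close>

section \<open>Smooth bump functions and test functions\<close>

text \<open>Two features of the definitions shape the argument. \<open>sob_normp\<close> is a p-th
  power, so the triangle inequality is used only up to the factor \<open>2 powr p\<close>; infinite
  sums are estimated with weights \<open>(2 powr p) ^ Suc k\<close>, against which the terms are
  chosen geometrically small. And admissible functions may be negative away from the set, so adding
  one can spoil a lower bound; each is therefore first replaced by a nonnegative majorant.
  Truncating general members of \<open>Wt\<close> would require the chain rule for them, while a
  majorant requires it for continuous functions only and costs a constant factor.

  In the converse direction the approximant starts from \<open>c\<close> and not from
  \<open>u\<close>, because nothing bounds \<open>u\<close> from below near \<open>V\<close> and
  \<open>P\<close>, whereas \<open>c \<ge> - B\<close> is lifted above 1 by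
  \<open>(1 + B) * (w + w')\<close>. The accuracy of \<open>c\<close> and the size of
  \<open>t\<close> must not depend on \<open>B\<close>; only the capacity allowed for
  \<open>V\<close> may. The factor \<open>1 + t\<close> relaxes \<open>ut \<ge> 1\<close> to the
  strict inequality \<open>ut > 1 / (1 + t)\<close>, whose solution set becomes relatively open once
  \<open>V\<close> is adjoined.\<close>

definition flat_exp :: "nat \<Rightarrow> real \<Rightarrow> real" where
  "flat_exp k t = (if t > 0 then exp (- 1 / t) / t ^ k else 0)"

lemma flat_exp_eq_0: "t \<le> 0 \<Longrightarrow> flat_exp k t = 0"
  and flat_exp_nonneg: "0 \<le> flat_exp k t"
  by (auto simp: flat_exp_def)

lemma flat_exp_tendsto_0: "(flat_exp k \<longlongrightarrow> 0) (at_right 0)"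
proof -
  have "((\<lambda>t. (inverse t) ^ k / exp (inverse t)) \<longlongrightarrow> (0::real)) (at_right 0)"
    using filterlim_compose[OF tendsto_power_div_exp_0 filterlim_inverse_at_top_right] .
  then show ?thesis
  proof (rule Lim_transform_eventually)
    show "\<forall>\<^sub>F t in at_right 0. inverse t ^ k / exp (inverse t) = flat_exp k t"
      unfolding eventually_at_right_field
      by (intro exI[of _ 1]) (auto simp: flat_exp_def exp_minus divide_simps power_divide)
  qed
qed

text \<open>The denominators \<open>t ^ k\<close> exist for this: the derivatives of
  \<open>exp (- 1 / t)\<close> acquire powers of \<open>1 / t\<close>, and the family indexed by
  \<open>k\<close> is closed under differentiation up to linear combinations.\<close>

lemma has_derivative_flat_exp:
  "(flat_exp k has_real_derivative flat_exp (k + 2) t - real k * flat_exp (k + 1) t) (at t)"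
proof -
  consider "t > 0" | "t < 0" | "t = 0" by linarith
  then show ?thesis
  proof cases
    case 1
    have eq: "(exp (- 1 / t) * (1 / t\<^sup>2) * t ^ k - exp (- 1 / t) * (real k * t ^ (k - 1)))
        / (t ^ k * t ^ k) = flat_exp (k + 2) t - real k * flat_exp (k + 1) t"
      using 1 by (cases k) (simp_all add: flat_exp_def divide_simps power2_eq_square, simp add: algebra_simps)
    have "((\<lambda>t. - 1 / t) has_real_derivative 1 / t\<^sup>2) (at t)"
      using 1 by (auto intro!: derivative_eq_intros simp: power2_eq_square)
    then have "((\<lambda>t. exp (- 1 / t)) has_real_derivative exp (- 1 / t) * (1 / t\<^sup>2)) (at t)"
      by (rule DERIV_chain2[OF DERIV_exp])
    moreover have "((\<lambda>t. t ^ k) has_real_derivative real k * t ^ (k - 1)) (at t)"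
      using DERIV_pow[of k t] by simp
    ultimately have "((\<lambda>t. exp (- 1 / t) / t ^ k) has_real_derivative
        flat_exp (k + 2) t - real k * flat_exp (k + 1) t) (at t)"
      unfolding eq[symmetric] using 1 by (intro DERIV_divide) auto
    then show ?thesis
      by (rule has_field_derivative_transform_within_open[of _ _ _ "{0<..}"])
         (use 1 in \<open>auto simp: flat_exp_def\<close>)
  next
    case 2
    have "((\<lambda>t. 0) has_real_derivative 0) (at t)" by simp
    then have "(flat_exp k has_real_derivative 0) (at t)"
      by (rule has_field_derivative_transform_within_open[of _ _ _ "{..<0}"])
         (use 2 in \<open>auto simp: flat_exp_def\<close>)
    then show ?thesis using 2 by (simp add: flat_exp_def)
  next
    case 3
    \<comment> \<open>For \<open>h > 0\<close> the difference quotient at 0 is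
      \<open>flat_exp (Suc k) h\<close>, which is already known to tend to 0; for
      \<open>h < 0\<close> it vanishes.\<close>
    have "((\<lambda>h. flat_exp k h / h) \<longlongrightarrow> 0) (at 0)"
      unfolding filterlim_at_split
    proof
      show "((\<lambda>h. flat_exp k h / h) \<longlongrightarrow> 0) (at_left 0)"
        by (rule Lim_transform_eventually[OF tendsto_const])
           (auto simp: eventually_at_left_field flat_exp_def intro!: exI[of _ "-1"])
      show "((\<lambda>h. flat_exp k h / h) \<longlongrightarrow> 0) (at_right 0)"
        by (rule Lim_transform_eventually[OF flat_exp_tendsto_0[of "Suc k"]])
           (auto simp: eventually_at_right_field flat_exp_def intro!: exI[of _ 1])
    qed
    then show ?thesis using 3 by (simp add: DERIV_def flat_exp_eq_0)
  qed
qed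

text \<open>A syntactic class that contains polynomials and bumps and is closed under directional
  derivatives, so that smoothness of all members follows from one coinduction.\<close>

inductive elem_smooth :: "('a::real_normed_vector \<Rightarrow> real) \<Rightarrow> bool" where
  elem_smooth_linear: "bounded_linear f \<Longrightarrow> elem_smooth f"
| elem_smooth_const: "elem_smooth (\<lambda>x. c)"
| elem_smooth_add: "elem_smooth f \<Longrightarrow> elem_smooth g \<Longrightarrow> elem_smooth (\<lambda>x. f x + g x)"
| elem_smooth_mult: "elem_smooth f \<Longrightarrow> elem_smooth g \<Longrightarrow> elem_smooth (\<lambda>x. f x * g x)"
| elem_smooth_flat_exp: "elem_smooth f \<Longrightarrow> elem_smooth (\<lambda>x. flat_exp k (f x))"

lemma elem_smooth_has_derivative:
  assumes "elem_smooth f"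
  shows "\<exists>D. (\<forall>x. (f has_derivative D x) (at x)) \<and> (\<forall>v. elem_smooth (\<lambda>x. D x v))"
  using assms
proof induction
  case (elem_smooth_linear f)
  then show ?case
    by (intro exI[of _ "\<lambda>_. f"])
       (auto intro: bounded_linear_imp_has_derivative elem_smooth.intros)
next
  case (elem_smooth_const c)
  then show ?case
    by (intro exI[of _ "\<lambda>_ _. 0"]) (auto intro: elem_smooth.intros)
next
  case (elem_smooth_add f g)
  then obtain D E where "\<And>x. (f has_derivative D x) (at x)" "\<And>v. elem_smooth (\<lambda>x. D x v)"
    "\<And>x. (g has_derivative E x) (at x)" "\<And>v. elem_smooth (\<lambda>x. E x v)" by blast
  then show ?case
    by (intro exI[of _ "\<lambda>x v. D x v + E x v"])
       (auto intro: elem_smooth.intros intro!: has_derivative_add)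
next
  case (elem_smooth_mult f g)
  then obtain D E where "\<And>x. (f has_derivative D x) (at x)" "\<And>v. elem_smooth (\<lambda>x. D x v)"
    "\<And>x. (g has_derivative E x) (at x)" "\<And>v. elem_smooth (\<lambda>x. E x v)" by blast
  then show ?case using elem_smooth_mult.hyps
    by (intro exI[of _ "\<lambda>x v. f x * E x v + D x v * g x"])
       (auto intro!: has_derivative_mult elem_smooth.elem_smooth_add elem_smooth.elem_smooth_mult)
next
  case (elem_smooth_flat_exp f k)
  then obtain D where D: "\<And>x. (f has_derivative D x) (at x)" "\<And>v. elem_smooth (\<lambda>x. D x v)"
    by blast
  let ?D = "\<lambda>x v. (flat_exp (k + 2) (f x) + (- real k) * flat_exp (k + 1) (f x)) * D x v"
  have "((\<lambda>x. flat_exp k (f x)) has_derivative ?D x) (at x)" for x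
    using has_derivative_compose[OF D(1)
        has_derivative_flat_exp[of k "f x", unfolded has_field_derivative_def]]
    by simp
  moreover have "elem_smooth (\<lambda>x. ?D x v)" for v
    by (intro elem_smooth.intros D elem_smooth_flat_exp.hyps)
  ultimately show ?case by (intro exI[of _ ?D]) simp
qed

lemma elem_smooth_smooth_on:
  fixes f :: "'a::euclidean_space \<Rightarrow> real"
  assumes "elem_smooth f"
  shows "smooth_on UNIV f"
  using assms
proof (coinduction arbitrary: f)
  case smooth_on
  then obtain D where D: "\<And>x. (f has_derivative D x) (at x)" "\<And>v. elem_smooth (\<lambda>x. D x v)"
    using elem_smooth_has_derivative by blast
  have "frechet_derivative f (at x) = D x" for x
    using frechet_derivative_at[OF D(1)] by simp
  moreover have "f differentiable_on UNIV"
    using D(1) by (meson differentiable_on_def differentiable_def has_derivative_at_withinI)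
  ultimately show ?case using D(2) by auto
qed

lemma elem_smooth_polynomial:
  assumes "real_polynomial_function g" shows "elem_smooth g"
  using assms
proof induction
  case (linear f)
  then show ?case by (rule elem_smooth_linear)
next
  case (const c)
  show ?case by (rule elem_smooth_const)
qed (auto intro: elem_smooth_add elem_smooth_mult)

lemma elem_smooth_sum:
  assumes "finite I" "\<And>i. i \<in> I \<Longrightarrow> elem_smooth (f i)"
  shows "elem_smooth (\<lambda>x. \<Sum>i\<in>I. f i x)"
  using assms
  by (induction I rule: finite_induct) (simp_all add: elem_smooth_const elem_smooth_add)

lemma elem_smooth_continuous: "elem_smooth f \<Longrightarrow> continuous_on S f"
  using elem_smooth_has_derivative[of f]
  by (auto intro!: continuous_at_imp_continuous_on dest: has_derivative_continuous)

text \<open>The squared norm is a polynomial in the coordinates, which puts the argument of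
  \<open>flat_exp\<close> into the class.\<close>

lemma elem_smooth_bump:
  fixes a :: "'a::euclidean_space"
  shows "elem_smooth (\<lambda>x. flat_exp 0 (r\<^sup>2 - (norm (x - a))\<^sup>2))"
proof -
  have "(\<lambda>x. r\<^sup>2 - (norm (x - a))\<^sup>2)
      = (\<lambda>x. r\<^sup>2 + (-1) * (\<Sum>b\<in>Basis. (x \<bullet> b + - (a \<bullet> b)) * (x \<bullet> b + - (a \<bullet> b))))"
  proof
    fix x
    have "(norm (x - a))\<^sup>2 = (x - a) \<bullet> (x - a)"
      by (simp add: power2_norm_eq_inner)
    also have "\<dots> = (\<Sum>b\<in>Basis. (x \<bullet> b + - (a \<bullet> b)) * (x \<bullet> b + - (a \<bullet> b)))"
      by (subst euclidean_inner) (simp add: inner_diff_left)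
    finally show "r\<^sup>2 - (norm (x - a))\<^sup>2
      = r\<^sup>2 + (-1) * (\<Sum>b\<in>Basis. (x \<bullet> b + - (a \<bullet> b)) * (x \<bullet> b + - (a \<bullet> b)))" by simp
  qed
  then have "elem_smooth (\<lambda>x. r\<^sup>2 - (norm (x - a))\<^sup>2)"
    by (simp only:) (intro elem_smooth_add elem_smooth_mult elem_smooth_const elem_smooth_sum
        elem_smooth_linear bounded_linear_inner_left finite_Basis)
  then show ?thesis by (rule elem_smooth_flat_exp)
qed

lemma bump_neq_0_iff:
  assumes "r > 0"
  shows "flat_exp 0 (r\<^sup>2 - (norm (x - a))\<^sup>2) \<noteq> 0 \<longleftrightarrow> x \<in> ball a r"
proof -
  have "flat_exp 0 t \<noteq> 0 \<longleftrightarrow> t > 0" for t by (simp add: flat_exp_def)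
  moreover have "r\<^sup>2 - (norm (x - a))\<^sup>2 > 0 \<longleftrightarrow> norm (x - a) < r"
    using assms by (metis diff_gt_0_iff_gt less_eq_real_def norm_ge_zero power_less_imp_less_base power_strict_mono pos2)
  ultimately show ?thesis by (simp add: dist_norm norm_minus_commute)
qed

text \<open>Finitely many bumps of radius \<open>e\<close> cover \<open>K\<close>, with
  \<open>e\<close> so small that the closed balls stay in \<open>W\<close>. Their sum is positive on
  \<open>K\<close>, and its support lies in the finite union of these closed balls.\<close>

lemma positive_test_fun_exists:
  fixes K W :: "'a::euclidean_space set"
  assumes K: "compact K" and W: "open W" "K \<subseteq> W"
  obtains s where "elem_smooth s" "\<And>x. s x \<ge> 0" "\<And>x. x \<in> K \<Longrightarrow> s x > 0"
    "compact (closure {x. s x \<noteq> 0})" "closure {x. s x \<noteq> 0} \<subseteq> W"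
proof -
  obtain e where e: "e > 0" "(\<Union>x\<in>K. cball x e) \<subseteq> W"
    using compact_subset_open_imp_cball_epsilon_subset[OF K W] by blast
  obtain C where C: "C \<subseteq> K" "finite C" "K \<subseteq> (\<Union>c\<in>C. ball c e)"
    using compactE_image[OF K, of K "\<lambda>x. ball x e"] e(1) by (metis open_ball UN_I centre_in_ball subsetI)
  let ?s = "\<lambda>x. \<Sum>c\<in>C. flat_exp 0 (e\<^sup>2 - (norm (x - c))\<^sup>2)"
  let ?L = "\<Union>c\<in>C. cball c e"
  have cL: "compact ?L" using C by (intro compact_UN) auto
  have "{x. ?s x \<noteq> 0} \<subseteq> ?L"
  proof
    fix x assume "x \<in> {x. ?s x \<noteq> 0}"
    then obtain c where "c \<in> C" "flat_exp 0 (e\<^sup>2 - (norm (x - c))\<^sup>2) \<noteq> 0"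
      by (metis (mono_tags, lifting) mem_Collect_eq sum.neutral)
    then have "x \<in> cball c e" using bump_neq_0_iff[OF e(1), of x c] by simp
    then show "x \<in> ?L" using \<open>c \<in> C\<close> by blast
  qed
  then have cl: "closure {x. ?s x \<noteq> 0} \<subseteq> ?L"
    using cL by (simp add: closure_minimal compact_imp_closed)
  show thesis
  proof
    show "elem_smooth ?s" by (intro elem_smooth_sum C elem_smooth_bump)
    show "?s x \<ge> 0" for x by (intro sum_nonneg flat_exp_nonneg)
    show "?s x > 0" if xK: "x \<in> K" for x
    proof -
      obtain c where c: "c \<in> C" "x \<in> ball c e" using xK C(3) by blast
      then have "flat_exp 0 (e\<^sup>2 - (norm (x - c))\<^sup>2) > 0"
        using bump_neq_0_iff[OF e(1), of x c] flat_exp_nonneg by (metis order_le_less)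
      then show ?thesis using c C by (intro sum_pos2[of _ c]) (auto simp: flat_exp_nonneg)
    qed
    show "compact (closure {x. ?s x \<noteq> 0})"
      using cl cL by (metis bounded_subset closed_closure compact_eq_bounded_closed)
    show "closure {x. ?s x \<noteq> 0} \<subseteq> W" using cl e(2) C(1) by blast
  qed
qed

text \<open>A substitute for mollification: on the support of a positive test function
  \<open>s\<close> the quotient \<open>\<psi> / s\<close> is continuous, so Stone-Weierstrass gives
  a polynomial \<open>g\<close> near it, and \<open>s * g\<close> is a test function near
  \<open>\<psi>\<close>.\<close>

lemma test_fun_approx:
  fixes \<psi> :: "'a::euclidean_space \<Rightarrow> real"
  assumes K: "compact K" and W: "open W" "K \<subseteq> W"
    and \<psi>: "continuous_on UNIV \<psi>" "\<And>x. x \<notin> K \<Longrightarrow> \<psi> x = 0" and \<epsilon>: "\<epsilon> > 0"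
  obtains \<phi> where "test_fun W \<phi>" "\<And>x. \<bar>\<psi> x - \<phi> x\<bar> \<le> \<epsilon>"
proof -
  obtain s where s: "elem_smooth s" "\<And>x. s x \<ge> 0" "\<And>x. x \<in> K \<Longrightarrow> s x > 0"
    "compact (closure {x. s x \<noteq> 0})" "closure {x. s x \<noteq> 0} \<subseteq> W"
    using positive_test_fun_exists[OF K W] by metis
  let ?L = "closure {x. s x \<noteq> 0}"
  have cs: "continuous_on S s" for S by (rule elem_smooth_continuous[OF s(1)])
  have op: "open {x. s x \<noteq> 0}"
    using cs[of UNIV] by (simp add: open_Collect_neq)
  \<comment> \<open>The boundary points of the support of \<open>s\<close>, where \<open>s\<close>
    vanishes, lie outside \<open>K\<close>. There the quotient is 0, division by zero included, so
    the two open sets together cover the support.\<close>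
  have "continuous_on ({x. s x \<noteq> 0} \<union> - K) (\<lambda>x. \<psi> x / s x)"
  proof (rule continuous_on_open_Un[OF op])
    show "open (- K)" using K by (simp add: compact_imp_closed open_Compl)
    show "continuous_on {x. s x \<noteq> 0} (\<lambda>x. \<psi> x / s x)"
      by (intro continuous_intros cs continuous_on_subset[OF \<psi>(1)]) auto
    show "continuous_on (- K) (\<lambda>x. \<psi> x / s x)"
      by (rule continuous_on_eq[OF continuous_on_const[of _ 0]]) (use \<psi>(2) in auto)
  qed
  then have cq: "continuous_on ?L (\<lambda>x. \<psi> x / s x)"
    by (rule continuous_on_subset) (use s(3) in force)
  obtain B where B: "\<And>x. x \<in> ?L \<Longrightarrow> s x \<le> B"
    using compact_continuous_image[OF cs s(4)] compact_imp_bounded bounded_imp_bdd_above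
    by (meson bdd_above.E imageI)
  \<comment> \<open>The polynomial error is multiplied by \<open>s x \<le> B\<close> at the end; the
    maximum with 1 guards against a nonpositive \<open>B\<close>.\<close>
  have B0: "max B 1 > 0" by simp
  then have eB: "\<epsilon> / max B 1 > 0" using \<epsilon> by simp
  obtain g where g: "real_polynomial_function g" "\<And>x. x \<in> ?L \<Longrightarrow> \<bar>\<psi> x / s x - g x\<bar> < \<epsilon> / max B 1"
    using Stone_Weierstrass_real_polynomial_function[OF s(4) cq eB] by blast
  show thesis
  proof
    have sub: "closure {x. s x * g x \<noteq> 0} \<subseteq> ?L" by (rule closure_mono) auto
    show "test_fun W (\<lambda>x. s x * g x)"
      unfolding test_fun_def
    proof (intro conjI)
      show "smooth_on UNIV (\<lambda>x. s x * g x)"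
        by (intro elem_smooth_smooth_on elem_smooth.intros s elem_smooth_polynomial g)
      show "compact (closure {x. s x * g x \<noteq> 0})"
        using sub s(4) by (metis bounded_subset closed_closure compact_eq_bounded_closed)
      show "closure {x. s x * g x \<noteq> 0} \<subseteq> W" using sub s(5) by blast
    qed
    fix x
    show "\<bar>\<psi> x - s x * g x\<bar> \<le> \<epsilon>"
    proof (cases "s x = 0")
      case True
      then have "\<psi> x = 0" using s(3)[of x] \<psi>(2)[of x] by fastforce
      then show ?thesis using True \<epsilon> by simp
    next
      case False
      then have xL: "x \<in> ?L" using closure_subset[of "{x. s x \<noteq> 0}"] by auto
      have "\<psi> x - s x * g x = s x * (\<psi> x / s x - g x)"
        using False by (simp add: right_diff_distrib)
      then have "\<bar>\<psi> x - s x * g x\<bar> = s x * \<bar>\<psi> x / s x - g x\<bar>"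
        using s(2)[of x] by (simp only: abs_mult abs_of_nonneg)
      also have "\<dots> \<le> max B 1 * (\<epsilon> / max B 1)"
        using g(2)[OF xL] B[OF xL] s(2)[of x] B0 by (intro mult_mono) auto
      finally show ?thesis by simp
    qed
  qed
qed

section \<open>Derivatives and translates of test functions\<close>

lemma smooth_on_UNIV_derivative:
  assumes "smooth_on UNIV \<phi>"
  shows "(\<phi> has_derivative frechet_derivative \<phi> (at x)) (at x)"
    and "continuous_on UNIV \<phi>"
    and "continuous_on UNIV (\<lambda>x. frechet_derivative \<phi> (at x) v)"
proof -
  have d: "\<phi> differentiable_on UNIV" "smooth_on UNIV (\<lambda>x. frechet_derivative \<phi> (at x) v)"
    using assms by (auto elim: smooth_on.cases)
  show "(\<phi> has_derivative frechet_derivative \<phi> (at x)) (at x)"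
    using d(1) by (simp add: differentiable_on_def frechet_derivative_works[symmetric])
  show "continuous_on UNIV \<phi>" using d(1) by (rule differentiable_imp_continuous_on)
  have "(\<lambda>x. frechet_derivative \<phi> (at x) v) differentiable_on UNIV"
    using d(2) by (auto elim: smooth_on.cases)
  then show "continuous_on UNIV (\<lambda>x. frechet_derivative \<phi> (at x) v)"
    by (rule differentiable_imp_continuous_on)
qed

lemma frechet_derivative_translate:
  assumes "smooth_on UNIV \<phi>"
  shows "frechet_derivative (\<lambda>x. \<phi> (x + c)) (at x) = frechet_derivative \<phi> (at (x + c))"
proof -
  have "((\<lambda>x. x + c) has_derivative (\<lambda>h. h)) (at x)"
    by (auto intro!: derivative_eq_intros)
  from has_derivative_compose[OF this smooth_on_UNIV_derivative(1)[OF assms]]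
  show ?thesis by (metis frechet_derivative_at)
qed

lemma smooth_on_translate:
  assumes "smooth_on UNIV \<phi>"
  shows "smooth_on UNIV (\<lambda>x. \<phi> (x + c))"
  using assms
proof (coinduction arbitrary: \<phi>)
  case smooth_on
  have "((\<lambda>x. \<phi> (x + c)) has_derivative frechet_derivative \<phi> (at (x + c))) (at x)" for x
  proof -
    have "((\<lambda>x. x + c) has_derivative (\<lambda>h. h)) (at x)"
      by (auto intro!: derivative_eq_intros)
    from has_derivative_compose[OF this smooth_on_UNIV_derivative(1)[OF smooth_on]]
    show ?thesis .
  qed
  moreover have "smooth_on UNIV (\<lambda>x. frechet_derivative \<phi> (at x) v)" for v
    using smooth_on by (auto elim: smooth_on.cases)
  ultimately show ?case
    by (auto simp: differentiable_on_def differentiable_def frechet_derivative_translate[OF smooth_on])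
qed

lemma smooth_directional_derivative:
  assumes "smooth_on UNIV \<phi>"
  shows "((\<lambda>t. \<phi> (x + t *\<^sub>R e)) has_real_derivative frechet_derivative \<phi> (at (x + t *\<^sub>R e)) e) (at t)"
proof -
  have "((\<lambda>t. x + t *\<^sub>R e) has_derivative (\<lambda>h. h *\<^sub>R e)) (at t)"
    by (auto intro!: derivative_eq_intros)
  from has_derivative_compose[OF this smooth_on_UNIV_derivative(1)[OF assms]]
  have "((\<lambda>t. \<phi> (x + t *\<^sub>R e)) has_derivative (\<lambda>h. frechet_derivative \<phi> (at (x + t *\<^sub>R e)) (h *\<^sub>R e))) (at t)" .
  moreover have "linear (frechet_derivative \<phi> (at y))" for y
    using smooth_on_UNIV_derivative(1)[OF assms] has_derivative_linear by blast
  ultimately show ?thesis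
    by (simp add: has_field_derivative_def linear_scale mult.commute[of "frechet_derivative \<phi> _ _"] mult_commute_abs)
qed

lemma frechet_derivative_outside_support:
  assumes "x \<notin> closure {x. \<phi> x \<noteq> (0::real)}"
  shows "frechet_derivative \<phi> (at x) = (\<lambda>_. 0)"
proof -
  have "(\<phi> has_derivative (\<lambda>_. 0)) (at x)"
    by (rule has_derivative_transform_within_open[of "\<lambda>_. 0" _ x UNIV "- closure {x. \<phi> x \<noteq> 0}"])
       (use assms closure_subset[of "{x. \<phi> x \<noteq> 0}"] in auto)
  then show ?thesis by (metis frechet_derivative_at)
qed

lemma test_fun_translate:
  assumes "test_fun W \<phi>" "\<And>x. x \<in> closure {x. \<phi> x \<noteq> 0} \<Longrightarrow> x - c \<in> \<Omega>"
  shows "test_fun \<Omega> (\<lambda>x. \<phi> (x + c))"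
proof -
  have eq: "{x. \<phi> (x + c) \<noteq> 0} = (\<lambda>x. - c + x) ` {x. \<phi> x \<noteq> 0}" 
    by (auto simp: image_iff) (metis add.commute add_diff_cancel_left' diff_add_cancel uminus_add_conv_diff)
  show ?thesis
    using assms compact_translation[of "closure {x. \<phi> x \<noteq> 0}" "- c"]
    unfolding test_fun_def eq closure_translation
    by (auto intro: smooth_on_translate simp del: compact_closure)
qed

lemma test_fun_mono: "test_fun W \<phi> \<Longrightarrow> W \<subseteq> \<Omega> \<Longrightarrow> test_fun \<Omega> \<phi>"
  unfolding test_fun_def by blast

section \<open>Local integrability and the fundamental lemma of the calculus of variations\<close>

lemma bounded_subset_cball_0:
  fixes S :: "'a::real_normed_vector set"
  assumes "bounded S" obtains R where "R > 0" "S \<subseteq> cball 0 R"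
  using bounded_subset_ballD[OF assms, of 0] ball_subset_cball by blast

locale open_domain =
  fixes \<Omega> :: "'a::euclidean_space set"
  assumes open_domain: "open \<Omega>"
begin

lemma domain_sets [simp]: "\<Omega> \<in> sets lebesgue"
  using open_domain by (simp add: borel_open)

text \<open>Integrability is required on all bounded parts of \<open>\<Omega>\<close>, up to its
  boundary, and not only on compact subsets. Measurable functions with integrable p-th power satisfy
  this, and integration against a bounded measurable function then only asks for bounded
  support.\<close>

definition locally_integrable :: "('a \<Rightarrow> real) \<Rightarrow> bool" where
  "locally_integrable f \<longleftrightarrow>
     (\<forall>R. integrable (lebesgue_on \<Omega>) (\<lambda>x. indicator (cball 0 R) x * f x))"

lemma continuous_measurable:
  fixes \<theta> :: "'a \<Rightarrow> 'b::euclidean_space"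
  shows "continuous_on UNIV \<theta> \<Longrightarrow> \<theta> \<in> borel_measurable (lebesgue_on \<Omega>)"
  by (rule continuous_imp_measurable_on_sets_lebesgue) (auto intro: continuous_on_subset)

lemma
  assumes f: "locally_integrable f" and \<theta>: "\<theta> \<in> borel_measurable (lebesgue_on \<Omega>)"
    and B: "\<And>x. \<bar>\<theta> x\<bar> \<le> B" and R: "\<And>x. x \<notin> cball 0 R \<Longrightarrow> \<theta> x = 0"
  shows locally_integrable_mult: "integrable (lebesgue_on \<Omega>) (\<lambda>x. f x * \<theta> x)"
    and locally_integrable_mult_bound: "\<bar>LINT x|lebesgue_on \<Omega>. f x * \<theta> x\<bar>
          \<le> B * (LINT x|lebesgue_on \<Omega>. indicator (cball 0 R) x * \<bar>f x\<bar>)"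
proof -
  let ?M = "lebesgue_on \<Omega>" and ?f = "\<lambda>x. indicator (cball 0 R) x * f x"
  have eq: "(\<lambda>x. f x * \<theta> x) = (\<lambda>x. ?f x * \<theta> x)"
    using R by (auto simp: indicator_def fun_eq_iff)
  have f': "integrable ?M ?f" using f by (simp add: locally_integrable_def)
  have bnd: "norm (?f x * \<theta> x) \<le> B * \<bar>?f x\<bar>" for x
    using mult_right_mono[OF B[of x], of "\<bar>?f x\<bar>"] by (simp add: abs_mult mult.commute)
  have iB: "integrable ?M (\<lambda>x. B * \<bar>?f x\<bar>)" using f' by simp
  show int: "integrable ?M (\<lambda>x. f x * \<theta> x)"
    unfolding eq
    by (rule Bochner_Integration.integrable_bound[OF iB])
       (use borel_measurable_integrable[OF f'] \<theta> bnd in \<open>auto intro: order_trans[OF _ abs_ge_self]\<close>)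
  have "\<bar>LINT x|?M. f x * \<theta> x\<bar> \<le> (LINT x|?M. B * \<bar>?f x\<bar>)"
    using integral_abs_bound_integral[OF int iB] bnd eq by (metis (no_types, lifting) real_norm_def)
  also have "\<dots> = B * (LINT x|?M. \<bar>?f x\<bar>)" by simp
  also have "(\<lambda>x. \<bar>?f x\<bar>) = (\<lambda>x. indicator (cball 0 R) x * \<bar>f x\<bar>)"
    by (auto simp: abs_mult)
  finally show "\<bar>LINT x|?M. f x * \<theta> x\<bar> \<le> B * (LINT x|?M. indicator (cball 0 R) x * \<bar>f x\<bar>)" .
qed

lemma continuous_bounded_support_bound:
  fixes \<theta> :: "'a \<Rightarrow> real"
  assumes \<theta>: "continuous_on UNIV \<theta>" and R: "\<And>x. x \<notin> cball 0 R \<Longrightarrow> \<theta> x = 0"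
  obtains B where "B \<ge> 0" "\<And>x. \<bar>\<theta> x\<bar> \<le> B"
proof -
  have "bounded (\<theta> ` cball 0 R)"
    by (intro compact_imp_bounded compact_continuous_image continuous_on_subset[OF \<theta>]) auto
  then obtain B where B: "\<And>x. x \<in> cball 0 R \<Longrightarrow> \<bar>\<theta> x\<bar> \<le> B"
    unfolding bounded_iff by (metis imageI real_norm_def)
  have "\<bar>\<theta> x\<bar> \<le> max B 0" for x using B[of x] R[of x] by (cases "x \<in> cball 0 R") auto
  then show thesis by (intro that[of "max B 0"]) auto
qed

lemma locally_integrable_mult_continuous:
  assumes "locally_integrable f" "continuous_on UNIV \<theta>" "\<And>x. x \<notin> cball 0 R \<Longrightarrow> \<theta> x = 0"
  shows "integrable (lebesgue_on \<Omega>) (\<lambda>x. f x * \<theta> x)"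
proof -
  obtain B where "\<And>x. \<bar>\<theta> x\<bar> \<le> B"
    using continuous_bounded_support_bound[OF assms(2,3)] by metis
  from locally_integrable_mult[OF assms(1) continuous_measurable[OF assms(2)] this assms(3)]
  show ?thesis by simp
qed

lemma continuous_locally_integrable:
  assumes "continuous_on UNIV f" shows "locally_integrable f"
  unfolding locally_integrable_def
proof
  fix R
  have "integrable lborel (\<lambda>x. indicator (cball 0 R) x *\<^sub>R f x)"
    by (rule borel_integrable_compact) (auto intro: continuous_on_subset[OF assms])
  then have "integrable lebesgue (\<lambda>x. indicator (cball 0 R) x *\<^sub>R f x)"
    by (simp add: integrable_completion borel_measurable_integrable)
  then have "integrable lebesgue (\<lambda>x. indicator \<Omega> x *\<^sub>R (indicator (cball 0 R) x *\<^sub>R f x))"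
    by (intro integrable_mult_indicator[OF domain_sets])
  then show "integrable (lebesgue_on \<Omega>) (\<lambda>x. indicator (cball 0 R) x * f x)"
    by (subst integrable_restrict_space) auto
qed

lemma test_fun_support:
  fixes \<phi> :: "'a \<Rightarrow> real"
  assumes "test_fun W \<phi>"
  obtains R where "R > 0" "closure {x. \<phi> x \<noteq> 0} \<subseteq> cball 0 R" "\<And>x. x \<notin> cball 0 R \<Longrightarrow> \<phi> x = 0"
    "\<And>x v. x \<notin> cball 0 R \<Longrightarrow> frechet_derivative \<phi> (at x) v = 0"
proof -
  have "bounded (closure {x. \<phi> x \<noteq> 0})"
    using assms by (auto simp: test_fun_def)
  then obtain R where R: "R > 0" "closure {x. \<phi> x \<noteq> 0} \<subseteq> cball 0 R"
    by (metis bounded_subset_cball_0)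
  show thesis
  proof
    show "R > 0" "closure {x. \<phi> x \<noteq> 0} \<subseteq> cball 0 R" by (fact R)+
    fix x :: 'a assume x: "x \<notin> cball 0 R"
    then show "frechet_derivative \<phi> (at x) v = 0" for v
      using R(2) frechet_derivative_outside_support[of x \<phi>] by (metis subsetD)
    show "\<phi> x = 0" using x R(2) closure_subset[of "{x. \<phi> x \<noteq> 0}"] by auto
  qed
qed

text \<open>All regularity sits in \<open>\<phi>\<close>; \<open>f\<close> is merely integrated. The
  difference quotients of \<open>\<phi>\<close> are bounded by a Lipschitz constant, so dominated
  convergence along an arbitrary null sequence gives the limit.\<close>

lemma has_derivative_integral_translate:
  assumes f: "locally_integrable f" and \<phi>: "test_fun W \<phi>"
  shows "((\<lambda>t. LINT x|lebesgue_on \<Omega>. f x * \<phi> (x + t *\<^sub>R e)) has_real_derivative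
     (LINT x|lebesgue_on \<Omega>. f x * frechet_derivative \<phi> (at (x + t *\<^sub>R e)) e)) (at t)"
proof -
  let ?M = "lebesgue_on \<Omega>" and ?D = "\<lambda>x. frechet_derivative \<phi> (at x) e"
  have sm: "smooth_on UNIV \<phi>" using \<phi> by (simp add: test_fun_def)
  obtain R where R: "R > 0" "\<And>x. x \<notin> cball 0 R \<Longrightarrow> \<phi> x = 0" "\<And>x. x \<notin> cball 0 R \<Longrightarrow> ?D x = 0"
    using test_fun_support[OF \<phi>] by metis
  obtain B where B: "B \<ge> 0" "\<And>x. \<bar>?D x\<bar> \<le> B"
    using continuous_bounded_support_bound[OF smooth_on_UNIV_derivative(3)[OF sm] R(3)] by metis
  have lip: "\<bar>\<phi> (x + s *\<^sub>R e) - \<phi> (x + t *\<^sub>R e)\<bar> \<le> B * \<bar>s - t\<bar>" for x s t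
    using field_differentiable_bound[of UNIV "\<lambda>t. \<phi> (x + t *\<^sub>R e)" "\<lambda>t. ?D (x + t *\<^sub>R e)" B s t]
      smooth_directional_derivative[OF sm] B by auto
  have c\<phi>: "continuous_on UNIV (\<lambda>x. \<phi> (x + c))" for c
    by (rule continuous_on_compose2[OF smooth_on_UNIV_derivative(2)[OF sm]])
       (auto intro!: continuous_intros)
  have out: "\<phi> (x + s *\<^sub>R e) = 0" if "x \<notin> cball 0 (R + \<bar>s\<bar> * norm e)" for x s
  proof -
    have "norm x \<le> norm (x + s *\<^sub>R e) + norm (s *\<^sub>R e)" by (metis add_diff_cancel norm_triangle_ineq4)
    then show ?thesis using that by (intro R(2)) auto
  qed
  have int: "integrable ?M (\<lambda>x. f x * \<phi> (x + s *\<^sub>R e))" for s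
    using locally_integrable_mult_continuous[OF f c\<phi> out] .
  show ?thesis
    unfolding DERIV_def tendsto_at_iff_sequentially
  proof (intro allI impI, unfold comp_def)
    fix X :: "nat \<Rightarrow> real"
    assume X: "\<forall>i. X i \<in> UNIV - {0}" "X \<longlonglongrightarrow> 0"
    have "Bseq X" using X(2) by (meson convergentI convergent_imp_Bseq)
    then obtain b where b: "b > 0" "\<And>i. \<bar>X i\<bar> \<le> b" unfolding Bseq_def by auto
    \<comment> \<open>\<open>b\<close> bounds the null sequence, so outside this radius the
      translates by \<open>t\<close> and by all \<open>t + X i\<close> vanish together. This makes
      the dominating function independent of \<open>i\<close>.\<close>
    define Q where "Q = R + (\<bar>t\<bar> + b) * norm e"
    let ?s = "\<lambda>i x. f x * ((\<phi> (x + (t + X i) *\<^sub>R e) - \<phi> (x + t *\<^sub>R e)) / X i)"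
    have s: "((LINT x|?M. f x * \<phi> (x + (t + X i) *\<^sub>R e)) - (LINT x|?M. f x * \<phi> (x + t *\<^sub>R e))) / X i
        = (LINT x|?M. ?s i x)" for i
    proof -
      have "(LINT x|?M. ?s i x)
          = (LINT x|?M. (f x * \<phi> (x + (t + X i) *\<^sub>R e) - f x * \<phi> (x + t *\<^sub>R e)) / X i)"
        by (simp add: right_diff_distrib)
      then show ?thesis using int[of "t + X i"] int[of t]
        by (simp only: integral_divide_zero Bochner_Integration.integral_diff)
    qed
    have i: "integrable ?M (\<lambda>x. B * \<bar>indicator (cball 0 Q) x * f x\<bar>)"
      using f by (simp add: locally_integrable_def)
    have bd: "norm (?s i x) \<le> B * \<bar>indicator (cball 0 Q) x * f x\<bar>" for i x
    proof (cases "x \<in> cball 0 Q")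
      case True
      have "\<bar>(\<phi> (x + (t + X i) *\<^sub>R e) - \<phi> (x + t *\<^sub>R e)) / X i\<bar> \<le> B"
        using lip[of x "t + X i" t] X(1) by (simp add: divide_le_eq)
      from mult_left_mono[OF this, of "\<bar>f x\<bar>"] True show ?thesis
        by (simp add: abs_mult mult.commute)
    next
      case False
      have "(\<bar>t + X i\<bar>) * norm e \<le> (\<bar>t\<bar> + b) * norm e" "\<bar>t\<bar> * norm e \<le> (\<bar>t\<bar> + b) * norm e"
        using b(2)[of i] b(1) by (auto intro!: mult_right_mono)
      then have "x \<notin> cball 0 (R + \<bar>t + X i\<bar> * norm e)" "x \<notin> cball 0 (R + \<bar>t\<bar> * norm e)"
        using False unfolding Q_def by auto
      then show ?thesis using out[of x "t + X i"] out[of x t] False by simp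
    qed
    have lim: "(\<lambda>i. ?s i x) \<longlonglongrightarrow> f x * ?D (x + t *\<^sub>R e)" for x
      using smooth_directional_derivative[OF sm, of x e t] X
      unfolding DERIV_def tendsto_at_iff_sequentially comp_def
      by (intro tendsto_intros) auto
    have mD: "(\<lambda>x. f x * ?D (x + t *\<^sub>R e)) \<in> borel_measurable ?M"
    proof (rule borel_measurable_LIMSEQ_real[OF lim])
      show "?s i \<in> borel_measurable ?M" for i
        using borel_measurable_integrable[OF int[of "t + X i"]] borel_measurable_integrable[OF int[of t]]
        by (simp add: right_diff_distrib diff_divide_distrib)
    qed
    show "(\<lambda>i. ((LINT x|?M. f x * \<phi> (x + (t + X i) *\<^sub>R e)) - (LINT x|?M. f x * \<phi> (x + t *\<^sub>R e))) / X i)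
       \<longlonglongrightarrow> (LINT x|?M. f x * ?D (x + t *\<^sub>R e))"
      unfolding s
    proof (rule integral_dominated_convergence[OF mD _ i])
      show "?s i \<in> borel_measurable ?M" for i
        using borel_measurable_integrable[OF int[of "t + X i"]] borel_measurable_integrable[OF int[of t]]
        by (simp add: right_diff_distrib diff_divide_distrib)
    qed (use lim bd in auto)
  qed
qed

text \<open>Uniform approximation by test functions suffices because all approximants stay in one
  bounded neighbourhood of \<open>K\<close>, where \<open>f\<close> is integrable: the error is at
  most \<open>\<epsilon> * C\<close> with \<open>C\<close> fixed in advance.\<close>

lemma integral_continuous_eq_0:
  assumes f: "locally_integrable f" and K: "compact K" "K \<subseteq> \<Omega>"
    and \<psi>: "continuous_on UNIV \<psi>" "\<And>x. x \<notin> K \<Longrightarrow> \<psi> x = 0"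
    and 0: "\<And>\<phi>. test_fun \<Omega> \<phi> \<Longrightarrow> (LINT x|lebesgue_on \<Omega>. f x * \<phi> x) = 0"
  shows "(LINT x|lebesgue_on \<Omega>. f x * \<psi> x) = 0"
proof -
  let ?M = "lebesgue_on \<Omega>"
  obtain r where r: "r > 0" "(\<Union>x\<in>K. cball x r) \<subseteq> \<Omega>"
    using compact_subset_open_imp_cball_epsilon_subset[OF K(1) open_domain K(2)] by blast
  obtain R where R: "K \<subseteq> cball 0 R"
    using K(1) by (meson bounded_subset_cball_0 compact_imp_bounded)
  let ?W = "\<Union>x\<in>K. ball x r"
  have W: "open ?W" "K \<subseteq> ?W" "?W \<subseteq> \<Omega>" "?W \<subseteq> cball 0 (R + r)"
  proof -
    show "?W \<subseteq> cball 0 (R + r)"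
    proof
      fix y assume "y \<in> ?W"
      then obtain k where "k \<in> K" "dist k y < r" by auto
      moreover have "norm y \<le> norm k + dist k y"
        by (metis dist_commute dist_norm norm_triangle_sub)
      ultimately show "y \<in> cball 0 (R + r)" using R by fastforce
    qed
    show "K \<subseteq> ?W" using r(1) by force
    show "?W \<subseteq> \<Omega>" using r(2) ball_subset_cball by fast
  qed blast
  define C where "C = (LINT x|?M. indicator (cball 0 (R + r)) x * \<bar>f x\<bar>)"
  have "\<bar>LINT x|?M. f x * \<psi> x\<bar> \<le> \<epsilon> * C" if \<epsilon>: "\<epsilon> > 0" for \<epsilon>
  proof -
    obtain \<phi> where \<phi>: "test_fun ?W \<phi>" "\<And>x. \<bar>\<psi> x - \<phi> x\<bar> \<le> \<epsilon>"
      using test_fun_approx[OF K(1) W(1,2) \<psi> \<epsilon>] by metis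
    have \<phi>\<Omega>: "test_fun \<Omega> \<phi>" using test_fun_mono[OF \<phi>(1) W(3)] .
    have zero: "\<psi> x = 0" "\<phi> x = 0" if "x \<notin> cball 0 (R + r)" for x
    proof -
      show "\<psi> x = 0" using that W \<psi>(2) by blast
      have "x \<notin> closure {x. \<phi> x \<noteq> 0}" using that W(4) \<phi>(1) unfolding test_fun_def by blast
      then show "\<phi> x = 0" using closure_subset[of "{x. \<phi> x \<noteq> 0}"] by auto
    qed
    have c: "continuous_on UNIV \<phi>"
      using \<phi>(1) smooth_on_UNIV_derivative(2) by (auto simp: test_fun_def)
    have i: "integrable ?M (\<lambda>x. f x * \<psi> x)" "integrable ?M (\<lambda>x. f x * \<phi> x)"
      using locally_integrable_mult_continuous[OF f \<psi>(1) zero(1)]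
        locally_integrable_mult_continuous[OF f c zero(2)] by auto
    have "(LINT x|?M. f x * \<psi> x) = (LINT x|?M. f x * (\<psi> x - \<phi> x))"
      using 0[OF \<phi>\<Omega>] i by (simp add: right_diff_distrib)
    also have "\<bar>\<dots>\<bar> \<le> \<epsilon> * C"
      unfolding C_def using f \<phi>(2) zero
      by (intro locally_integrable_mult_bound continuous_measurable continuous_intros \<psi>(1) c) auto
    finally show ?thesis .
  qed
  moreover have "C \<ge> 0" unfolding C_def by simp
  ultimately have "\<bar>LINT x|?M. f x * \<psi> x\<bar> \<le> \<epsilon>" if "\<epsilon> > 0" for \<epsilon>
  proof -
    have "\<bar>LINT x|?M. f x * \<psi> x\<bar> \<le> \<epsilon> / (C + 1) * C"
      using that \<open>C \<ge> 0\<close> by (intro \<open>\<And>\<epsilon>. 0 < \<epsilon> \<Longrightarrow> \<bar>LINT x|?M. f x * \<psi> x\<bar> \<le> \<epsilon> * C\<close>) simp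
    also have "\<dots> \<le> \<epsilon>" using that \<open>C \<ge> 0\<close> by (simp add: field_simps)
    finally show ?thesis .
  qed
  then show ?thesis by (metis abs_le_zero_iff field_le_epsilon add_0)
qed

lemma integral_compact_eq_0:
  assumes f: "locally_integrable f" and K: "compact K" "K \<subseteq> \<Omega>"
    and 0: "\<And>\<phi>. test_fun \<Omega> \<phi> \<Longrightarrow> (LINT x|lebesgue_on \<Omega>. f x * \<phi> x) = 0"
  shows "(LINT x|lebesgue_on \<Omega>. f x * indicator K x) = 0"
proof (cases "K = {}")
  case False
  let ?M = "lebesgue_on \<Omega>"
  obtain r where r: "r > 0" "(\<Union>x\<in>K. cball x r) \<subseteq> \<Omega>"
    using compact_subset_open_imp_cball_epsilon_subset[OF K(1) open_domain K(2)] by blast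
  let ?L = "{x. infdist x K \<le> r}"
  have L: "compact ?L" using compact_infdist_le[OF False K(1) r(1)] .
  have LO: "?L \<subseteq> \<Omega>"
  proof
    fix x assume "x \<in> ?L"
    moreover obtain y where "y \<in> K" "infdist x K = dist x y"
      using infdist_attains_inf[of K x] K False compact_imp_closed by metis
    ultimately show "x \<in> \<Omega>" using r(2) by (auto simp: subset_iff dist_commute)
  qed
  obtain R where R: "?L \<subseteq> cball 0 R"
    using L by (meson bounded_subset_cball_0 compact_imp_bounded)
  \<comment> \<open>Steepening cones over \<open>K\<close> that decrease to its indicator. The
    summand \<open>1 / r\<close> keeps the support in \<open>?L\<close> already for
    \<open>n = 0\<close>.\<close>
  define \<psi> where "\<psi> n x = max 0 (1 - (real n + 1 / r) * infdist x K)" for n x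
  have c: "continuous_on UNIV (\<psi> n)" for n
    unfolding \<psi>_def by (intro continuous_intros)
  have out: "\<psi> n x = 0" if "x \<notin> ?L" for n x
  proof -
    have "1 \<le> (1 / r) * infdist x K" using that r(1) by (simp add: field_simps)
    also have "\<dots> \<le> (real n + 1 / r) * infdist x K"
      by (intro mult_right_mono) (auto simp: infdist_nonneg)
    finally show ?thesis by (simp add: \<psi>_def)
  qed
  have out': "\<psi> n x = 0" if "x \<notin> cball 0 R" for n x
    using out that R by blast
  have b: "\<bar>\<psi> n x\<bar> \<le> 1" for n x
    using r(1) by (auto simp: \<psi>_def infdist_nonneg)
  have lim: "(\<lambda>n. \<psi> n x) \<longlonglongrightarrow> indicator K x" for x
  proof (cases "x \<in> K")
    case True
    then show ?thesis by (simp add: \<psi>_def)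
  next
    case False
    then have pos: "infdist x K > 0"
      using K(1) \<open>K \<noteq> {}\<close> infdist_pos_not_in_closed compact_imp_closed by blast
    then obtain N where N: "1 < real N * infdist x K"
      using reals_Archimedean3 by blast
    have "\<psi> n x = 0" if "n \<ge> N" for n
    proof -
      have "1 < real N * infdist x K" by fact
      also have "\<dots> \<le> (real n + 1 / r) * infdist x K"
        using that r(1) pos by (intro mult_right_mono) (auto intro: order_trans[of _ "real n"])
      finally show ?thesis by (simp add: \<psi>_def)
    qed
    then have "\<forall>\<^sub>F n in sequentially. \<psi> n x = indicator K x"
      using False by (auto simp: eventually_sequentially)
    then show ?thesis by (rule tendsto_eventually)
  qed
  have Km: "indicator K \<in> borel_measurable ?M"
    using K by (auto intro!: borel_measurable_indicator simp: sets_restrict_space_iff borel_compact)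
  have f1: "integrable ?M (\<lambda>x. \<bar>indicator (cball 0 R) x * f x\<bar>)"
    using f by (simp add: locally_integrable_def)
  have "(\<lambda>n. LINT x|?M. f x * \<psi> n x) \<longlonglongrightarrow> (LINT x|?M. f x * indicator K x)"
  proof (rule integral_dominated_convergence[OF _ _ f1])
    have "K \<subseteq> ?L" using r(1) by auto
    then have "indicator K x = (0::real)" if "x \<notin> cball 0 R" for x using R that by (auto simp: indicator_def)
    then show "(\<lambda>x. f x * indicator K x) \<in> borel_measurable ?M"
      using locally_integrable_mult[OF f Km, of 1 R] by (auto simp: indicator_def)
    show "(\<lambda>x. f x * \<psi> n x) \<in> borel_measurable ?M" for n
      using locally_integrable_mult_continuous[OF f c out'] by auto
    show "AE x in ?M. (\<lambda>n. f x * \<psi> n x) \<longlonglongrightarrow> f x * indicator K x"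
      by (intro AE_I2 tendsto_intros lim)
    show "AE x in ?M. norm (f x * \<psi> n x) \<le> \<bar>indicator (cball 0 R) x * f x\<bar>" for n
    proof (rule AE_I2)
      fix x
      show "norm (f x * \<psi> n x) \<le> \<bar>indicator (cball 0 R) x * f x\<bar>"
        using mult_left_mono[OF b[of n x], of "\<bar>f x\<bar>"] out'[of x n]
        by (cases "x \<in> cball 0 R") (auto simp: abs_mult)
    qed
  qed
  moreover have "(LINT x|?M. f x * \<psi> n x) = 0" for n
    by (rule integral_continuous_eq_0[OF f L LO c out 0])
  ultimately show ?thesis by (simp add: LIMSEQ_unique[OF _ tendsto_const])
qed simp

text \<open>By inner regularity the set where \<open>f\<close> is positive is, up to small measure,
  a closed set and hence a countable union of compact sets. On each of these a positive integrand
  has integral 0, which is possible only on a null set.\<close>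

lemma AE_nonpos_of_integral_compact_eq_0:
  assumes f: "locally_integrable f" and fm: "f \<in> borel_measurable (lebesgue_on \<Omega>)"
    and 0: "\<And>K. compact K \<Longrightarrow> K \<subseteq> \<Omega> \<Longrightarrow> (LINT x|lebesgue_on \<Omega>. f x * indicator K x) = 0"
  shows "AE x in lebesgue_on \<Omega>. f x \<le> 0"
proof -
  let ?M = "lebesgue_on \<Omega>" and ?S = "{x \<in> \<Omega>. f x > 0}"
  have S: "?S \<in> sets lebesgue"
  proof -
    have "{x \<in> space ?M. f x > 0} \<in> sets ?M" using fm by measurable
    then show ?thesis by (simp add: sets_restrict_space_iff)
  qed
  have K0: "emeasure lebesgue K = 0" if K: "compact K" "K \<subseteq> ?S" for K
  proof -
    have K': "K \<in> sets lebesgue" using K(1) by (simp add: borel_compact)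
    have Km: "indicator K \<in> borel_measurable ?M"
      using K K' by (auto intro!: borel_measurable_indicator simp: sets_restrict_space_iff)
    obtain R where R: "K \<subseteq> cball 0 R"
      using K(1) by (meson bounded_subset_cball_0 compact_imp_bounded)
    have i: "integrable ?M (\<lambda>x. f x * indicator K x)"
      by (rule locally_integrable_mult[OF f Km, of 1 R]) (use R in \<open>auto simp: indicator_def\<close>)
    have "AE x in ?M. f x * indicator K x = 0"
      using 0[of K] K by (subst integral_nonneg_eq_0_iff_AE[OF i, symmetric])
        (auto simp: indicator_def subset_iff less_imp_le)
    then have "AE x in lebesgue. x \<in> \<Omega> \<longrightarrow> f x * indicator K x = 0"
      by (simp add: AE_restrict_space_iff)
    then have "AE x in lebesgue. x \<notin> K"
      by eventually_elim (use K(2) in \<open>auto simp: indicator_def subset_iff split: if_splits\<close>)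
    then show ?thesis
      using AE_iff_measurable[OF K', of "\<lambda>x. x \<notin> K"] by simp
  qed
  have T0: "emeasure lebesgue T = 0" if T: "closed T" "T \<subseteq> ?S" for T
  proof -
    have "T = (\<Union>n::nat. T \<inter> cball 0 (real n))"
      using real_arch_simple by fastforce
    moreover have "(\<Union>n::nat. T \<inter> cball 0 (real n)) \<in> null_sets lebesgue"
    proof (intro null_sets_UN null_setsI K0)
      show "compact (T \<inter> cball 0 (real n))" for n using T(1) by (simp add: closed_Int_compact)
      then show "T \<inter> cball 0 (real n) \<in> sets lebesgue" for n by (simp add: borel_compact)
      show "T \<inter> cball 0 (real n) \<subseteq> ?S" for n using T(2) by blast
    qed
    ultimately show ?thesis by auto
  qed
  have "emeasure lebesgue ?S \<le> 0"
  proof (rule ennreal_le_epsilon)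
    fix e :: real assume e: "e > 0"
    obtain T where T: "closed T" "T \<subseteq> ?S" "?S - T \<in> lmeasurable" "emeasure lebesgue (?S - T) < ennreal e"
      using sets_lebesgue_inner_closed[OF S e] by blast
    have "emeasure lebesgue ?S = emeasure lebesgue (T \<union> (?S - T))"
      using T(2) by (simp add: Un_absorb1)
    also have "\<dots> \<le> emeasure lebesgue T + emeasure lebesgue (?S - T)"
      using T by (intro emeasure_subadditive) auto
    also have "\<dots> \<le> 0 + ennreal e" using T0[OF T(1,2)] T(4) by simp
    finally show "emeasure lebesgue ?S \<le> 0 + ennreal e" .
  qed
  then have "?S \<in> null_sets lebesgue" using S by auto
  then have "AE x in lebesgue. x \<notin> ?S" by (rule AE_not_in)
  then show ?thesis by (auto simp: AE_restrict_space_iff elim!: eventually_mono)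
qed

lemma fundamental_lemma:
  assumes f: "locally_integrable f" and fm: "f \<in> borel_measurable (lebesgue_on \<Omega>)"
    and 0: "\<And>\<phi>. test_fun \<Omega> \<phi> \<Longrightarrow> (LINT x|lebesgue_on \<Omega>. f x * \<phi> x) = 0"
  shows "AE x in lebesgue_on \<Omega>. f x = 0"
proof -
  have m: "locally_integrable (\<lambda>x. - f x)"
    using f by (simp add: locally_integrable_def)
  have "AE x in lebesgue_on \<Omega>. f x \<le> 0"
    using integral_compact_eq_0[OF f _ _ 0] by (intro AE_nonpos_of_integral_compact_eq_0 f fm)
  moreover have "AE x in lebesgue_on \<Omega>. - f x \<le> 0"
    using integral_compact_eq_0[OF f _ _ 0] fm by (intro AE_nonpos_of_integral_compact_eq_0 m) auto
  ultimately show ?thesis by eventually_elim auto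
qed

end

section \<open>The chain rule for continuous weakly differentiable functions\<close>

context open_domain
begin

text \<open>The form in which the chain rule uses weak differentiability: one direction at a time,
  and local integrability in place of p-integrability.\<close>

definition weak_partial :: "('a \<Rightarrow> real) \<Rightarrow> ('a \<Rightarrow> real) \<Rightarrow> 'a \<Rightarrow> bool" where
  "weak_partial u w e \<longleftrightarrow> locally_integrable u \<and> locally_integrable w \<and>
     (\<forall>\<phi>. test_fun \<Omega> \<phi> \<longrightarrow> (LINT x|lebesgue_on \<Omega>. u x * frechet_derivative \<phi> (at x) e)
        = - (LINT x|lebesgue_on \<Omega>. w x * \<phi> x))"

lemma continuous_on_translate:
  fixes f :: "'a \<Rightarrow> real"
  assumes "continuous_on UNIV f" shows "continuous_on UNIV (\<lambda>x. f (x + c))"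
  by (rule continuous_on_compose2[OF assms]) (auto intro!: continuous_intros)

text \<open>A continuous \<open>\<psi>\<close> has no derivative to test with, so it is compared
  with a test function \<open>\<phi>\<close> within \<open>\<eta>\<close>. For \<open>\<phi>\<close>
  the map \<open>J\<close> is differentiable with derivative given by \<open>w\<close>, and the mean
  value theorem yields an exact difference at an intermediate shift \<open>z\<close>;
  \<open>\<omega>\<close> then compares \<open>\<psi>\<close> at \<open>x\<close> with
  \<open>\<psi>\<close> at the shifted point. Of the radius \<open>2 * r\<close>, one half is for
  the support of \<open>\<phi>\<close>, the other for the shift.\<close>

lemma translation_estimate_approx:
  assumes uw: "weak_partial u w e" and e: "norm e = 1" and K: "compact K" and r: "r > 0"
    and KR: "\<And>k. k \<in> K \<Longrightarrow> cball k (2 * r) \<subseteq> \<Omega> \<inter> cball 0 R"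
    and \<psi>: "continuous_on UNIV \<psi>" "\<And>x. x \<notin> K \<Longrightarrow> \<psi> x = 0"
    and h: "0 < h" "h \<le> r" and \<eta>: "\<eta> > 0"
    and \<omega>: "\<And>x \<xi>. 0 \<le> \<xi> \<Longrightarrow> \<xi> \<le> h \<Longrightarrow> \<bar>\<psi> (x + \<xi> *\<^sub>R e) - \<psi> x\<bar> \<le> \<omega>"
  shows "\<bar>(LINT x|lebesgue_on \<Omega>. u x * (\<psi> (x + h *\<^sub>R e) - \<psi> x)) + h * (LINT x|lebesgue_on \<Omega>. w x * \<psi> x)\<bar>
    \<le> 2 * \<eta> * (LINT x|lebesgue_on \<Omega>. indicator (cball 0 R) x * \<bar>u x\<bar>)
      + h * ((\<omega> + \<eta>) * (LINT x|lebesgue_on \<Omega>. indicator (cball 0 R) x * \<bar>w x\<bar>))"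
proof -
  let ?M = "lebesgue_on \<Omega>" and ?W = "\<Union>k\<in>K. ball k r"
  note u = uw[unfolded weak_partial_def, THEN conjunct1]
    and w = uw[unfolded weak_partial_def, THEN conjunct2, THEN conjunct1]
    and wk = uw[unfolded weak_partial_def, THEN conjunct2, THEN conjunct2, rule_format]
  have W: "open ?W" "K \<subseteq> ?W" using r by auto
  obtain \<phi> where \<phi>: "test_fun ?W \<phi>" "\<And>x. \<bar>\<psi> x - \<phi> x\<bar> \<le> \<eta>"
    using test_fun_approx[OF K W \<psi> \<eta>] by metis
  have sm: "smooth_on UNIV \<phi>" and LW: "closure {x. \<phi> x \<noteq> 0} \<subseteq> ?W"
    using \<phi>(1) by (auto simp: test_fun_def)
  note c\<phi> = smooth_on_UNIV_derivative(2)[OF sm]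
  have shift: "x - t *\<^sub>R e \<in> \<Omega> \<inter> cball 0 R" if x: "x \<in> ?W" and t: "0 \<le> t" "t \<le> r" for x t
  proof -
    obtain k where k: "k \<in> K" "dist k x < r" using x by auto
    have "dist k (x - t *\<^sub>R e) \<le> dist k x + dist x (x - t *\<^sub>R e)" by (rule dist_triangle)
    then have "x - t *\<^sub>R e \<in> cball k (2 * r)" using k t e by (simp add: dist_norm)
    then show ?thesis using KR[OF k(1)] by blast
  qed
  have zero: "\<phi> (x + t *\<^sub>R e) = 0" "\<psi> (x + t *\<^sub>R e) = 0"
    if x: "x \<notin> cball 0 R" and t: "0 \<le> t" "t \<le> r" for x t
  proof -
    have "x + t *\<^sub>R e \<notin> ?W" using shift[of "x + t *\<^sub>R e" t] t x by auto
    then have "x + t *\<^sub>R e \<notin> closure {x. \<phi> x \<noteq> 0}" "x + t *\<^sub>R e \<notin> K"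
      using LW W(2) by blast+
    then show "\<phi> (x + t *\<^sub>R e) = 0" "\<psi> (x + t *\<^sub>R e) = 0"
      using closure_subset[of "{x. \<phi> x \<noteq> 0}"] \<psi>(2) by auto
  qed
  have zero0: "\<phi> x = 0" "\<psi> x = 0" if x: "x \<notin> cball 0 R" for x
    using zero[OF x, of 0] r by auto
  have tst: "test_fun \<Omega> (\<lambda>x. \<phi> (x + t *\<^sub>R e))" if "0 \<le> t" "t \<le> r" for t
    using shift[OF _ that] LW by (intro test_fun_translate[OF \<phi>(1)]) blast
  define J where "J t = (LINT x|?M. u x * \<phi> (x + t *\<^sub>R e))" for t
  have "(J has_real_derivative - (LINT x|?M. w x * \<phi> (x + t *\<^sub>R e))) (at t)"
    if "0 \<le> t" "t \<le> h" for t
    using has_derivative_integral_translate[OF u \<phi>(1), of e t] wk[OF tst[of t]] that h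
    unfolding J_def[abs_def] by (simp add: frechet_derivative_translate[OF sm])
  from MVT2[OF h(1) this] obtain z where z: "0 < z" "z < h"
    "J h - J 0 = (h - 0) * - (LINT x|?M. w x * \<phi> (x + z *\<^sub>R e))" by blast
  have zr: "0 \<le> z" "z \<le> r" "0 \<le> h" using z h by auto
  note ct = continuous_on_translate
  have i: "integrable ?M (\<lambda>x. u x * \<phi> (x + h *\<^sub>R e))" "integrable ?M (\<lambda>x. u x * \<phi> x)"
    "integrable ?M (\<lambda>x. u x * \<psi> (x + h *\<^sub>R e))" "integrable ?M (\<lambda>x. u x * \<psi> x)"
    "integrable ?M (\<lambda>x. w x * \<psi> x)" "integrable ?M (\<lambda>x. w x * \<phi> (x + z *\<^sub>R e))"
    by (rule locally_integrable_mult_continuous[where R = R];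
        use u w ct[OF c\<phi>] ct[OF \<psi>(1)] c\<phi> \<psi>(1) zero zero0 zr h in blast)+
  have 1: "(LINT x|?M. u x * (\<psi> (x + h *\<^sub>R e) - \<psi> x)) + h * (LINT x|?M. w x * \<psi> x)
      = (LINT x|?M. u x * ((\<psi> (x + h *\<^sub>R e) - \<phi> (x + h *\<^sub>R e)) - (\<psi> x - \<phi> x)))
        + h * (LINT x|?M. w x * (\<psi> x - \<phi> (x + z *\<^sub>R e)))"
    using z(3) i unfolding J_def by (simp add: right_diff_distrib)
  have 2: "\<bar>LINT x|?M. u x * ((\<psi> (x + h *\<^sub>R e) - \<phi> (x + h *\<^sub>R e)) - (\<psi> x - \<phi> x))\<bar>
     \<le> (2 * \<eta>) * (LINT x|?M. indicator (cball 0 R) x * \<bar>u x\<bar>)"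
  proof (rule locally_integrable_mult_bound[OF u])
    show "(\<lambda>x. \<psi> (x + h *\<^sub>R e) - \<phi> (x + h *\<^sub>R e) - (\<psi> x - \<phi> x)) \<in> borel_measurable ?M"
      by (intro continuous_measurable continuous_intros ct \<psi>(1) c\<phi>)
    show "\<bar>\<psi> (x + h *\<^sub>R e) - \<phi> (x + h *\<^sub>R e) - (\<psi> x - \<phi> x)\<bar> \<le> 2 * \<eta>" for x
      using \<phi>(2)[of x] \<phi>(2)[of "x + h *\<^sub>R e"] by linarith
  qed (use zero zero0 h zr in auto)
  have 3: "\<bar>LINT x|?M. w x * (\<psi> x - \<phi> (x + z *\<^sub>R e))\<bar>
     \<le> (\<omega> + \<eta>) * (LINT x|?M. indicator (cball 0 R) x * \<bar>w x\<bar>)"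
  proof (rule locally_integrable_mult_bound[OF w])
    show "(\<lambda>x. \<psi> x - \<phi> (x + z *\<^sub>R e)) \<in> borel_measurable ?M"
      by (intro continuous_measurable continuous_intros ct \<psi>(1) c\<phi>)
    show "\<bar>\<psi> x - \<phi> (x + z *\<^sub>R e)\<bar> \<le> \<omega> + \<eta>" for x
      using \<phi>(2)[of "x + z *\<^sub>R e"] \<omega>[of z x] z by linarith
  qed (use zero zero0 h zr in auto)
  have "\<bar>h * (LINT x|?M. w x * (\<psi> x - \<phi> (x + z *\<^sub>R e)))\<bar>
     \<le> h * ((\<omega> + \<eta>) * (LINT x|?M. indicator (cball 0 R) x * \<bar>w x\<bar>))"
    using mult_left_mono[OF 3 zr(3)] h by (simp add: abs_mult)
  with 2 show ?thesis unfolding 1 by linarith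
qed

text \<open>Letting \<open>\<eta>\<close> tend to 0 leaves an error proportional to
  \<open>h\<close>, which after division by \<open>h\<close> is a multiple of the modulus
  \<open>\<omega>\<close> alone.\<close>

lemma translation_estimate:
  assumes uw: "weak_partial u w e" and e: "norm e = 1" and K: "compact K" and r: "r > 0"
    and KR: "\<And>k. k \<in> K \<Longrightarrow> cball k (2 * r) \<subseteq> \<Omega> \<inter> cball 0 R"
    and \<psi>: "continuous_on UNIV \<psi>" "\<And>x. x \<notin> K \<Longrightarrow> \<psi> x = 0"
    and h: "0 < h" "h \<le> r"
    and \<omega>: "\<And>x \<xi>. 0 \<le> \<xi> \<Longrightarrow> \<xi> \<le> h \<Longrightarrow> \<bar>\<psi> (x + \<xi> *\<^sub>R e) - \<psi> x\<bar> \<le> \<omega>"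
  shows "\<bar>(LINT x|lebesgue_on \<Omega>. u x * (\<psi> (x + h *\<^sub>R e) - \<psi> x)) + h * (LINT x|lebesgue_on \<Omega>. w x * \<psi> x)\<bar>
    \<le> h * (\<omega> * (LINT x|lebesgue_on \<Omega>. indicator (cball 0 R) x * \<bar>w x\<bar>))" (is "?L \<le> h * (\<omega> * ?w)")
proof -
  let ?u = "LINT x|lebesgue_on \<Omega>. indicator (cball 0 R) x * \<bar>u x\<bar>"
  have "((\<lambda>\<eta>. 2 * \<eta> * ?u + h * ((\<omega> + \<eta>) * ?w)) \<longlongrightarrow> 2 * 0 * ?u + h * ((\<omega> + 0) * ?w)) (at_right 0)"
    by (intro tendsto_intros)
  moreover have "\<forall>\<^sub>F \<eta> in at_right 0. ?L \<le> 2 * \<eta> * ?u + h * ((\<omega> + \<eta>) * ?w)"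
    using eventually_at_right_less[of 0]
    by eventually_elim (rule translation_estimate_approx[OF uw e K r KR \<psi> h _ \<omega>])
  ultimately have "?L \<le> 2 * 0 * ?u + h * ((\<omega> + 0) * ?w)"
    by (intro tendsto_lowerbound) auto
  then show ?thesis by simp
qed

section \<open>Integrals over the whole space and their translation\<close>

lemma integral_domain_eq_lborel:
  assumes "continuous_on UNIV \<theta>" "\<And>x. x \<notin> \<Omega> \<Longrightarrow> \<theta> x = 0"
  shows "(LINT x|lebesgue_on \<Omega>. \<theta> x) = (LINT x|lborel. (\<theta> x :: real))"
proof -
  have "(LINT x|lebesgue_on \<Omega>. \<theta> x) = (LINT x|lebesgue. indicator \<Omega> x *\<^sub>R \<theta> x)"
    by (rule integral_restrict_space) simp
  also have "(\<lambda>x. indicator \<Omega> x *\<^sub>R \<theta> x) = \<theta>"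
    using assms(2) by (fastforce simp: indicator_def)
  also have "(LINT x|lebesgue. \<theta> x) = (LINT x|lborel. \<theta> x)"
    using borel_measurable_continuous_onI[OF assms(1)] by (intro integral_completion) simp
  finally show ?thesis .
qed

lemma lborel_integral_translate:
  assumes "continuous_on UNIV (\<theta> :: 'a \<Rightarrow> real)"
  shows "(LINT x|lborel. \<theta> (x + c)) = (LINT x|lborel. \<theta> x)"
proof -
  have "(LINT x|lborel. \<theta> x) = (LINT x|distr lborel borel ((+) c). \<theta> x)"
    by (simp add: lborel_distr_plus)
  also have "\<dots> = (LINT x|lborel. \<theta> (c + x))"
    using borel_measurable_continuous_onI[OF assms] by (intro integral_distr) auto
  finally show ?thesis by (simp add: add.commute)
qed

lemma lborel_integrable_continuous:
  assumes "continuous_on UNIV (\<theta> :: 'a \<Rightarrow> real)" "\<And>x. x \<notin> cball 0 R \<Longrightarrow> \<theta> x = 0"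
  shows "integrable lborel \<theta>"
proof -
  have "integrable lborel (\<lambda>x. indicator (cball 0 R) x *\<^sub>R \<theta> x)"
    by (rule borel_integrable_compact) (auto intro: continuous_on_subset[OF assms(1)])
  also have "(\<lambda>x. indicator (cball 0 R) x *\<^sub>R \<theta> x) = \<theta>"
    using assms(2) by (fastforce simp: indicator_def)
  finally show ?thesis .
qed

text \<open>Multiplication by the conjugate sum cancels \<open>\<epsilon>\<close>; the resulting
  factor has no singularity at \<open>a = b\<close>.\<close>

lemma difference_sqrt_factor:
  fixes a b \<epsilon> :: real
  assumes "\<epsilon> > 0"
  shows "sqrt (a\<^sup>2 + \<epsilon>\<^sup>2) - sqrt (b\<^sup>2 + \<epsilon>\<^sup>2)
      = (a - b) * ((a + b) / (sqrt (a\<^sup>2 + \<epsilon>\<^sup>2) + sqrt (b\<^sup>2 + \<epsilon>\<^sup>2)))"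
proof -
  have "sqrt (a\<^sup>2 + \<epsilon>\<^sup>2) > 0" "sqrt (b\<^sup>2 + \<epsilon>\<^sup>2) > 0"
    using assms by (auto intro!: add_nonneg_pos)
  then have p: "sqrt (a\<^sup>2 + \<epsilon>\<^sup>2) + sqrt (b\<^sup>2 + \<epsilon>\<^sup>2) > 0" by linarith
  have "(sqrt (a\<^sup>2 + \<epsilon>\<^sup>2) - sqrt (b\<^sup>2 + \<epsilon>\<^sup>2)) * (sqrt (a\<^sup>2 + \<epsilon>\<^sup>2) + sqrt (b\<^sup>2 + \<epsilon>\<^sup>2))
      = (sqrt (a\<^sup>2 + \<epsilon>\<^sup>2))\<^sup>2 - (sqrt (b\<^sup>2 + \<epsilon>\<^sup>2))\<^sup>2"
    by (simp add: power2_eq_square algebra_simps)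
  also have "\<dots> = (a - b) * (a + b)" by (simp add: power2_eq_square algebra_simps)
  finally show ?thesis using p by (simp add: field_simps)
qed

text \<open>Translation invariance moves the shift from \<open>\<phi>\<close> to \<open>F\<close>,
  where the pointwise identity \<open>eq\<close> trades \<open>F\<close> for \<open>V\<close>; the
  shift is then moved back onto \<open>\<psi>\<close>. The vanishing conditions allow the integrals
  over \<open>\<Omega>\<close> to be taken over the whole space, where translation is
  possible.\<close>

lemma summation_by_parts_translate:
  fixes V \<phi> F :: "'a \<Rightarrow> real"
  assumes V: "continuous_on UNIV V" and F: "continuous_on UNIV F"
    and \<phi>: "continuous_on UNIV \<phi>" and \<psi>: "continuous_on UNIV \<psi>"
    and R: "\<And>x. x \<notin> cball 0 R \<Longrightarrow> \<phi> x = 0 \<and> \<psi> x = 0 \<and> \<phi> (x + c) = 0 \<and> \<psi> (x + c) = 0"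
    and \<Omega>: "\<And>x. x \<notin> \<Omega> \<Longrightarrow> \<phi> x = 0 \<and> \<psi> x = 0 \<and> \<phi> (x + c) = 0 \<and> \<psi> (x + c) = 0"
    and eq: "\<And>x. (F x - F (x - c)) * \<phi> x = (V x - V (x - c)) * \<psi> x"
  shows "(LINT x|lebesgue_on \<Omega>. F x * (\<phi> (x + c) - \<phi> x)) = (LINT x|lebesgue_on \<Omega>. V x * (\<psi> (x + c) - \<psi> x))"
proof -
  have ct: "continuous_on UNIV (\<lambda>x. f (x + d))" if "continuous_on UNIV f" for f :: "'a \<Rightarrow> real" and d
    using continuous_on_translate[OF that] .
  have ct': "continuous_on UNIV (\<lambda>x. f (x - c))" if "continuous_on UNIV f" for f :: "'a \<Rightarrow> real"
    using ct[OF that, of "- c"] by simp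
  have key: "(LINT x|lebesgue_on \<Omega>. G x * (\<theta> (x + c) - \<theta> x)) = - (LINT x|lborel. (G x - G (x - c)) * \<theta> x)"
    if G: "continuous_on UNIV G" and \<theta>: "continuous_on UNIV \<theta>"
      and z: "\<And>x. x \<notin> cball 0 R \<Longrightarrow> \<theta> x = 0 \<and> \<theta> (x + c) = 0" "\<And>x. x \<notin> \<Omega> \<Longrightarrow> \<theta> x = 0 \<and> \<theta> (x + c) = 0"
    for G \<theta> :: "'a \<Rightarrow> real"
  proof -
    have "(LINT x|lebesgue_on \<Omega>. G x * (\<theta> (x + c) - \<theta> x)) = (LINT x|lborel. G x * (\<theta> (x + c) - \<theta> x))"
      using z by (intro integral_domain_eq_lborel continuous_intros G \<theta> ct) auto
    also have "\<dots> = (LINT x|lborel. G x * \<theta> (x + c)) - (LINT x|lborel. G x * \<theta> x)"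
      unfolding right_diff_distrib
      using z by (intro Bochner_Integration.integral_diff lborel_integrable_continuous[where R = R] continuous_intros G \<theta> ct) auto
    also have "(LINT x|lborel. G x * \<theta> (x + c)) = (LINT x|lborel. G (x - c) * \<theta> x)"
      using lborel_integral_translate[of "\<lambda>x. G (x - c) * \<theta> x" c]
      by (simp add: continuous_on_mult ct'[OF G] \<theta>)
    also have "\<dots> - (LINT x|lborel. G x * \<theta> x) = (LINT x|lborel. G (x - c) * \<theta> x - G x * \<theta> x)"
      using z by (intro Bochner_Integration.integral_diff[symmetric] lborel_integrable_continuous[where R = R] continuous_intros G \<theta> ct') auto
    also have "\<dots> = - (LINT x|lborel. (G x - G (x - c)) * \<theta> x)"
      by (subst Bochner_Integration.integral_minus[symmetric]) (simp add: left_diff_distrib)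
    finally show ?thesis .
  qed
  show ?thesis
    using key[OF F \<phi>] key[OF V \<psi>] R \<Omega> eq by simp
qed

lemma integral_mult_cong_AE:
  assumes "locally_integrable f" "locally_integrable g" "AE x in lebesgue_on \<Omega>. f x = g x"
    and "continuous_on UNIV \<theta>" "\<And>x. x \<notin> cball 0 R \<Longrightarrow> \<theta> x = 0"
  shows "(LINT x|lebesgue_on \<Omega>. f x * \<theta> x) = (LINT x|lebesgue_on \<Omega>. g x * \<theta> x)"
  using assms(3) locally_integrable_mult_continuous[OF assms(1,4,5)]
    locally_integrable_mult_continuous[OF assms(2,4,5)]
  by (intro integral_cong_AE) auto

text \<open>The right derivative at 0 of the integral of
  \<open>F x * \<phi> (x + t *\<^sub>R e)\<close> is computed twice: by differentiating under the
  integral sign, and by moving the difference onto \<open>V\<close>, where the weak derivative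
  \<open>w\<close> takes over. The representative \<open>V\<close> on the whole space makes all
  integrands of the second computation continuous everywhere before \<open>u\<close> replaces
  it.\<close>

lemma sqrt_chain_rule:
  assumes uw: "weak_partial u w e" and e: "norm e = 1" and um: "u \<in> borel_measurable (lebesgue_on \<Omega>)"
    and wm: "w \<in> borel_measurable (lebesgue_on \<Omega>)"
    and V: "continuous_on UNIV V" and uV: "AE x in lebesgue_on \<Omega>. u x = V x"
    and \<epsilon>: "\<epsilon> > 0" and \<phi>: "test_fun \<Omega> \<phi>"
  shows "(LINT x|lebesgue_on \<Omega>. sqrt ((u x)\<^sup>2 + \<epsilon>\<^sup>2) * frechet_derivative \<phi> (at x) e)
     = - (LINT x|lebesgue_on \<Omega>. w x * (u x / sqrt ((u x)\<^sup>2 + \<epsilon>\<^sup>2) * \<phi> x))"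
proof -
  let ?M = "lebesgue_on \<Omega>"
  note u = uw[unfolded weak_partial_def, THEN conjunct1]
    and w = uw[unfolded weak_partial_def, THEN conjunct2, THEN conjunct1]
  define F where "F x = sqrt ((V x)\<^sup>2 + \<epsilon>\<^sup>2)" for x
  have Fpos: "F x > 0" for x unfolding F_def using \<epsilon> by (auto intro!: add_nonneg_pos)
  have F: "continuous_on UNIV F" unfolding F_def by (intro continuous_intros V)
  have sm: "smooth_on UNIV \<phi>" using \<phi> by (simp add: test_fun_def)
  note c\<phi> = smooth_on_UNIV_derivative(2)[OF sm]
  define K where "K = closure {x. \<phi> x \<noteq> 0}"
  have K: "compact K" "K \<subseteq> \<Omega>" using \<phi> by (auto simp: test_fun_def K_def)
  have \<phi>K: "\<phi> x = 0" if "x \<notin> K" for x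
    using that closure_subset[of "{x. \<phi> x \<noteq> 0}"] by (auto simp: K_def)
  obtain r0 where r0: "r0 > 0" "(\<Union>x\<in>K. cball x r0) \<subseteq> \<Omega>"
    using compact_subset_open_imp_cball_epsilon_subset[OF K(1) open_domain K(2)] by blast
  \<comment> \<open>Halved because the translation estimate asks for balls of twice the
    radius.\<close>
  define r where "r = r0 / 2"
  have r: "r > 0" using r0 by (simp add: r_def)
  obtain R0 where R0: "R0 > 0" "K \<subseteq> cball 0 R0"
    using bounded_subset_cball_0[OF compact_imp_bounded[OF K(1)]] by blast
  \<comment> \<open>Room for the balls of radius \<open>2 * r\<close> around \<open>K\<close> and
    for shifts of length at most 1.\<close>
  define R where "R = R0 + 2 * r + 1"
  have near: "y \<in> cball 0 (R0 + s)" if "dist k y \<le> s" "k \<in> K" for y k s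
  proof -
    have "norm y \<le> norm k + dist k y"
      by (metis dist_commute dist_norm norm_triangle_sub)
    then show ?thesis using that R0 by fastforce
  qed
  have KR: "cball k (2 * r) \<subseteq> \<Omega> \<inter> cball 0 R" if "k \<in> K" for k
  proof
    fix y assume y: "y \<in> cball k (2 * r)"
    then have "y \<in> (\<Union>x\<in>K. cball x r0)" using that by (auto simp: r_def)
    then have "y \<in> \<Omega>" using r0(2) by blast
    then show "y \<in> \<Omega> \<inter> cball 0 R" using near[OF _ that, of y "2 * r"] y by (auto simp: R_def)
  qed
  have KR0: "K \<subseteq> cball 0 R" using R0 r by (auto simp: R_def)
  \<comment> \<open>With \<open>t\<close> as the shift, this is \<open>\<phi> x\<close> times the
    difference quotient of the square root function between the values \<open>V x\<close> and
    \<open>V (x - t *\<^sub>R e)\<close>; at \<open>t = 0\<close> the quotient becomes the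
    derivative \<open>V x / F x\<close>. As one continuous function of \<open>(x, t)\<close>, it
    lets a single uniform continuity argument control both its translates and its dependence on the
    shift.\<close>
  define \<Psi> where "\<Psi> = (\<lambda>(x, t). (V x + V (x - t *\<^sub>R e)) / (F x + F (x - t *\<^sub>R e)) * \<phi> x)"
  have c2: "continuous_on UNIV (\<lambda>z. f (g z))"
    if "continuous_on UNIV f" "continuous_on UNIV g" for f :: "'a \<Rightarrow> real" and g :: "'a \<times> real \<Rightarrow> 'a"
    by (rule continuous_on_compose2[OF that(1,2)]) simp
  have Fne: "F x + F y \<noteq> 0" for x y using Fpos[of x] Fpos[of y] by linarith
  have c\<Psi>: "continuous_on UNIV \<Psi>"
    unfolding \<Psi>_def split_beta
    by (intro continuous_intros c2[OF V] c2[OF F] c2[OF c\<phi>] ballI Fne)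
  have c\<Psi>h: "continuous_on UNIV (\<lambda>x. \<Psi> (x, h))" for h
    by (rule continuous_on_compose2[OF c\<Psi>]) (auto intro!: continuous_intros)
  have \<Psi>K: "\<Psi> (x, h) = 0" if "x \<notin> K" for x h using \<phi>K[OF that] by (simp add: \<Psi>_def)
  have \<Psi>R: "\<Psi> (x, h) = 0" if "x \<notin> cball 0 R" for x h using that KR0 \<Psi>K by blast
  define C where "C = (LINT x|?M. indicator (cball 0 R) x * \<bar>w x\<bar>)"
  have C: "C \<ge> 0" unfolding C_def by simp
  define J where "J t = (LINT x|?M. F x * \<phi> (x + t *\<^sub>R e))" for t
  have i\<phi>: "integrable ?M (\<lambda>x. F x * \<phi> (x + t *\<^sub>R e))" if "\<bar>t\<bar> \<le> 2 * r" for t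
  proof (rule locally_integrable_mult_continuous[OF continuous_locally_integrable[OF F]
        continuous_on_translate[OF c\<phi>]])
    show "\<phi> (x + t *\<^sub>R e) = 0" if x: "x \<notin> cball 0 R" for x
    proof (rule \<phi>K, rule)
      assume "x + t *\<^sub>R e \<in> K"
      from near[OF _ this, of x "2 * r"] show False using x e \<open>\<bar>t\<bar> \<le> 2 * r\<close> by (simp add: dist_norm R_def)
    qed
  qed
  have est: "\<forall>\<^sub>F h in at_right 0. \<bar>(J h - J 0) / h + (LINT x|?M. w x * \<Psi> (x, 0))\<bar> \<le> 2 * \<eta> * C"
    if \<eta>: "\<eta> > 0" for \<eta>
  proof -
    have "uniformly_continuous_on (cball 0 R \<times> {0..1}) \<Psi>"
      by (intro compact_uniformly_continuous continuous_on_subset[OF c\<Psi>] compact_Times) auto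
    then obtain d where d: "d > 0" "\<And>y z. y \<in> cball 0 R \<times> {0..1} \<Longrightarrow> z \<in> cball 0 R \<times> {0..1}
        \<Longrightarrow> dist z y < d \<Longrightarrow> dist (\<Psi> z) (\<Psi> y) < \<eta>"
      using \<eta> unfolding uniformly_continuous_on_def by metis
    have "\<bar>(J h - J 0) / h + (LINT x|?M. w x * \<Psi> (x, 0))\<bar> \<le> 2 * \<eta> * C"
      if h: "0 < h" "h < min d (min r 1)" for h
    proof -
      have near1: "x \<in> cball 0 R" "x + \<xi> *\<^sub>R e \<in> cball 0 R"
        if "x \<in> K \<or> x + \<xi> *\<^sub>R e \<in> K" "0 \<le> \<xi>" "\<xi> \<le> h" for x \<xi>
        using that near[of x "x + \<xi> *\<^sub>R e" 1] near[of "x + \<xi> *\<^sub>R e" x 1] KR0 h e r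
        by (auto simp: dist_norm R_def)
      have \<omega>: "\<bar>\<Psi> (x + \<xi> *\<^sub>R e, h) - \<Psi> (x, h)\<bar> \<le> \<eta>" if \<xi>: "0 \<le> \<xi>" "\<xi> \<le> h" for x \<xi>
      proof (cases "x \<in> K \<or> x + \<xi> *\<^sub>R e \<in> K")
        case True
        have "dist (\<Psi> (x + \<xi> *\<^sub>R e, h)) (\<Psi> (x, h)) < \<eta>"
          using near1[OF True \<xi>] h \<xi> e by (intro d(2)) (auto simp: dist_Pair_Pair dist_norm)
        then show ?thesis by (simp add: dist_norm)
      next
        case False
        then show ?thesis using \<eta> by (simp add: \<Psi>K)
      qed
      have \<omega>0: "\<bar>\<Psi> (x, h) - \<Psi> (x, 0)\<bar> \<le> \<eta>" for x
      proof (cases "x \<in> K")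
        case True
        have "dist (\<Psi> (x, h)) (\<Psi> (x, 0)) < \<eta>"
          using True KR0 h by (intro d(2)) (auto simp: dist_Pair_Pair dist_norm)
        then show ?thesis by (simp add: dist_norm)
      next
        case False
        then show ?thesis using \<eta> by (simp add: \<Psi>K)
      qed
      have out: "x \<notin> K" "x + h *\<^sub>R e \<notin> K" if x: "x \<notin> cball 0 R" for x
        using near1[of x h] x h by auto
      have out': "x \<notin> K" "x + h *\<^sub>R e \<notin> K" if x: "x \<notin> \<Omega>" for x
      proof -
        show "x \<notin> K" using x K by blast
        show "x + h *\<^sub>R e \<notin> K"
        proof
          assume k: "x + h *\<^sub>R e \<in> K"
          have "x \<in> cball (x + h *\<^sub>R e) (2 * r)" using h e by (simp add: dist_norm)
          then show False using KR[OF k] x by blast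
        qed
      qed
      have fac: "(F x - F (x - h *\<^sub>R e)) * \<phi> x = (V x - V (x - h *\<^sub>R e)) * \<Psi> (x, h)" for x
        unfolding F_def \<Psi>_def by (simp add: difference_sqrt_factor[OF \<epsilon>])
      have "J h - J 0 = (LINT x|?M. F x * (\<phi> (x + h *\<^sub>R e) - \<phi> x))"
        using i\<phi>[of h] i\<phi>[of 0] h r unfolding J_def by (simp add: right_diff_distrib)
      also have "\<dots> = (LINT x|?M. V x * (\<Psi> (x + h *\<^sub>R e, h) - \<Psi> (x, h)))"
        using \<phi>K \<Psi>K out out'
        by (intro summation_by_parts_translate[where \<psi> = "\<lambda>x. \<Psi> (x, h)" and R = R] V F c\<phi> c\<Psi>h fac) auto
      also have "\<dots> = (LINT x|?M. u x * (\<Psi> (x + h *\<^sub>R e, h) - \<Psi> (x, h)))"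
      proof (rule integral_mult_cong_AE[symmetric, OF u continuous_locally_integrable[OF V] uV])
        show "continuous_on UNIV (\<lambda>x. \<Psi> (x + h *\<^sub>R e, h) - \<Psi> (x, h))"
          by (intro continuous_intros c\<Psi>h continuous_on_translate[OF c\<Psi>h])
        show "\<Psi> (x + h *\<^sub>R e, h) - \<Psi> (x, h) = 0" if "x \<notin> cball 0 R" for x
          using out[OF that] by (simp add: \<Psi>K)
      qed
      finally have JJ: "J h - J 0 = \<dots>" .
      have 1: "\<bar>(J h - J 0) + h * (LINT x|?M. w x * \<Psi> (x, h))\<bar> \<le> h * (\<eta> * C)"
        unfolding JJ C_def using h \<omega>
        by (intro translation_estimate[OF uw e K(1) r KR c\<Psi>h \<Psi>K]) auto
      have "(J h - J 0) / h + (LINT x|?M. w x * \<Psi> (x, h))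
          = ((J h - J 0) + h * (LINT x|?M. w x * \<Psi> (x, h))) / h"
        using h(1) by (simp add: field_simps)
      then have "\<bar>(J h - J 0) / h + (LINT x|?M. w x * \<Psi> (x, h))\<bar>
          = \<bar>(J h - J 0) + h * (LINT x|?M. w x * \<Psi> (x, h))\<bar> / h"
        using h(1) by simp
      also have "\<dots> \<le> \<eta> * C" using 1 h(1) by (simp add: divide_le_eq mult.commute)
      finally have 2: "\<bar>(J h - J 0) / h + (LINT x|?M. w x * \<Psi> (x, h))\<bar> \<le> \<eta> * C" .
      have iw: "integrable ?M (\<lambda>x. w x * \<Psi> (x, t))" for t
        using \<Psi>R by (rule locally_integrable_mult_continuous[OF w c\<Psi>h])
      have "\<bar>(LINT x|?M. w x * \<Psi> (x, h)) - (LINT x|?M. w x * \<Psi> (x, 0))\<bar>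
          = \<bar>LINT x|?M. w x * (\<Psi> (x, h) - \<Psi> (x, 0))\<bar>"
        using iw by (simp add: right_diff_distrib)
      also have "\<dots> \<le> \<eta> * C"
        unfolding C_def using \<Psi>R \<omega>0
        by (intro locally_integrable_mult_bound[OF w] continuous_measurable continuous_intros c\<Psi>h) auto
      finally show ?thesis using 2 by linarith
    qed
    then show ?thesis unfolding eventually_at_right_field
      using d(1) r by (intro exI[of _ "min d (min r 1)"]) auto
  qed
  have "((\<lambda>h. (J h - J 0) / h) \<longlongrightarrow> - (LINT x|?M. w x * \<Psi> (x, 0))) (at_right 0)"
  proof (rule tendstoI)
    fix \<delta> :: real assume \<delta>: "\<delta> > 0"
    \<comment> \<open>\<open>2 * C + 1\<close> and not \<open>2 * C\<close>, since \<open>C\<close>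
      may be 0.\<close>
    have *: "2 * (\<delta> / (2 * C + 1) / 2) * C < \<delta>" using C \<delta> by (simp add: field_simps add_pos_nonneg)
    have "\<delta> / (2 * C + 1) / 2 > 0" using C \<delta> by simp
    from est[OF this] show "\<forall>\<^sub>F h in at_right 0. dist ((J h - J 0) / h) (- (LINT x|?M. w x * \<Psi> (x, 0))) < \<delta>"
      by eventually_elim (use * in \<open>simp add: dist_norm\<close>)
  qed
  \<comment> \<open>Since \<open>J\<close> is known to be differentiable at 0, the limit from the
    right determines its derivative, and negative shifts need no estimate.\<close>
  moreover have "((\<lambda>h. (J h - J 0) / h) \<longlongrightarrow> (LINT x|?M. F x * frechet_derivative \<phi> (at x) e)) (at_right 0)"
    using has_derivative_integral_translate[OF continuous_locally_integrable[OF F] \<phi>, of e 0]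
    unfolding J_def DERIV_def by (auto simp: filterlim_at_split)
  ultimately have "(LINT x|?M. F x * frechet_derivative \<phi> (at x) e) = - (LINT x|?M. w x * \<Psi> (x, 0))"
    by (intro tendsto_unique[OF trivial_limit_at_right_real])
  moreover have "(LINT x|?M. F x * frechet_derivative \<phi> (at x) e)
      = (LINT x|?M. sqrt ((u x)\<^sup>2 + \<epsilon>\<^sup>2) * frechet_derivative \<phi> (at x) e)"
  proof (rule integral_cong_AE)
    show "AE x in ?M. F x * frechet_derivative \<phi> (at x) e
        = sqrt ((u x)\<^sup>2 + \<epsilon>\<^sup>2) * frechet_derivative \<phi> (at x) e"
      using uV by eventually_elim (simp add: F_def)
  qed (use um continuous_measurable[OF F] continuous_measurable[OF smooth_on_UNIV_derivative(3)[OF sm, of e]]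
      in auto)
  moreover have "(LINT x|?M. w x * \<Psi> (x, 0)) = (LINT x|?M. w x * (u x / sqrt ((u x)\<^sup>2 + \<epsilon>\<^sup>2) * \<phi> x))"
  proof (rule integral_cong_AE)
    show "AE x in ?M. w x * \<Psi> (x, 0) = w x * (u x / sqrt ((u x)\<^sup>2 + \<epsilon>\<^sup>2) * \<phi> x)"
      using uV by eventually_elim (simp add: \<Psi>_def F_def)
  qed (use wm um continuous_measurable[OF c\<Psi>h] continuous_measurable[OF c\<phi>] in auto)
  ultimately show ?thesis by simp
qed

end

section \<open>Sobolev functions and their weak gradients\<close>

text \<open>Origin of the factor \<open>2 powr p\<close> in the later norm estimates. Its size is
  immaterial, as every error is made small in the end.\<close>

lemma norm_add_powr_le:
  fixes a b :: "'b::real_normed_vector"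
  assumes "p > 0"
  shows "norm (a + b) powr p \<le> 2 powr p * (norm a powr p + norm b powr p)"
proof -
  have "norm (a + b) powr p \<le> (2 * max (norm a) (norm b)) powr p"
    using norm_triangle_ineq[of a b] assms by (intro powr_mono2) auto
  also have "\<dots> = 2 powr p * max (norm a) (norm b) powr p" by (simp add: powr_mult)
  also have "\<dots> \<le> 2 powr p * (norm a powr p + norm b powr p)"
    by (intro mult_left_mono) (auto simp: max_def)
  finally show ?thesis .
qed

text \<open>Lets the p-th power dominate the function itself on sets of finite measure, in place of
  Hoelder's inequality.\<close>

lemma le_one_plus_powr:
  fixes t p :: real
  assumes "0 \<le> t" "1 \<le> p" shows "t \<le> 1 + t powr p"
proof (cases "t \<le> 1")
  case False
  then have "t powr 1 \<le> t powr p" using assms by (intro powr_mono) auto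
  then show ?thesis using False by simp
qed (use powr_ge_zero[of t p] in linarith)

locale sobolev_domain = open_domain +
  fixes p :: real
  assumes p_gt_1: "1 < p"
begin

text \<open>Carrying the gradient explicitly avoids \<open>wgrad\<close>, which is an arbitrary
  choice; the two are reconciled in \<open>sob_normp_eq\<close>.\<close>

definition sob_pair :: "('a \<Rightarrow> real) \<Rightarrow> ('a \<Rightarrow> 'a) \<Rightarrow> bool" where
  "sob_pair u g \<longleftrightarrow> u \<in> borel_measurable (lebesgue_on \<Omega>) \<and>
     integrable (lebesgue_on \<Omega>) (\<lambda>x. \<bar>u x\<bar> powr p) \<and> weak_grad \<Omega> u g \<and>
     integrable (lebesgue_on \<Omega>) (\<lambda>x. norm (g x) powr p)"

lemma sobolev_iff_pair: "sobolev \<Omega> p u \<longleftrightarrow> (\<exists>g. sob_pair u g)"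
  by (auto simp: sobolev_def sob_pair_def)

lemma sob_pair_wgrad:
  assumes "sobolev \<Omega> p u" shows "sob_pair u (wgrad \<Omega> p u)"
proof -
  have "\<exists>g. weak_grad \<Omega> u g \<and> integrable (lebesgue_on \<Omega>) (\<lambda>x. norm (g x) powr p)"
    using assms by (simp add: sobolev_def)
  from someI_ex[OF this] show ?thesis
    using assms by (simp add: sobolev_def sob_pair_def wgrad_def)
qed

lemma sob_pairD:
  assumes "sob_pair u g"
  shows "u \<in> borel_measurable (lebesgue_on \<Omega>)" "integrable (lebesgue_on \<Omega>) (\<lambda>x. \<bar>u x\<bar> powr p)"
    "g \<in> borel_measurable (lebesgue_on \<Omega>)" "integrable (lebesgue_on \<Omega>) (\<lambda>x. norm (g x) powr p)"
    "weak_grad \<Omega> u g"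
  using assms by (auto simp: sob_pair_def weak_grad_def)

lemma locally_integrable_dominated:
  assumes f: "f \<in> borel_measurable (lebesgue_on \<Omega>)" and S: "integrable (lebesgue_on \<Omega>) S"
    and le: "AE x in lebesgue_on \<Omega>. \<bar>f x\<bar> \<le> 1 + S x"
  shows "locally_integrable f"
  unfolding locally_integrable_def
proof
  fix R
  have i: "integrable (lebesgue_on \<Omega>) (\<lambda>x. indicator (cball 0 R) x * 1 + \<bar>S x\<bar>)"
    using continuous_locally_integrable[OF continuous_on_const[of _ 1]] S
    by (auto simp: locally_integrable_def)
  show "integrable (lebesgue_on \<Omega>) (\<lambda>x. indicator (cball 0 R) x * f x)"
  proof (rule Bochner_Integration.integrable_bound[OF i])
    have "(indicator (cball 0 R) :: 'a \<Rightarrow> real) \<in> borel_measurable (lebesgue_on \<Omega>)"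
      by (intro measurable_restrict_space1 measurable_completion borel_measurable_indicator) simp
    then show "(\<lambda>x. indicator (cball 0 R) x * f x) \<in> borel_measurable (lebesgue_on \<Omega>)"
      using f by auto
    show "AE x in lebesgue_on \<Omega>. norm (indicator (cball 0 R) x * f x)
        \<le> norm (indicator (cball 0 R) x * 1 + \<bar>S x\<bar>)"
      using le by eventually_elim (auto simp: indicator_def)
  qed
qed

lemma locally_integrable_powr:
  fixes f :: "'a \<Rightarrow> real"
  assumes "f \<in> borel_measurable (lebesgue_on \<Omega>)" "integrable (lebesgue_on \<Omega>) (\<lambda>x. \<bar>f x\<bar> powr p)"
  shows "locally_integrable f"
  using le_one_plus_powr[of "\<bar>f _\<bar>" p] p_gt_1
  by (intro locally_integrable_dominated[OF assms] AE_I2) auto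

lemma
  assumes "sob_pair u g"
  shows sob_pair_locally_integrable: "locally_integrable u"
    and sob_pair_grad_locally_integrable: "locally_integrable (\<lambda>x. g x \<bullet> i)"
proof -
  note D = sob_pairD[OF assms]
  show "locally_integrable u" using D by (intro locally_integrable_powr)
  have gi: "(\<lambda>x. \<bar>g x \<bullet> i\<bar>) \<in> borel_measurable (lebesgue_on \<Omega>)" using D(3) by simp
  have "integrable (lebesgue_on \<Omega>) (\<lambda>x. norm i powr p * norm (g x) powr p)" using D(4) by simp
  then have "integrable (lebesgue_on \<Omega>) (\<lambda>x. \<bar>g x \<bullet> i\<bar> powr p)"
  proof (rule Bochner_Integration.integrable_bound)
    have "\<bar>g x \<bullet> i\<bar> powr p \<le> norm i powr p * norm (g x) powr p" for x
      using powr_mono2[of p "\<bar>g x \<bullet> i\<bar>" "norm (g x) * norm i"] p_gt_1 Cauchy_Schwarz_ineq2[of "g x" i]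
      by (simp add: powr_mult mult.commute)
    then show "AE x in lebesgue_on \<Omega>. norm (\<bar>g x \<bullet> i\<bar> powr p) \<le> norm (norm i powr p * norm (g x) powr p)"
      by simp
  qed (use gi in simp)
  then show "locally_integrable (\<lambda>x. g x \<bullet> i)"
    using D(3) by (intro locally_integrable_powr) auto
qed

lemma weak_gradD:
  assumes "weak_grad \<Omega> u g" "test_fun \<Omega> \<phi>" "i \<in> Basis"
  shows "(LINT x|lebesgue_on \<Omega>. u x * frechet_derivative \<phi> (at x) i)
          = - (LINT x|lebesgue_on \<Omega>. (g x \<bullet> i) * \<phi> x)"
  using assms by (auto simp: weak_grad_def)

lemma sob_pair_weak_partial:
  assumes "sob_pair u g" "i \<in> Basis"
  shows "weak_partial u (\<lambda>x. g x \<bullet> i) i"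
  using sob_pair_locally_integrable[OF assms(1)] sob_pair_grad_locally_integrable[OF assms(1)]
    weak_gradD[OF sob_pairD(5)[OF assms(1)] _ assms(2)]
  by (simp add: weak_partial_def)

lemma test_fun_continuous:
  assumes "test_fun W \<phi>"
  shows "continuous_on UNIV \<phi>" "continuous_on UNIV (\<lambda>x. frechet_derivative \<phi> (at x) v)"
  using assms smooth_on_UNIV_derivative by (auto simp: test_fun_def)

lemma integrable_mult_test_fun:
  assumes "locally_integrable f" "test_fun W \<phi>"
  shows "integrable (lebesgue_on \<Omega>) (\<lambda>x. f x * \<phi> x)"
    "integrable (lebesgue_on \<Omega>) (\<lambda>x. f x * frechet_derivative \<phi> (at x) v)"
proof -
  obtain R where R: "\<And>x. x \<notin> cball 0 R \<Longrightarrow> \<phi> x = 0" "\<And>x v. x \<notin> cball 0 R \<Longrightarrow> frechet_derivative \<phi> (at x) v = 0"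
    using test_fun_support[OF assms(2)] by metis
  show "integrable (lebesgue_on \<Omega>) (\<lambda>x. f x * \<phi> x)"
    by (rule locally_integrable_mult_continuous[OF assms(1) test_fun_continuous(1)[OF assms(2)] R(1)])
  show "integrable (lebesgue_on \<Omega>) (\<lambda>x. f x * frechet_derivative \<phi> (at x) v)"
    by (rule locally_integrable_mult_continuous[OF assms(1) test_fun_continuous(2)[OF assms(2)] R(2)])
qed

text \<open>In each coordinate the difference of the gradients integrates to 0 against every test
  function, so the fundamental lemma applies coordinatewise.\<close>

lemma sob_pair_unique:
  assumes "sob_pair u g" "sob_pair u g'"
  shows "AE x in lebesgue_on \<Omega>. g x = g' x"
proof -
  have "AE x in lebesgue_on \<Omega>. g x \<bullet> i - g' x \<bullet> i = 0" if i: "i \<in> Basis" for i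
  proof (rule fundamental_lemma)
    note l = sob_pair_grad_locally_integrable[OF assms(1), of i] sob_pair_grad_locally_integrable[OF assms(2), of i]
    then show "locally_integrable (\<lambda>x. g x \<bullet> i - g' x \<bullet> i)"
      by (simp add: locally_integrable_def right_diff_distrib)
    show "(\<lambda>x. g x \<bullet> i - g' x \<bullet> i) \<in> borel_measurable (lebesgue_on \<Omega>)"
      using sob_pairD(3)[OF assms(1)] sob_pairD(3)[OF assms(2)] by simp
    show "(LINT x|lebesgue_on \<Omega>. (g x \<bullet> i - g' x \<bullet> i) * \<phi> x) = 0" if \<phi>: "test_fun \<Omega> \<phi>" for \<phi>
      using weak_gradD[OF sob_pairD(5)[OF assms(1)] \<phi> i] weak_gradD[OF sob_pairD(5)[OF assms(2)] \<phi> i]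
        integrable_mult_test_fun(1)[OF l(1) \<phi>] integrable_mult_test_fun(1)[OF l(2) \<phi>]
      by (simp add: left_diff_distrib)
  qed
  then have "AE x in lebesgue_on \<Omega>. \<forall>i\<in>Basis. g x \<bullet> i - g' x \<bullet> i = 0"
    by (simp add: AE_ball_countable countable_finite)
  then show ?thesis
    by eventually_elim (auto intro: euclidean_eqI)
qed

text \<open>By uniqueness the gradient picked by \<open>SOME\<close> does not matter; from here on
  any convenient gradient computes the norm.\<close>

lemma sob_normp_eq:
  assumes "sob_pair u g"
  shows "sob_normp \<Omega> p u = (LINT x|lebesgue_on \<Omega>. \<bar>u x\<bar> powr p) + (LINT x|lebesgue_on \<Omega>. norm (g x) powr p)"
proof -
  have w: "sob_pair u (wgrad \<Omega> p u)" using assms sob_pair_wgrad sobolev_iff_pair by blast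
  have "(LINT x|lebesgue_on \<Omega>. norm (wgrad \<Omega> p u x) powr p) = (LINT x|lebesgue_on \<Omega>. norm (g x) powr p)"
    using sob_pair_unique[OF w assms] sob_pairD(4)[OF assms] sob_pairD(4)[OF w]
    by (intro integral_cong_AE) auto
  then show ?thesis by (simp add: sob_normp_def)
qed

lemma sob_normp_nonneg: "0 \<le> sob_normp \<Omega> p u"
  by (simp add: sob_normp_def)

lemma integrable_add_powr:
  fixes f g :: "'a \<Rightarrow> 'b::euclidean_space"
  assumes "f \<in> borel_measurable (lebesgue_on \<Omega>)" "g \<in> borel_measurable (lebesgue_on \<Omega>)"
    and "integrable (lebesgue_on \<Omega>) (\<lambda>x. norm (f x) powr p)" "integrable (lebesgue_on \<Omega>) (\<lambda>x. norm (g x) powr p)"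
  shows "integrable (lebesgue_on \<Omega>) (\<lambda>x. norm (f x + g x) powr p)"
    and "(LINT x|lebesgue_on \<Omega>. norm (f x + g x) powr p)
      \<le> 2 powr p * ((LINT x|lebesgue_on \<Omega>. norm (f x) powr p) + (LINT x|lebesgue_on \<Omega>. norm (g x) powr p))"
proof -
  have i: "integrable (lebesgue_on \<Omega>) (\<lambda>x. 2 powr p * (norm (f x) powr p + norm (g x) powr p))"
    using assms by auto
  have le: "norm (f x + g x) powr p \<le> 2 powr p * (norm (f x) powr p + norm (g x) powr p)" for x
    using norm_add_powr_le[of p "f x" "g x"] p_gt_1 by simp
  show I: "integrable (lebesgue_on \<Omega>) (\<lambda>x. norm (f x + g x) powr p)"
    by (rule Bochner_Integration.integrable_bound[OF i]) (use assms le in \<open>auto intro: order_trans[OF _ abs_ge_self]\<close>)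
  have "(LINT x|lebesgue_on \<Omega>. norm (f x + g x) powr p)
      \<le> (LINT x|lebesgue_on \<Omega>. 2 powr p * (norm (f x) powr p + norm (g x) powr p))"
    by (rule integral_mono[OF I i]) (use le in auto)
  also have "\<dots> = 2 powr p * ((LINT x|lebesgue_on \<Omega>. norm (f x) powr p) + (LINT x|lebesgue_on \<Omega>. norm (g x) powr p))"
    using assms by simp
  finally show "(LINT x|lebesgue_on \<Omega>. norm (f x + g x) powr p)
      \<le> 2 powr p * ((LINT x|lebesgue_on \<Omega>. norm (f x) powr p) + (LINT x|lebesgue_on \<Omega>. norm (g x) powr p))" .
qed

lemma sob_pair_add:
  assumes "sob_pair u g" "sob_pair v k"
  shows "sob_pair (\<lambda>x. u x + v x) (\<lambda>x. g x + k x)"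
proof -
  note U = sob_pairD[OF assms(1)] and V = sob_pairD[OF assms(2)]
  have "weak_grad \<Omega> (\<lambda>x. u x + v x) (\<lambda>x. g x + k x)"
    unfolding weak_grad_def
  proof (intro conjI allI impI ballI)
    show "(\<lambda>x. g x + k x) \<in> borel_measurable (lebesgue_on \<Omega>)" using U V by simp
    fix \<phi> and i :: 'a assume \<phi>: "test_fun \<Omega> \<phi>" and i: "i \<in> Basis"
    note loc = integrable_mult_test_fun[OF sob_pair_locally_integrable[OF assms(1)] \<phi>]
      integrable_mult_test_fun[OF sob_pair_locally_integrable[OF assms(2)] \<phi>]
      integrable_mult_test_fun[OF sob_pair_grad_locally_integrable[OF assms(1)] \<phi>]
      integrable_mult_test_fun[OF sob_pair_grad_locally_integrable[OF assms(2)] \<phi>]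
    show "(LINT x|lebesgue_on \<Omega>. (u x + v x) * frechet_derivative \<phi> (at x) i)
       = - (LINT x|lebesgue_on \<Omega>. (g x + k x) \<bullet> i * \<phi> x)"
      using weak_gradD[OF U(5) \<phi> i] weak_gradD[OF V(5) \<phi> i] loc
      by (simp add: inner_add_left distrib_right)
  qed
  then show ?thesis
    unfolding sob_pair_def
    using U V integrable_add_powr(1)[of g k] integrable_add_powr(1)[of u v] by auto
qed

lemma sob_pair_scale:
  assumes "sob_pair u g"
  shows "sob_pair (\<lambda>x. c * u x) (\<lambda>x. c *\<^sub>R g x)"
proof -
  note U = sob_pairD[OF assms]
  have "weak_grad \<Omega> (\<lambda>x. c * u x) (\<lambda>x. c *\<^sub>R g x)"
    unfolding weak_grad_def
  proof (intro conjI allI impI ballI)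
    show "(\<lambda>x. c *\<^sub>R g x) \<in> borel_measurable (lebesgue_on \<Omega>)" using U by simp
    fix \<phi> and i :: 'a assume \<phi>: "test_fun \<Omega> \<phi>" and i: "i \<in> Basis"
    show "(LINT x|lebesgue_on \<Omega>. (c * u x) * frechet_derivative \<phi> (at x) i)
       = - (LINT x|lebesgue_on \<Omega>. (c *\<^sub>R g x) \<bullet> i * \<phi> x)"
      using weak_gradD[OF U(5) \<phi> i] by (simp add: mult.assoc)
  qed
  then show ?thesis
    unfolding sob_pair_def using U by (auto simp: abs_mult powr_mult)
qed

lemma sob_pair_zero: "sob_pair (\<lambda>x. 0) (\<lambda>x. 0)"
  by (simp add: sob_pair_def weak_grad_def)

lemma sob_pair_diff:
  assumes "sob_pair u g" "sob_pair v k"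
  shows "sob_pair (\<lambda>x. u x - v x) (\<lambda>x. g x - k x)"
  using sob_pair_add[OF assms(1) sob_pair_scale[OF assms(2), of "-1"]] by simp

lemma sobolev_add: "sobolev \<Omega> p u \<Longrightarrow> sobolev \<Omega> p v \<Longrightarrow> sobolev \<Omega> p (\<lambda>x. u x + v x)"
  unfolding sobolev_iff_pair by (elim exE) (rule exI, rule sob_pair_add)

lemma sobolev_diff: "sobolev \<Omega> p u \<Longrightarrow> sobolev \<Omega> p v \<Longrightarrow> sobolev \<Omega> p (\<lambda>x. u x - v x)"
  unfolding sobolev_iff_pair by (elim exE) (rule exI, rule sob_pair_diff)

lemma sobolev_scale: "sobolev \<Omega> p u \<Longrightarrow> sobolev \<Omega> p (\<lambda>x. c * u x)"
  unfolding sobolev_iff_pair by (elim exE) (rule exI, rule sob_pair_scale)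

lemma sob_normp_zero: "sob_normp \<Omega> p (\<lambda>x. 0) = 0"
  using sob_normp_eq[OF sob_pair_zero] by simp

lemma sob_normp_add_le:
  assumes "sobolev \<Omega> p u" "sobolev \<Omega> p v"
  shows "sob_normp \<Omega> p (\<lambda>x. u x + v x) \<le> 2 powr p * (sob_normp \<Omega> p u + sob_normp \<Omega> p v)"
proof -
  obtain g k where gk: "sob_pair u g" "sob_pair v k" using assms sobolev_iff_pair by blast
  note U = sob_pairD[OF gk(1)] and V = sob_pairD[OF gk(2)]
  show ?thesis
    using integrable_add_powr(2)[of g k] integrable_add_powr(2)[of u v] U V
    unfolding sob_normp_eq[OF gk(1)] sob_normp_eq[OF gk(2)] sob_normp_eq[OF sob_pair_add[OF gk]]
    by (simp add: algebra_simps)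
qed

lemma sob_normp_scale:
  assumes "sobolev \<Omega> p u"
  shows "sob_normp \<Omega> p (\<lambda>x. c * u x) = \<bar>c\<bar> powr p * sob_normp \<Omega> p u"
proof -
  obtain g where g: "sob_pair u g" using assms sobolev_iff_pair by blast
  show ?thesis unfolding sob_normp_eq[OF g] sob_normp_eq[OF sob_pair_scale[OF g]]
    by (simp add: abs_mult powr_mult distrib_left)
qed

lemma sob_normp_diff_le:
  assumes "sobolev \<Omega> p u" "sobolev \<Omega> p v"
  shows "sob_normp \<Omega> p (\<lambda>x. u x - v x) \<le> 2 powr p * (sob_normp \<Omega> p u + sob_normp \<Omega> p v)"
  using sob_normp_add_le[OF assms(1) sobolev_scale[OF assms(2), of "-1"]] sob_normp_scale[OF assms(2), of "-1"]
  by simp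

text \<open>As \<open>\<epsilon>\<close> tends to 0 the smoothed square roots tend to the absolute
  value, and their derivatives tend to \<open>sgn (u x)\<close>, with value 0 at the zeros of
  \<open>u\<close>. Because \<open>\<epsilon> n \<le> 1\<close>, the function
  \<open>1 + \<bar>u x\<bar>\<close> dominates the square roots, so both sides of the chain rule
  pass to the limit.\<close>

lemma sob_pair_abs:
  assumes ug: "sob_pair u g" and V: "continuous_on UNIV V" "AE x in lebesgue_on \<Omega>. u x = V x"
  shows "sob_pair (\<lambda>x. \<bar>u x\<bar>) (\<lambda>x. sgn (u x) *\<^sub>R g x)"
proof -
  let ?M = "lebesgue_on \<Omega>"
  note U = sob_pairD[OF ug] and lu = sob_pair_locally_integrable[OF ug] and lg = sob_pair_grad_locally_integrable[OF ug]
  have sm: "(\<lambda>x. sgn (u x)) \<in> borel_measurable ?M" using U(1) by simp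
  have gm: "(\<lambda>x. sgn (u x) *\<^sub>R g x) \<in> borel_measurable ?M" using sm U(3) by simp
  have "weak_grad \<Omega> (\<lambda>x. \<bar>u x\<bar>) (\<lambda>x. sgn (u x) *\<^sub>R g x)"
    unfolding weak_grad_def
  proof (intro conjI allI impI ballI gm)
    fix \<phi> and i :: 'a assume \<phi>: "test_fun \<Omega> \<phi>" and i: "i \<in> Basis"
    let ?D = "\<lambda>x. frechet_derivative \<phi> (at x) i" and ?w = "\<lambda>x. g x \<bullet> i"
    define \<epsilon> where "\<epsilon> n = 1 / real (Suc n)" for n
    have \<epsilon>: "\<epsilon> n > 0" "\<epsilon> n \<le> 1" for n by (auto simp: \<epsilon>_def)
    have \<epsilon>0: "\<epsilon> \<longlonglongrightarrow> 0" unfolding \<epsilon>_def[abs_def] by (rule LIMSEQ_Suc[OF lim_1_over_n])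
    have mD: "?D \<in> borel_measurable ?M" "\<phi> \<in> borel_measurable ?M" "?w \<in> borel_measurable ?M"
      using continuous_measurable test_fun_continuous[OF \<phi>] U(3) by auto
    have l1: "locally_integrable (\<lambda>x. 1 + \<bar>u x\<bar>)"
      unfolding locally_integrable_def
    proof
      fix R
      have "integrable ?M (\<lambda>x. indicator (cball 0 R) x * (1::real))"
        using continuous_locally_integrable[OF continuous_on_const[of _ 1]]
        unfolding locally_integrable_def ..
      moreover have "integrable ?M (\<lambda>x. \<bar>indicator (cball 0 R) x * u x\<bar>)"
        using lu unfolding locally_integrable_def by (intro integrable_abs) blast
      ultimately have "integrable ?M (\<lambda>x. indicator (cball 0 R) x * 1 + \<bar>indicator (cball 0 R) x * u x\<bar>)"
        by (rule Bochner_Integration.integrable_add)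
      then show "integrable ?M (\<lambda>x. indicator (cball 0 R) x * (1 + \<bar>u x\<bar>))"
        by (simp add: abs_mult distrib_left)
    qed
    have eq: "(LINT x|?M. sqrt ((u x)\<^sup>2 + (\<epsilon> n)\<^sup>2) * ?D x)
        = - (LINT x|?M. ?w x * (u x / sqrt ((u x)\<^sup>2 + (\<epsilon> n)\<^sup>2) * \<phi> x))" for n
      by (rule sqrt_chain_rule[OF sob_pair_weak_partial[OF ug i] norm_Basis[OF i] U(1) mD(3) V \<epsilon>(1) \<phi>])
    have "(\<lambda>n. LINT x|?M. sqrt ((u x)\<^sup>2 + (\<epsilon> n)\<^sup>2) * ?D x) \<longlonglongrightarrow> (LINT x|?M. \<bar>u x\<bar> * ?D x)"
    proof (rule integral_dominated_convergence)
      show "integrable ?M (\<lambda>x. \<bar>(1 + \<bar>u x\<bar>) * ?D x\<bar>)"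
        using integrable_mult_test_fun(2)[OF l1 \<phi>] by (rule integrable_abs)
      show "AE x in ?M. norm (sqrt ((u x)\<^sup>2 + (\<epsilon> n)\<^sup>2) * ?D x) \<le> \<bar>(1 + \<bar>u x\<bar>) * ?D x\<bar>" for n
      proof (rule AE_I2)
        fix x
        have "sqrt ((u x)\<^sup>2 + (\<epsilon> n)\<^sup>2) \<le> \<bar>u x\<bar> + \<bar>\<epsilon> n\<bar>" by (rule sqrt_sum_squares_le_sum_abs)
        then have "sqrt ((u x)\<^sup>2 + (\<epsilon> n)\<^sup>2) \<le> 1 + \<bar>u x\<bar>" using \<epsilon>[of n] by simp
        from mult_right_mono[OF this, of "\<bar>?D x\<bar>"]
        show "norm (sqrt ((u x)\<^sup>2 + (\<epsilon> n)\<^sup>2) * ?D x) \<le> \<bar>(1 + \<bar>u x\<bar>) * ?D x\<bar>"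
          by (simp add: abs_mult)
      qed
      have "(\<lambda>n. sqrt ((u x)\<^sup>2 + (\<epsilon> n)\<^sup>2) * ?D x) \<longlonglongrightarrow> sqrt ((u x)\<^sup>2 + 0\<^sup>2) * ?D x" for x
        by (intro tendsto_intros \<epsilon>0)
      then show "AE x in ?M. (\<lambda>n. sqrt ((u x)\<^sup>2 + (\<epsilon> n)\<^sup>2) * ?D x) \<longlonglongrightarrow> \<bar>u x\<bar> * ?D x"
        by simp
    qed (use U(1) mD in auto)
    moreover have "(\<lambda>n. LINT x|?M. ?w x * (u x / sqrt ((u x)\<^sup>2 + (\<epsilon> n)\<^sup>2) * \<phi> x))
        \<longlonglongrightarrow> (LINT x|?M. ?w x * (sgn (u x) * \<phi> x))"
    proof (rule integral_dominated_convergence)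
      show "integrable ?M (\<lambda>x. \<bar>?w x * \<phi> x\<bar>)"
        using integrable_mult_test_fun(1)[OF lg \<phi>] by (rule integrable_abs)
      show "AE x in ?M. norm (?w x * (u x / sqrt ((u x)\<^sup>2 + (\<epsilon> n)\<^sup>2) * \<phi> x)) \<le> \<bar>?w x * \<phi> x\<bar>" for n
      proof (rule AE_I2)
        fix x
        have "\<bar>u x\<bar> \<le> sqrt ((u x)\<^sup>2 + (\<epsilon> n)\<^sup>2)" by simp
        moreover have "sqrt ((u x)\<^sup>2 + (\<epsilon> n)\<^sup>2) > 0"
          using \<epsilon>(1)[of n] by (auto intro!: add_nonneg_pos)
        ultimately have "\<bar>u x / sqrt ((u x)\<^sup>2 + (\<epsilon> n)\<^sup>2)\<bar> \<le> 1" by (simp add: abs_divide)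
        from mult_right_mono[OF this, of "\<bar>?w x * \<phi> x\<bar>"]
        show "norm (?w x * (u x / sqrt ((u x)\<^sup>2 + (\<epsilon> n)\<^sup>2) * \<phi> x)) \<le> \<bar>?w x * \<phi> x\<bar>"
          by (simp add: abs_mult mult_ac)
      qed
      have "(\<lambda>n. u x / sqrt ((u x)\<^sup>2 + (\<epsilon> n)\<^sup>2)) \<longlonglongrightarrow> sgn (u x)" for x
      proof (cases "u x = 0")
        case False
        then have "(\<lambda>n. u x / sqrt ((u x)\<^sup>2 + (\<epsilon> n)\<^sup>2)) \<longlonglongrightarrow> u x / sqrt ((u x)\<^sup>2 + 0\<^sup>2)"
          by (intro tendsto_intros \<epsilon>0) auto
        then show ?thesis by (simp add: real_sgn_eq)
      qed simp
      then show "AE x in ?M. (\<lambda>n. ?w x * (u x / sqrt ((u x)\<^sup>2 + (\<epsilon> n)\<^sup>2) * \<phi> x))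
          \<longlonglongrightarrow> ?w x * (sgn (u x) * \<phi> x)"
        by (intro AE_I2 tendsto_intros)
    qed (use U(1) mD sm in auto)
    ultimately have "(LINT x|?M. \<bar>u x\<bar> * ?D x) = - (LINT x|?M. ?w x * (sgn (u x) * \<phi> x))"
      unfolding eq by (intro LIMSEQ_unique[OF _ tendsto_minus])
    also have "(\<lambda>x. ?w x * (sgn (u x) * \<phi> x)) = (\<lambda>x. (sgn (u x) *\<^sub>R g x) \<bullet> i * \<phi> x)"
      by (auto simp: mult_ac)
    finally show "(LINT x|?M. \<bar>u x\<bar> * ?D x) = - (LINT x|?M. (sgn (u x) *\<^sub>R g x) \<bullet> i * \<phi> x)" .
  qed
  moreover have "integrable ?M (\<lambda>x. norm (sgn (u x) *\<^sub>R g x) powr p)"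
  proof (rule Bochner_Integration.integrable_bound[OF U(4)])
    show "(\<lambda>x. norm (sgn (u x) *\<^sub>R g x) powr p) \<in> borel_measurable ?M" using gm by measurable
    have "norm (sgn (u x) *\<^sub>R g x) powr p \<le> norm (g x) powr p" for x
      by (cases "u x = 0") (simp_all add: abs_sgn_eq)
    then show "AE x in ?M. norm (norm (sgn (u x) *\<^sub>R g x) powr p) \<le> norm (norm (g x) powr p)"
      by simp
  qed
  moreover have "(\<lambda>x. \<bar>u x\<bar>) \<in> borel_measurable ?M" using U(1) by measurable
  ultimately show ?thesis unfolding sob_pair_def using U(2) by simp
qed

lemma sob_normp_abs_le:
  assumes u: "sobolev \<Omega> p u" and V: "continuous_on UNIV V" "AE x in lebesgue_on \<Omega>. u x = V x"
  shows "sobolev \<Omega> p (\<lambda>x. \<bar>u x\<bar>)" "sob_normp \<Omega> p (\<lambda>x. \<bar>u x\<bar>) \<le> sob_normp \<Omega> p u"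
proof -
  obtain g where g: "sob_pair u g" using u sobolev_iff_pair by blast
  note a = sob_pair_abs[OF g V]
  show "sobolev \<Omega> p (\<lambda>x. \<bar>u x\<bar>)" using a sobolev_iff_pair by blast
  have "(LINT x|lebesgue_on \<Omega>. norm (sgn (u x) *\<^sub>R g x) powr p) \<le> (LINT x|lebesgue_on \<Omega>. norm (g x) powr p)"
    by (intro integral_mono sob_pairD(4)[OF a] sob_pairD(4)[OF g]) (auto simp: sgn_if)
  then show "sob_normp \<Omega> p (\<lambda>x. \<bar>u x\<bar>) \<le> sob_normp \<Omega> p u"
    unfolding sob_normp_eq[OF g] sob_normp_eq[OF a] by simp
qed

end

section \<open>Series of Sobolev functions\<close>

text \<open>The geometric weights bound \<open>\<Sum>k. b k\<close> by the supremum of \<open>2 ^ Suc k * b k\<close>; this takes the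
  place of Minkowski's inequality for the \<open>L\<^sup>p\<close> norm.\<close>

lemma series_powr_bound:
  fixes b :: "nat \<Rightarrow> real"
  assumes p: "p > 0" and b: "\<And>k. 0 \<le> b k" and s: "summable (\<lambda>k. (2 powr p) ^ Suc k * b k powr p)"
  shows "summable b" "(\<Sum>k. b k) powr p \<le> (\<Sum>k. (2 powr p) ^ Suc k * b k powr p)"
proof -
  define S where "S = (\<Sum>k. (2 powr p) ^ Suc k * b k powr p)"
  have pos: "0 \<le> (2 powr p) ^ Suc k * b k powr p" for k by simp
  have S0: "S \<ge> 0" unfolding S_def by (rule suminf_nonneg[OF s pos])
  have le: "b k \<le> S powr (1 / p) * (1 / 2) ^ Suc k" for k
  proof -
    have "(2 ^ Suc k * b k) powr p = (2 powr p) ^ Suc k * b k powr p"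
      using b[of k] by (simp add: powr_mult powr_powr powr_realpow[symmetric] mult.commute del: power_Suc)
    also have "\<dots> = sum (\<lambda>k. (2 powr p) ^ Suc k * b k powr p) {k}" by simp
    also have "\<dots> \<le> S" unfolding S_def by (rule sum_le_suminf[OF s]) (use pos in auto)
    finally have "((2 ^ Suc k * b k) powr p) powr (1 / p) \<le> S powr (1 / p)"
      using p by (intro powr_mono2) auto
    then have "2 ^ Suc k * b k \<le> S powr (1 / p)"
      using b[of k] p by (simp add: powr_powr del: power_Suc)
    then show ?thesis by (simp add: field_simps del: power_Suc)
  qed
  have geo: "(\<lambda>k. S powr (1 / p) * (1 / 2) ^ Suc k) sums (S powr (1 / p) * 1)"
    by (intro sums_mult power_half_series)
  show sb: "summable b"
    by (rule summable_comparison_test'[OF sums_summable[OF geo], of 0]) (use le b in auto)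
  have "(\<Sum>k. b k) \<le> S powr (1 / p)"
    using suminf_le[OF le sb sums_summable[OF geo]] sums_unique[OF geo] by simp
  then have "(\<Sum>k. b k) powr p \<le> (S powr (1 / p)) powr p"
    using p suminf_nonneg[OF sb b] by (intro powr_mono2) auto
  also have "\<dots> = S" using p S0 by (simp add: powr_powr)
  finally show "(\<Sum>k. b k) powr p \<le> (\<Sum>k. (2 powr p) ^ Suc k * b k powr p)" by (simp add: S_def)
qed

lemma AE_summable_of_summable_integral:
  fixes F :: "nat \<Rightarrow> 'a \<Rightarrow> real"
  assumes "\<And>k. integrable M (F k)" "\<And>k x. 0 \<le> F k x" "summable (\<lambda>k. integral\<^sup>L M (F k))"
  shows "AE x in M. summable (\<lambda>k. F k x)"
proof -
  have m: "F k \<in> borel_measurable M" for k using assms(1) by auto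
  have "(\<integral>\<^sup>+x. (\<Sum>k. ennreal (F k x)) \<partial>M) = (\<Sum>k. \<integral>\<^sup>+x. ennreal (F k x) \<partial>M)"
    using m by (intro nn_integral_suminf) auto
  also have "\<dots> = (\<Sum>k. ennreal (integral\<^sup>L M (F k)))"
    using assms by (intro suminf_cong nn_integral_eq_integral) auto
  also have "\<dots> = ennreal (\<Sum>k. integral\<^sup>L M (F k))"
    using assms by (intro suminf_ennreal2) auto
  finally have "(\<integral>\<^sup>+x. (\<Sum>k. ennreal (F k x)) \<partial>M) \<noteq> \<infinity>" by simp
  then have "AE x in M. (\<Sum>k. ennreal (F k x)) \<noteq> \<infinity>"
    using m by (intro nn_integral_PInf_AE) auto
  then show ?thesis
    by eventually_elim (use assms(2) in \<open>auto intro: summable_suminf_not_top\<close>)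
qed

context sobolev_domain
begin

text \<open>\<open>S\<close> is the weighted series of the p-th powers: the bounds \<open>a\<close>
  make it integrable, and \<open>series_powr_bound\<close> applies at almost every point.\<close>

lemma Lp_series_bound:
  fixes f :: "nat \<Rightarrow> 'a \<Rightarrow> 'b::euclidean_space"
  assumes m: "\<And>k. f k \<in> borel_measurable (lebesgue_on \<Omega>)"
    and i: "\<And>k. integrable (lebesgue_on \<Omega>) (\<lambda>x. norm (f k x) powr p)"
    and a: "\<And>k. (2 powr p) ^ Suc k * (LINT x|lebesgue_on \<Omega>. norm (f k x) powr p) \<le> a k" "summable a"
  obtains S where "integrable (lebesgue_on \<Omega>) S"
    "AE x in lebesgue_on \<Omega>. summable (\<lambda>k. norm (f k x)) \<and> (\<Sum>k. norm (f k x)) powr p \<le> S x"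
    "integral\<^sup>L (lebesgue_on \<Omega>) S \<le> suminf a"
proof -
  let ?M = "lebesgue_on \<Omega>"
  let ?F = "\<lambda>k x. (2 powr p) ^ Suc k * norm (f k x) powr p"
  have iF: "integrable ?M (?F k)" for k using i by simp
  have F0: "0 \<le> ?F k x" for k x by simp
  have le: "integral\<^sup>L ?M (?F k) \<le> a k" for k using a(1)[of k] by simp
  have sF: "summable (\<lambda>k. integral\<^sup>L ?M (?F k))"
    by (rule summable_comparison_test'[OF a(2), of 0]) (use le in simp)
  have AEs: "AE x in ?M. summable (\<lambda>k. ?F k x)"
    by (rule AE_summable_of_summable_integral[OF iF F0 sF])
  then have AEs': "AE x in ?M. summable (\<lambda>k. norm (?F k x))" by simp
  have sF': "summable (\<lambda>k. LINT x|?M. norm (?F k x))" using sF by simp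
  show thesis
  proof
    show "integrable ?M (\<lambda>x. \<Sum>k. ?F k x)"
      by (rule integrable_suminf[OF iF AEs' sF'])
    show "AE x in ?M. summable (\<lambda>k. norm (f k x)) \<and> (\<Sum>k. norm (f k x)) powr p \<le> (\<Sum>k. ?F k x)"
      using AEs
    proof eventually_elim
      case (elim x)
      then show ?case using series_powr_bound[of p "\<lambda>k. norm (f k x)"] p_gt_1 by simp
    qed
    have "(LINT x|?M. (\<Sum>k. ?F k x)) = (\<Sum>k. integral\<^sup>L ?M (?F k))"
      by (rule integral_suminf[OF iF AEs' sF'])
    also have "\<dots> \<le> suminf a" by (rule suminf_le[OF le sF a(2)])
    finally show "(LINT x|?M. (\<Sum>k. ?F k x)) \<le> suminf a" .
  qed
qed

text \<open>Besides the limit this provides one dominating function \<open>1 + S\<close> for all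
  partial sums. With it weak gradients pass to the limit by dominated convergence, without any
  duality argument.\<close>

lemma Lp_series:
  fixes f :: "nat \<Rightarrow> 'a \<Rightarrow> 'b::euclidean_space"
  assumes m: "\<And>k. f k \<in> borel_measurable (lebesgue_on \<Omega>)"
    and i: "\<And>k. integrable (lebesgue_on \<Omega>) (\<lambda>x. norm (f k x) powr p)"
    and a: "\<And>k. (2 powr p) ^ Suc k * (LINT x|lebesgue_on \<Omega>. norm (f k x) powr p) \<le> a k" "summable a"
  obtains v S where "v \<in> borel_measurable (lebesgue_on \<Omega>)"
    "integrable (lebesgue_on \<Omega>) (\<lambda>x. norm (v x) powr p)"
    "AE x in lebesgue_on \<Omega>. (\<lambda>k. f k x) sums v x"
    "integrable (lebesgue_on \<Omega>) S"
    "AE x in lebesgue_on \<Omega>. \<forall>n. norm (\<Sum>k<n. f k x) \<le> 1 + S x"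
    "\<forall>n. (LINT x|lebesgue_on \<Omega>. norm (v x - (\<Sum>k<n. f k x)) powr p) \<le> (\<Sum>k. a (k + n))"
proof -
  let ?M = "lebesgue_on \<Omega>" and ?v = "\<lambda>x. \<Sum>k. f k x"
  obtain S where S: "integrable ?M S"
    "AE x in ?M. summable (\<lambda>k. norm (f k x)) \<and> (\<Sum>k. norm (f k x)) powr p \<le> S x"
    using Lp_series_bound[OF m i a] .
  have vm: "?v \<in> borel_measurable ?M" using m by (rule borel_measurable_suminf)
  have pm: "(\<lambda>x. \<Sum>k<n. f k x) \<in> borel_measurable ?M" for n using m by (rule borel_measurable_sum)
  have tail: "integrable ?M (\<lambda>x. norm (?v x - (\<Sum>k<n. f k x)) powr p) \<and>
     (LINT x|?M. norm (?v x - (\<Sum>k<n. f k x)) powr p) \<le> (\<Sum>k. a (k + n))" for n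
  proof -
    \<comment> \<open>Renumbering after the first \<open>n\<close> terms lowers the weights, because
      \<open>2 powr p \<ge> 1\<close>; the tail thus satisfies the same hypotheses with the shifted
      bounds.\<close>
    have sh: "(2 powr p) ^ Suc k * (LINT x|?M. norm (f (k + n) x) powr p) \<le> a (k + n)" for k
    proof -
      have "1 \<le> 2 powr p" using p_gt_1 by (simp add: ge_one_powr_ge_zero)
      then have "(2 powr p) ^ Suc k * (LINT x|?M. norm (f (k + n) x) powr p)
          \<le> (2 powr p) ^ Suc (k + n) * (LINT x|?M. norm (f (k + n) x) powr p)"
        by (intro mult_right_mono power_increasing) auto
      also have "\<dots> \<le> a (k + n)" by (rule a(1))
      finally show ?thesis .
    qed
    have sa: "summable (\<lambda>k. a (k + n))" using a(2) by (simp add: summable_iff_shift)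
    obtain T where T: "integrable ?M T"
      "AE x in ?M. summable (\<lambda>k. norm (f (k + n) x)) \<and> (\<Sum>k. norm (f (k + n) x)) powr p \<le> T x"
      "integral\<^sup>L ?M T \<le> (\<Sum>k. a (k + n))"
      using Lp_series_bound[of "\<lambda>k. f (k + n)" "\<lambda>k. a (k + n)", OF m i sh sa] .
    have le: "AE x in ?M. norm (?v x - (\<Sum>k<n. f k x)) powr p \<le> T x"
      using S(2) T(2)
    proof eventually_elim
      case (elim x)
      have "summable (\<lambda>k. f k x)" by (rule summable_norm_cancel) (use elim in simp)
      then have "?v x - (\<Sum>k<n. f k x) = (\<Sum>k. f (k + n) x)"
        by (rule suminf_minus_initial_segment[symmetric])
      then have "norm (?v x - (\<Sum>k<n. f k x)) \<le> (\<Sum>k. norm (f (k + n) x))"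
        using elim by (simp add: summable_norm)
      then have "norm (?v x - (\<Sum>k<n. f k x)) powr p \<le> (\<Sum>k. norm (f (k + n) x)) powr p"
        using p_gt_1 by (intro powr_mono2) auto
      then show ?case using elim by linarith
    qed
    have I: "integrable ?M (\<lambda>x. norm (?v x - (\<Sum>k<n. f k x)) powr p)"
    proof (rule Bochner_Integration.integrable_bound[OF T(1)])
      show "(\<lambda>x. norm (?v x - (\<Sum>k<n. f k x)) powr p) \<in> borel_measurable ?M"
        using vm pm[of n] by measurable
      show "AE x in ?M. norm (norm (?v x - (\<Sum>k<n. f k x)) powr p) \<le> norm (T x)"
        using le by eventually_elim auto
    qed
    have "(LINT x|?M. norm (?v x - (\<Sum>k<n. f k x)) powr p) \<le> integral\<^sup>L ?M T"
      by (rule integral_mono_AE[OF I T(1) le])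
    with I T(3) show ?thesis by simp
  qed
  show thesis
  proof (rule that[OF vm])
    show "integrable ?M (\<lambda>x. norm (?v x) powr p)" using tail[of 0] by simp
    show "AE x in ?M. (\<lambda>k. f k x) sums ?v x"
      using S(2) by eventually_elim (auto intro: summable_sums summable_norm_cancel)
    show "integrable ?M S" by fact
    show "AE x in ?M. \<forall>n. norm (\<Sum>k<n. f k x) \<le> 1 + S x"
      using S(2)
    proof eventually_elim
      case (elim x)
      show ?case
      proof
        fix n
        have "norm (\<Sum>k<n. f k x) \<le> (\<Sum>k<n. norm (f k x))" by (rule norm_sum)
        also have "\<dots> \<le> (\<Sum>k. norm (f k x))" using elim by (intro sum_le_suminf) auto
        also have "\<dots> \<le> 1 + (\<Sum>k. norm (f k x)) powr p"
          using elim p_gt_1 by (intro le_one_plus_powr suminf_nonneg) auto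
        finally show "norm (\<Sum>k<n. f k x) \<le> 1 + S x" using elim by linarith
      qed
    qed
  qed (use tail in blast)
qed

lemma sob_pair_sum:
  assumes "\<And>k. sob_pair (h k) (g k)"
  shows "sob_pair (\<lambda>x. \<Sum>k<n. h k x) (\<lambda>x. \<Sum>k<(n::nat). g k x)"
  by (induction n) (simp_all add: sob_pair_zero sob_pair_add assms)

lemma dominated_convergence_test:
  fixes s :: "nat \<Rightarrow> 'a \<Rightarrow> real"
  assumes lim: "AE x in lebesgue_on \<Omega>. (\<lambda>n. s n x) \<longlonglongrightarrow> f x"
    and dom: "AE x in lebesgue_on \<Omega>. \<forall>n. \<bar>s n x\<bar> \<le> 1 + S x" and S: "integrable (lebesgue_on \<Omega>) S"
    and m: "f \<in> borel_measurable (lebesgue_on \<Omega>)" "\<And>n. s n \<in> borel_measurable (lebesgue_on \<Omega>)"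
    and \<theta>: "continuous_on UNIV \<theta>" "\<And>x. x \<notin> cball 0 R \<Longrightarrow> \<theta> x = 0"
  shows "(\<lambda>n. LINT x|lebesgue_on \<Omega>. s n x * \<theta> x) \<longlonglongrightarrow> (LINT x|lebesgue_on \<Omega>. f x * \<theta> x)"
proof (rule integral_dominated_convergence)
  let ?M = "lebesgue_on \<Omega>"
  have \<theta>m: "\<theta> \<in> borel_measurable ?M" by (rule continuous_measurable[OF \<theta>(1)])
  show "(\<lambda>x. f x * \<theta> x) \<in> borel_measurable ?M" "(\<lambda>x. s n x * \<theta> x) \<in> borel_measurable ?M" for n
    using m \<theta>m by auto
  have "locally_integrable (\<lambda>x. 1 + \<bar>S x\<bar>)"
    by (rule locally_integrable_dominated[of _ "\<lambda>x. \<bar>S x\<bar>"]) (use S in auto)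
  then show "integrable ?M (\<lambda>x. \<bar>(1 + \<bar>S x\<bar>) * \<theta> x\<bar>)"
    by (intro integrable_abs locally_integrable_mult_continuous[OF _ \<theta>])
  show "AE x in ?M. (\<lambda>n. s n x * \<theta> x) \<longlonglongrightarrow> f x * \<theta> x"
    using lim by eventually_elim (rule tendsto_mult_right)
  show "AE x in ?M. norm (s n x * \<theta> x) \<le> \<bar>(1 + \<bar>S x\<bar>) * \<theta> x\<bar>" for n
    using dom
  proof eventually_elim
    case (elim x)
    then have "\<bar>s n x\<bar> \<le> 1 + \<bar>S x\<bar>" by (meson abs_ge_self add_left_mono order_trans)
    from mult_right_mono[OF this, of "\<bar>\<theta> x\<bar>"] show ?case by (simp add: abs_mult)
  qed
qed

text \<open>Completeness in the form of convergent series. Functions and gradients are summed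
  separately; every partial sum satisfies the weak gradient identity, which survives in the limit
  against a fixed test function.\<close>

lemma sobolev_series:
  assumes h: "\<And>k. sobolev \<Omega> p (h k)"
    and a: "\<And>k. (2 powr p) ^ Suc k * sob_normp \<Omega> p (h k) \<le> a k" "summable a"
  obtains v where "sobolev \<Omega> p v" "AE x in lebesgue_on \<Omega>. (\<lambda>k. h k x) sums v x"
    "\<And>n. sob_normp \<Omega> p (\<lambda>x. v x - (\<Sum>k<n. h k x)) \<le> (\<Sum>k. a (k + n))"
proof -
  let ?M = "lebesgue_on \<Omega>"
  define g where "g k = wgrad \<Omega> p (h k)" for k
  have hg: "sob_pair (h k) (g k)" for k unfolding g_def by (rule sob_pair_wgrad[OF h])
  note D = sob_pairD[OF hg]
  \<comment> \<open>The bound \<open>a\<close> is split between function and gradient, so that the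
    two tail estimates add up to the tail of \<open>a\<close> again.\<close>
  define A B where "A k = (2 powr p) ^ Suc k * (LINT x|?M. norm (h k x) powr p)"
    and "B k = (2 powr p) ^ Suc k * (LINT x|?M. norm (g k x) powr p)" for k
  have AB: "A k + B k \<le> a k" for k
    using a(1)[of k] unfolding sob_normp_eq[OF hg] A_def B_def by (simp add: distrib_left)
  have pos: "0 \<le> A k" "0 \<le> B k" for k by (auto simp: A_def B_def)
  have "norm (A k) \<le> a k" "norm (B k) \<le> a k" for k
    using AB[of k] pos[of k] by auto
  then have sA: "summable A" and sB: "summable B"
    by (auto intro!: summable_comparison_test'[OF a(2), of 0])
  have ih: "integrable ?M (\<lambda>x. norm (h k x) powr p)" for k using D(2) by simp
  have leA: "(2 powr p) ^ Suc k * (LINT x|?M. norm (h k x) powr p) \<le> A k" for k by (simp add: A_def)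
  have leB: "(2 powr p) ^ Suc k * (LINT x|?M. norm (g k x) powr p) \<le> B k" for k by (simp add: B_def)
  obtain v S where v: "v \<in> borel_measurable ?M" "integrable ?M (\<lambda>x. norm (v x) powr p)"
    "AE x in ?M. (\<lambda>k. h k x) sums v x" "integrable ?M S" "AE x in ?M. \<forall>n. norm (\<Sum>k<n. h k x) \<le> 1 + S x"
    "\<forall>n. (LINT x|?M. norm (v x - (\<Sum>k<n. h k x)) powr p) \<le> (\<Sum>k. A (k + n))"
    using Lp_series[OF D(1) ih leA sA] .
  obtain G T where G: "G \<in> borel_measurable ?M" "integrable ?M (\<lambda>x. norm (G x) powr p)"
    "AE x in ?M. (\<lambda>k. g k x) sums G x" "integrable ?M T" "AE x in ?M. \<forall>n. norm (\<Sum>k<n. g k x) \<le> 1 + T x"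
    "\<forall>n. (LINT x|?M. norm (G x - (\<Sum>k<n. g k x)) powr p) \<le> (\<Sum>k. B (k + n))"
    using Lp_series[OF D(3) D(4) leB sB] .
  have "weak_grad \<Omega> v G"
    unfolding weak_grad_def
  proof (intro conjI allI impI ballI G(1))
    fix \<phi> and i :: 'a assume \<phi>: "test_fun \<Omega> \<phi>" and i: "i \<in> Basis"
    obtain R where R: "\<And>x. x \<notin> cball 0 R \<Longrightarrow> \<phi> x = 0" "\<And>x v. x \<notin> cball 0 R \<Longrightarrow> frechet_derivative \<phi> (at x) v = 0"
      using test_fun_support[OF \<phi>] by metis
    have "(\<lambda>n. LINT x|?M. (\<Sum>k<n. h k x) * frechet_derivative \<phi> (at x) i)
       \<longlonglongrightarrow> (LINT x|?M. v x * frechet_derivative \<phi> (at x) i)"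
    proof (rule dominated_convergence_test[OF _ _ v(4) v(1) _ test_fun_continuous(2)[OF \<phi>] R(2)])
      show "AE x in ?M. (\<lambda>n. \<Sum>k<n. h k x) \<longlonglongrightarrow> v x" using v(3) by (simp add: sums_def)
      show "AE x in ?M. \<forall>n. \<bar>\<Sum>k<n. h k x\<bar> \<le> 1 + S x" using v(5) by simp
      show "(\<lambda>x. \<Sum>k<n. h k x) \<in> borel_measurable ?M" for n using D(1) by (rule borel_measurable_sum)
    qed
    moreover have "(\<lambda>n. LINT x|?M. ((\<Sum>k<n. g k x) \<bullet> i) * \<phi> x) \<longlonglongrightarrow> (LINT x|?M. (G x \<bullet> i) * \<phi> x)"
    proof (rule dominated_convergence_test[OF _ _ G(4) _ _ test_fun_continuous(1)[OF \<phi>] R(1)])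
      show "AE x in ?M. (\<lambda>n. (\<Sum>k<n. g k x) \<bullet> i) \<longlonglongrightarrow> G x \<bullet> i"
        using G(3) unfolding sums_def by eventually_elim (intro tendsto_intros)
      show "AE x in ?M. \<forall>n. \<bar>(\<Sum>k<n. g k x) \<bullet> i\<bar> \<le> 1 + T x"
        using G(5) by eventually_elim (meson Basis_le_norm i order_trans)
      show "(\<lambda>x. G x \<bullet> i) \<in> borel_measurable ?M" using G(1) by simp
      show "(\<lambda>x. (\<Sum>k<n. g k x) \<bullet> i) \<in> borel_measurable ?M" for n
        using borel_measurable_sum[of "{..<n}" g, OF D(3)] by simp
    qed
    moreover have "(LINT x|?M. (\<Sum>k<n. h k x) * frechet_derivative \<phi> (at x) i)
        = - (LINT x|?M. ((\<Sum>k<n. g k x) \<bullet> i) * \<phi> x)" for n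
      by (rule weak_gradD[OF sob_pairD(5)[OF sob_pair_sum[OF hg]] \<phi> i])
    ultimately show "(LINT x|?M. v x * frechet_derivative \<phi> (at x) i) = - (LINT x|?M. (G x \<bullet> i) * \<phi> x)"
      by (simp only:) (rule LIMSEQ_unique[OF _ tendsto_minus])
  qed
  then have vG: "sob_pair v G" unfolding sob_pair_def using v G by simp
  show thesis
  proof (rule that[OF _ v(3)])
    show "sobolev \<Omega> p v" using vG sobolev_iff_pair by blast
    fix n
    have "sob_normp \<Omega> p (\<lambda>x. v x - (\<Sum>k<n. h k x)) \<le> (\<Sum>k. A (k + n)) + (\<Sum>k. B (k + n))"
      unfolding sob_normp_eq[OF sob_pair_diff[OF vG sob_pair_sum[OF hg]]]
      using v(6)[rule_format, of n] G(6)[rule_format, of n] by simp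
    also have "\<dots> = (\<Sum>k. A (k + n) + B (k + n))"
      using sA sB by (intro suminf_add) (simp_all add: summable_iff_shift)
    also have "\<dots> \<le> (\<Sum>k. a (k + n))"
      using AB sA sB a(2) by (intro suminf_le summable_add) (simp_all add: summable_iff_shift)
    finally show "sob_normp \<Omega> p (\<lambda>x. v x - (\<Sum>k<n. h k x)) \<le> (\<Sum>k. a (k + n))" .
  qed
qed

end

section \<open>The space \<open>Wt\<close>\<close>

context sobolev_domain
begin

definition cont_sob :: "('a \<Rightarrow> real) \<Rightarrow> bool" where
  "cont_sob u \<longleftrightarrow> sobolev \<Omega> p u \<and>
      (\<exists>v. continuous_on (closure \<Omega>) v \<and> compact (closure {x\<in>closure \<Omega>. v x \<noteq> 0})
           \<and> (AE x in lebesgue_on \<Omega>. u x = v x))"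

lemma Wt_eq: "Wt \<Omega> p = sob_closure \<Omega> p (Collect cont_sob)"
  unfolding Wt_def cont_sob_def[abs_def] ..

lemma Wt_sobolev: "u \<in> Wt \<Omega> p \<Longrightarrow> sobolev \<Omega> p u"
  by (simp add: Wt_def sob_closure_def)

lemma Wt_approx:
  assumes "u \<in> Wt \<Omega> p" "\<epsilon> > 0"
  obtains c where "cont_sob c" "sob_normp \<Omega> p (\<lambda>x. u x - c x) < \<epsilon>"
  using assms unfolding Wt_eq sob_closure_def by blast

lemma cont_sob_lincomb:
  assumes "cont_sob u" "cont_sob w"
  shows "cont_sob (\<lambda>x. a * u x + b * w x)"
proof -
  obtain v v' where v: "continuous_on (closure \<Omega>) v" "bounded {x\<in>closure \<Omega>. v x \<noteq> 0}"
      "AE x in lebesgue_on \<Omega>. u x = v x"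
    and v': "continuous_on (closure \<Omega>) v'" "bounded {x\<in>closure \<Omega>. v' x \<noteq> 0}"
      "AE x in lebesgue_on \<Omega>. w x = v' x"
    using assms unfolding cont_sob_def compact_closure by blast
  have "bounded {x\<in>closure \<Omega>. a * v x + b * v' x \<noteq> 0}"
    by (rule bounded_subset[OF bounded_Un[THEN iffD2, OF conjI[OF v(2) v'(2)]]]) auto
  moreover have "AE x in lebesgue_on \<Omega>. a * u x + b * w x = a * v x + b * v' x"
    using v(3) v'(3) by eventually_elim simp
  moreover have "continuous_on (closure \<Omega>) (\<lambda>x. a * v x + b * v' x)"
    by (intro continuous_intros v v')
  moreover have "sobolev \<Omega> p (\<lambda>x. a * u x + b * w x)"
    using assms by (intro sobolev_add sobolev_scale) (auto simp: cont_sob_def)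
  ultimately show ?thesis unfolding cont_sob_def compact_closure by blast
qed

lemma cont_sob_diff: "cont_sob u \<Longrightarrow> cont_sob w \<Longrightarrow> cont_sob (\<lambda>x. u x - w x)"
  using cont_sob_lincomb[of u w 1 "-1"] by simp

lemma cont_sob_abs:
  assumes "cont_sob u"
  shows "cont_sob (\<lambda>x. \<bar>u x\<bar>)" "sob_normp \<Omega> p (\<lambda>x. \<bar>u x\<bar>) \<le> sob_normp \<Omega> p u"
proof -
  obtain v where v: "continuous_on (closure \<Omega>) v" "bounded {x\<in>closure \<Omega>. v x \<noteq> 0}"
      "AE x in lebesgue_on \<Omega>. u x = v x" and u: "sobolev \<Omega> p u"
    using assms unfolding cont_sob_def compact_closure by blast
  \<comment> \<open>The chain rule asks for a representative that is continuous on the whole space;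
    Tietze's theorem extends \<open>v\<close> from the closed set
    \<open>closure \<Omega>\<close>.\<close>
  obtain V where V: "continuous_on UNIV V" "\<And>x. x \<in> closure \<Omega> \<Longrightarrow> V x = v x"
    using Tietze_unbounded[of "closure \<Omega>" v UNIV] v(1) by auto
  have uV: "AE x in lebesgue_on \<Omega>. u x = V x"
    using v(3) AE_space
  proof eventually_elim
    case (elim x)
    then show ?case using V(2)[of x] closure_subset[of \<Omega>] by auto
  qed
  note a = sob_normp_abs_le[OF u V(1) uV]
  show "sob_normp \<Omega> p (\<lambda>x. \<bar>u x\<bar>) \<le> sob_normp \<Omega> p u" by (fact a)
  have "AE x in lebesgue_on \<Omega>. \<bar>u x\<bar> = \<bar>v x\<bar>" using v(3) by eventually_elim simp
  moreover have "continuous_on (closure \<Omega>) (\<lambda>x. \<bar>v x\<bar>)" by (intro continuous_intros v)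
  moreover have "bounded {x\<in>closure \<Omega>. \<bar>v x\<bar> \<noteq> 0}" using v(2) by simp
  ultimately show "cont_sob (\<lambda>x. \<bar>u x\<bar>)"
    using a(1) unfolding cont_sob_def compact_closure by blast
qed

text \<open>Compact support makes the continuous representative bounded. This is the source of the
  lower bound \<open>- B\<close> on which the converse direction rests.\<close>

lemma cont_sob_bounded:
  assumes "cont_sob u"
  obtains B where "B \<ge> 0" "AE x in lebesgue_on \<Omega>. \<bar>u x\<bar> \<le> B"
proof -
  obtain v where v: "continuous_on (closure \<Omega>) v" "compact (closure {x\<in>closure \<Omega>. v x \<noteq> 0})"
      "AE x in lebesgue_on \<Omega>. u x = v x"
    using assms unfolding cont_sob_def by blast
  let ?S = "{x\<in>closure \<Omega>. v x \<noteq> 0}"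
  have "closure ?S \<subseteq> closure \<Omega>" by (rule closure_minimal) auto
  then have "bounded (v ` closure ?S)"
    using v by (intro compact_imp_bounded compact_continuous_image continuous_on_subset[OF v(1)])
  then obtain B where "\<forall>y\<in>v ` closure ?S. norm y \<le> B"
    unfolding bounded_iff by blast
  then have B: "\<bar>v x\<bar> \<le> B" if "x \<in> closure ?S" for x using that by simp
  have "AE x in lebesgue_on \<Omega>. \<bar>u x\<bar> \<le> max B 0"
    using v(3) AE_space
  proof eventually_elim
    case (elim x)
    have "x \<in> closure \<Omega>" using elim closure_subset[of \<Omega>] by auto
    then have "v x = 0 \<or> x \<in> closure ?S" using closure_subset[of ?S] by blast
    then show ?case using B[of x] elim by auto
  qed
  then show thesis by (intro that[of "max B 0"]) auto
qed

lemma cont_sob_Wt: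
  assumes "cont_sob u" shows "u \<in> Wt \<Omega> p"
proof -
  have "sob_normp \<Omega> p (\<lambda>x. u x - u x) = 0" by (simp add: sob_normp_zero)
  then have "\<exists>c\<in>Collect cont_sob. sob_normp \<Omega> p (\<lambda>x. u x - c x) < \<epsilon>" if "\<epsilon> > 0" for \<epsilon>
    using assms that by (intro bexI[of _ u]) auto
  then show ?thesis unfolding Wt_eq sob_closure_def using assms by (simp add: cont_sob_def)
qed

lemma Wt_lincomb:
  assumes u: "u \<in> Wt \<Omega> p" and w: "w \<in> Wt \<Omega> p"
  shows "(\<lambda>x. a * u x + b * w x) \<in> Wt \<Omega> p"
proof -
  note su = Wt_sobolev[OF u] and sw = Wt_sobolev[OF w]
  have "\<exists>c\<in>Collect cont_sob. sob_normp \<Omega> p (\<lambda>x. (a * u x + b * w x) - c x) < \<epsilon>" if \<epsilon>: "\<epsilon> > 0" for \<epsilon>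
  proof -
    \<comment> \<open>The summand 1 keeps \<open>D\<close> positive and the final inequality strict
      even for \<open>a = b = 0\<close>.\<close>
    define D where "D = 2 powr p * (\<bar>a\<bar> powr p + \<bar>b\<bar> powr p + 1)"
    define \<eta> where "\<eta> = \<epsilon> / D"
    have den: "D > 0"
      unfolding D_def by (intro mult_pos_pos add_nonneg_pos) auto
    then have \<eta>: "\<eta> > 0" using \<epsilon> by (simp add: \<eta>_def)
    obtain c where c: "cont_sob c" "sob_normp \<Omega> p (\<lambda>x. u x - c x) < \<eta>" using Wt_approx[OF u \<eta>] .
    obtain d where d: "cont_sob d" "sob_normp \<Omega> p (\<lambda>x. w x - d x) < \<eta>" using Wt_approx[OF w \<eta>] .
    have sc: "sobolev \<Omega> p (\<lambda>x. u x - c x)" "sobolev \<Omega> p (\<lambda>x. w x - d x)"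
      using c(1) d(1) su sw by (auto simp: cont_sob_def intro: sobolev_diff)
    have eq: "(\<lambda>x. (a * u x + b * w x) - (a * c x + b * d x)) = (\<lambda>x. a * (u x - c x) + b * (w x - d x))"
      by (auto simp: algebra_simps)
    have "sob_normp \<Omega> p (\<lambda>x. a * (u x - c x) + b * (w x - d x))
        \<le> 2 powr p * (\<bar>a\<bar> powr p * sob_normp \<Omega> p (\<lambda>x. u x - c x) + \<bar>b\<bar> powr p * sob_normp \<Omega> p (\<lambda>x. w x - d x))"
      using sob_normp_add_le[OF sobolev_scale[OF sc(1), of a] sobolev_scale[OF sc(2), of b]]
      by (simp add: sob_normp_scale sc)
    also have "\<dots> \<le> 2 powr p * (\<bar>a\<bar> powr p * \<eta> + \<bar>b\<bar> powr p * \<eta>)"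
      using c(2) d(2) by (intro mult_left_mono add_mono) auto
    also have "\<dots> < D * \<eta>"
      using \<eta> by (simp add: D_def algebra_simps)
    also have "\<dots> = \<epsilon>" using den by (simp add: \<eta>_def)
    finally show ?thesis
      using cont_sob_lincomb[OF c(1) d(1), of a b] unfolding eq[symmetric]
      by (intro bexI[of _ "\<lambda>x. a * c x + b * d x"] CollectI)
  qed
  then show ?thesis
    unfolding Wt_eq sob_closure_def using sobolev_add[OF sobolev_scale[OF su] sobolev_scale[OF sw]] by simp
qed

lemma Wt_add: "u \<in> Wt \<Omega> p \<Longrightarrow> w \<in> Wt \<Omega> p \<Longrightarrow> (\<lambda>x. u x + w x) \<in> Wt \<Omega> p"
  and Wt_diff: "u \<in> Wt \<Omega> p \<Longrightarrow> w \<in> Wt \<Omega> p \<Longrightarrow> (\<lambda>x. u x - w x) \<in> Wt \<Omega> p"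
  and Wt_scale: "u \<in> Wt \<Omega> p \<Longrightarrow> (\<lambda>x. a * u x) \<in> Wt \<Omega> p"
  using Wt_lincomb[of u w 1 1] Wt_lincomb[of u w 1 "-1"] Wt_lincomb[of u u a 0] by simp_all

lemma Wt_closed:
  assumes u: "sobolev \<Omega> p u" and "\<And>\<epsilon>. \<epsilon> > 0 \<Longrightarrow> \<exists>w\<in>Wt \<Omega> p. sob_normp \<Omega> p (\<lambda>x. u x - w x) < \<epsilon>"
  shows "u \<in> Wt \<Omega> p"
proof -
  have "\<exists>c\<in>Collect cont_sob. sob_normp \<Omega> p (\<lambda>x. u x - c x) < \<epsilon>" if \<epsilon>: "\<epsilon> > 0" for \<epsilon>
  proof -
    define \<eta> where "\<eta> = \<epsilon> / (2 powr p * 2)"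
    have \<eta>: "\<eta> > 0" using \<epsilon> by (simp add: \<eta>_def)
    obtain w where w: "w \<in> Wt \<Omega> p" "sob_normp \<Omega> p (\<lambda>x. u x - w x) < \<eta>" using assms(2)[OF \<eta>] by blast
    obtain c where c: "cont_sob c" "sob_normp \<Omega> p (\<lambda>x. w x - c x) < \<eta>" using Wt_approx[OF w(1) \<eta>] .
    have "sobolev \<Omega> p (\<lambda>x. u x - w x)" "sobolev \<Omega> p (\<lambda>x. w x - c x)"
      using c(1) u Wt_sobolev[OF w(1)] by (auto simp: cont_sob_def intro: sobolev_diff)
    from sob_normp_add_le[OF this]
    have "sob_normp \<Omega> p (\<lambda>x. u x - c x)
       \<le> 2 powr p * (sob_normp \<Omega> p (\<lambda>x. u x - w x) + sob_normp \<Omega> p (\<lambda>x. w x - c x))" by simp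
    also have "\<dots> < 2 powr p * (\<eta> + \<eta>)" using w c by (intro mult_strict_left_mono add_strict_mono) auto
    also have "\<dots> = \<epsilon>" by (simp add: \<eta>_def)
    finally show ?thesis using c(1) by blast
  qed
  then show ?thesis unfolding Wt_eq sob_closure_def using u by simp
qed

lemma Wt_sum: "(\<And>k. h k \<in> Wt \<Omega> p) \<Longrightarrow> (\<lambda>x. \<Sum>k<(n::nat). h k x) \<in> Wt \<Omega> p"
proof (induction n)
  case 0
  obtain c where "cont_sob c" using Wt_approx[OF 0(1)[of 0], of 1] by auto
  then show ?case using Wt_scale[OF cont_sob_Wt, of c 0] by simp
next
  case (Suc n)
  then show ?case by (simp add: Wt_add)
qed

lemma Wt_series:
  assumes h: "\<And>k. h k \<in> Wt \<Omega> p"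
    and a: "\<And>k. (2 powr p) ^ Suc k * sob_normp \<Omega> p (h k) \<le> a k" "summable a"
  obtains v where "v \<in> Wt \<Omega> p" "AE x in lebesgue_on \<Omega>. (\<lambda>k. h k x) sums v x"
    "sob_normp \<Omega> p v \<le> suminf a"
proof -
  obtain v where v: "sobolev \<Omega> p v" "AE x in lebesgue_on \<Omega>. (\<lambda>k. h k x) sums v x"
    "\<And>n. sob_normp \<Omega> p (\<lambda>x. v x - (\<Sum>k<n. h k x)) \<le> (\<Sum>k. a (k + n))"
    using sobolev_series[OF Wt_sobolev[OF h] a] by blast
  have "v \<in> Wt \<Omega> p"
  proof (rule Wt_closed[OF v(1)])
    fix \<epsilon> :: real assume "\<epsilon> > 0"
    then obtain N where "norm (\<Sum>k. a (k + N)) < \<epsilon>" using suminf_exist_split[OF _ a(2)] by blast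
    then have "sob_normp \<Omega> p (\<lambda>x. v x - (\<Sum>k<N. h k x)) < \<epsilon>" using v(3)[of N] by simp
    then show "\<exists>w\<in>Wt \<Omega> p. sob_normp \<Omega> p (\<lambda>x. v x - w x) < \<epsilon>"
      using Wt_sum[of h, OF h] by (intro bexI[of _ "\<lambda>x. \<Sum>k<N. h k x"])
  qed
  then show thesis using that v(2) v(3)[of 0] by simp
qed

text \<open>In \<open>Wt_majorant\<close> the weighted \<open>k\<close>-th term is bounded by
  \<open>4 * q ^ 3 * e * (1 / 2) ^ k\<close> with \<open>q = 2 powr p\<close>; summing the geometric
  series doubles the constant.\<close>

definition maj_const :: real where "maj_const = 8 * (2 powr p) ^ 3"

lemma maj_const_pos: "maj_const > 0" by (simp add: maj_const_def)

text \<open>Absolute values are available for continuous functions only, so \<open>f\<close> is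
  expanded into a telescoping series of such functions and the absolute values are taken term by
  term. Their sum dominates every \<open>\<bar>F n x\<bar>\<close>, and these tend to
  \<open>\<bar>f x\<bar>\<close> almost everywhere.\<close>

lemma Wt_majorant:
  assumes f: "f \<in> Wt \<Omega> p" and e: "sob_normp \<Omega> p f < e"
  obtains v where "v \<in> Wt \<Omega> p" "AE x in lebesgue_on \<Omega>. \<bar>f x\<bar> \<le> v x" "sob_normp \<Omega> p v \<le> maj_const * e"
proof -
  let ?M = "lebesgue_on \<Omega>"
  define q where "q = 2 powr p"
  have q: "q \<ge> 1" using p_gt_1 by (simp add: q_def ge_one_powr_ge_zero)
  \<comment> \<open>Half of \<open>1 / q\<close>: this absorbs the weights \<open>q ^ k\<close> of
    the series bound and leaves a factor \<open>(1 / 2) ^ k\<close>.\<close>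
  define \<rho> where "\<rho> = 1 / (2 * q)"
  have \<rho>: "0 < \<rho>" "\<rho> \<le> 1" using q by (auto simp: \<rho>_def)
  have e0: "e > 0" using e sob_normp_nonneg[of f] by linarith
  have "\<exists>c. cont_sob c \<and> sob_normp \<Omega> p (\<lambda>x. f x - c x) < e * \<rho> ^ k" for k
    using Wt_approx[OF f, of "e * \<rho> ^ k"] e0 \<rho> by auto
  then obtain F where F: "\<And>k. cont_sob (F k)" "\<And>k. sob_normp \<Omega> p (\<lambda>x. f x - F k x) < e * \<rho> ^ k"
    by metis
  have sF: "sobolev \<Omega> p (\<lambda>x. f x - F k x)" for k
    using F(1) Wt_sobolev[OF f] by (auto simp: cont_sob_def intro: sobolev_diff)
  \<comment> \<open>The term for \<open>k = 0\<close> is \<open>F 0\<close> itself, so that the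
    partial sums telescope to \<open>F n\<close> with nothing left over.\<close>
  define d where "d k = (case k of 0 \<Rightarrow> F 0 | Suc j \<Rightarrow> (\<lambda>x. F (Suc j) x - F j x))" for k
  have dc: "cont_sob (d k)" for k
    using F(1) cont_sob_diff by (cases k) (auto simp: d_def)
  \<comment> \<open>The division by \<open>\<rho>\<close> accounts for the index shift, since
    \<open>d (Suc j)\<close> is controlled by the error of \<open>F j\<close>; for
    \<open>k = 0\<close> it is slack, as \<open>\<rho> \<le> 1\<close>.\<close>
  have dN: "sob_normp \<Omega> p (d k) \<le> q * (2 * (e * \<rho> ^ k / \<rho>))" for k
  proof (cases k)
    case 0
    have "sob_normp \<Omega> p (d k) \<le> q * (sob_normp \<Omega> p f + sob_normp \<Omega> p (\<lambda>x. f x - F 0 x))"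
      using sob_normp_diff_le[OF Wt_sobolev[OF f] sF[of 0]] by (simp add: d_def 0 q_def)
    also have "\<dots> \<le> q * (e + e)" using e F(2)[of 0] q by (intro mult_left_mono add_mono) auto
    also have "\<dots> \<le> q * (2 * (e / \<rho>))"
      using q e0 \<rho> by (intro mult_left_mono) (auto simp: field_simps)
    finally show ?thesis by (simp add: 0)
  next
    case (Suc j)
    have "sob_normp \<Omega> p (d k) \<le> q * (sob_normp \<Omega> p (\<lambda>x. f x - F j x) + sob_normp \<Omega> p (\<lambda>x. f x - F (Suc j) x))"
      using sob_normp_diff_le[OF sF[of j] sF[of "Suc j"]] by (simp add: d_def Suc q_def)
    also have "\<dots> \<le> q * (e * \<rho> ^ j + e * \<rho> ^ Suc j)"
      using F(2)[of j] F(2)[of "Suc j"] q by (intro mult_left_mono add_mono) auto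
    also have "e * \<rho> ^ Suc j \<le> e * \<rho> ^ j" using e0 \<rho> by (simp add: mult_left_le_one_le)
    finally show ?thesis using q \<rho> by (simp add: Suc mult_ac)
  qed
  define a where "a k = 4 * q ^ 3 * e * (1 / 2) ^ k" for k :: nat
  have q\<rho>: "q ^ k * \<rho> ^ k = (1 / 2) ^ k" for k
    using q by (simp add: \<rho>_def power_mult_distrib[symmetric])
  have wa: "q ^ Suc k * (q * (2 * (e * \<rho> ^ k / \<rho>))) = a k" for k
  proof -
    have "q ^ Suc k * (q * (2 * (e * \<rho> ^ k / \<rho>))) = q * q * 2 * e * (q ^ k * \<rho> ^ k) * (1 / \<rho>)" by simp
    also have "\<dots> = a k" unfolding q\<rho> a_def using q by (simp add: \<rho>_def power3_eq_cube)
    finally show ?thesis .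
  qed
  have sa: "a sums (4 * q ^ 3 * e * 2)"
    unfolding a_def using geometric_sums[of "1/2::real"] by (intro sums_mult) simp
  have "(2 powr p) ^ Suc k * sob_normp \<Omega> p (\<lambda>x. \<bar>d k x\<bar>) \<le> a k" for k
  proof -
    have "q ^ Suc k * sob_normp \<Omega> p (\<lambda>x. \<bar>d k x\<bar>) \<le> q ^ Suc k * (q * (2 * (e * \<rho> ^ k / \<rho>)))"
      using order_trans[OF cont_sob_abs(2)[OF dc] dN, of k] q by (intro mult_left_mono) auto
    then show ?thesis unfolding wa by (simp add: q_def)
  qed
  then obtain v where v: "v \<in> Wt \<Omega> p" "AE x in ?M. (\<lambda>k. \<bar>d k x\<bar>) sums v x" "sob_normp \<Omega> p v \<le> suminf a"
    using Wt_series[of "\<lambda>k x. \<bar>d k x\<bar>" a] cont_sob_Wt[OF cont_sob_abs(1)[OF dc]] sums_summable[OF sa] by blast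
  \<comment> \<open>Norm convergence alone would give this only along a subsequence. Here the errors
    decay so fast that the series of \<open>f x - F k x\<close> converges almost everywhere, hence
    its terms tend to 0.\<close>
  have AEF: "AE x in ?M. (\<lambda>n. F n x) \<longlonglongrightarrow> f x"
  proof -
    have b: "(2 powr p) ^ Suc k * sob_normp \<Omega> p (\<lambda>x. f x - F k x) \<le> q * e * (1 / 2) ^ k" for k
    proof -
      have "q ^ Suc k * sob_normp \<Omega> p (\<lambda>x. f x - F k x) \<le> q ^ Suc k * (e * \<rho> ^ k)"
        using F(2)[of k] q by (intro mult_left_mono) auto
      also have "\<dots> = q * e * (q ^ k * \<rho> ^ k)" by simp
      finally show ?thesis unfolding q\<rho> by (simp add: q_def)
    qed
    have sb: "summable (\<lambda>k. q * e * (1 / 2) ^ k)" by (intro summable_mult summable_geometric) simp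
    obtain w where "AE x in ?M. (\<lambda>k. f x - F k x) sums w x"
      using sobolev_series[OF sF b sb] by blast
    then show ?thesis
    proof eventually_elim
      case (elim x)
      have "(\<lambda>k. f x - F k x) \<longlonglongrightarrow> 0"
        by (rule summable_LIMSEQ_zero[OF sums_summable[OF elim]])
      then have "(\<lambda>k. f x - (f x - F k x)) \<longlonglongrightarrow> f x - 0" by (intro tendsto_intros)
      then show ?case by simp
    qed
  qed
  have tel: "F n x = (\<Sum>k<Suc n. d k x)" for n x
    by (induction n) (simp_all add: d_def)
  have "AE x in ?M. \<bar>f x\<bar> \<le> v x"
    using v(2) AEF
  proof eventually_elim
    case (elim x)
    have "\<bar>F n x\<bar> \<le> v x" for n
    proof -
      have "\<bar>F n x\<bar> \<le> (\<Sum>k<Suc n. \<bar>d k x\<bar>)" unfolding tel by (rule sum_abs)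
      also have "\<dots> \<le> (\<Sum>k. \<bar>d k x\<bar>)"
        using sums_summable[OF elim(1)] by (intro sum_le_suminf) auto
      also have "\<dots> = v x" using elim(1) by (simp add: sums_iff)
      finally show ?thesis .
    qed
    then show ?case
      by (intro tendsto_upperbound[OF tendsto_rabs[OF elim(2)]]) auto
  qed
  moreover have "suminf a = maj_const * e" using sums_unique[OF sa] by (simp add: maj_const_def q_def)
  ultimately show thesis using that v by simp
qed

end

section \<open>Capacity\<close>

context sobolev_domain
begin

text \<open>Refers the almost-everywhere conditions of all sets \<open>U\<close> to the same measure
  on \<open>\<Omega>\<close>, so that they can be combined. The trace on \<open>\<Omega>\<close> of
  a relatively open set is open, hence measurable.\<close>

lemma Ycap_iff:
  "w \<in> Ycap \<Omega> p A \<longleftrightarrow> w \<in> Wt \<Omega> p \<and> (\<exists>U. openin (top_of_set (closure \<Omega>)) U \<and> A \<subseteq> U \<and>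
      (AE x in lebesgue_on \<Omega>. x \<in> U \<longrightarrow> 1 \<le> w x))"
proof -
  have "(AE x in lebesgue_on (U \<inter> \<Omega>). 1 \<le> w x) \<longleftrightarrow> (AE x in lebesgue_on \<Omega>. x \<in> U \<longrightarrow> 1 \<le> w x)"
    if U: "openin (top_of_set (closure \<Omega>)) U" for U
  proof -
    obtain T where T: "open T" "U = closure \<Omega> \<inter> T" using U by (auto simp: openin_open)
    then have "U \<inter> \<Omega> = T \<inter> \<Omega>" using closure_subset[of \<Omega>] by blast
    then have "U \<inter> \<Omega> \<in> sets lebesgue" using T(1) open_domain by (simp add: borel_open open_Int)
    then show ?thesis
      by (auto simp: AE_restrict_space_iff elim!: eventually_mono)
  qed
  then show ?thesis unfolding Ycap_def by blast
qed

lemma Cap_lessE: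
  assumes "Cap \<Omega> p V < ennreal e"
  obtains w where "w \<in> Ycap \<Omega> p V" "sob_normp \<Omega> p w < e"
  using assms unfolding Cap_def INF_less_iff by (auto simp: ennreal_less_iff sob_normp_nonneg)

lemma Cap_eq_0I:
  assumes "\<And>e. e > 0 \<Longrightarrow> \<exists>w\<in>Ycap \<Omega> p A. sob_normp \<Omega> p w \<le> e"
  shows "Cap \<Omega> p A = 0"
proof -
  have "Cap \<Omega> p A \<le> 0"
  proof (rule ennreal_le_epsilon)
    fix e :: real assume "e > 0"
    then obtain w where w: "w \<in> Ycap \<Omega> p A" "sob_normp \<Omega> p w \<le> e" using assms by blast
    have "Cap \<Omega> p A \<le> ennreal (sob_normp \<Omega> p w)" unfolding Cap_def using w(1) by (rule INF_lower)
    then show "Cap \<Omega> p A \<le> 0 + ennreal e" using w(2) by (simp add: ennreal_leI order_trans)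
  qed
  then show ?thesis by simp
qed

text \<open>A nearly optimal admissible function may be negative elsewhere. Its majorant can be
  added to other functions without lowering them, at the price of the factor
  \<open>maj_const\<close>.\<close>

lemma Cap_less_majorant:
  assumes "Cap \<Omega> p V < ennreal e"
  obtains w U where "w \<in> Wt \<Omega> p" "sob_normp \<Omega> p w \<le> maj_const * e" "AE x in lebesgue_on \<Omega>. 0 \<le> w x"
    "openin (top_of_set (closure \<Omega>)) U" "V \<subseteq> U" "AE x in lebesgue_on \<Omega>. x \<in> U \<longrightarrow> 1 \<le> w x"
proof -
  obtain v where v: "v \<in> Ycap \<Omega> p V" "sob_normp \<Omega> p v < e" using Cap_lessE[OF assms] .
  obtain U where U: "v \<in> Wt \<Omega> p" "openin (top_of_set (closure \<Omega>)) U" "V \<subseteq> U" "AE x in lebesgue_on \<Omega>. x \<in> U \<longrightarrow> 1 \<le> v x"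
    using v(1) unfolding Ycap_iff by blast
  obtain w where w: "w \<in> Wt \<Omega> p" "AE x in lebesgue_on \<Omega>. \<bar>v x\<bar> \<le> w x" "sob_normp \<Omega> p w \<le> maj_const * e"
    using Wt_majorant[OF U(1) v(2)] .
  show thesis
  proof (rule that[OF w(1,3) _ U(2,3)])
    show "AE x in lebesgue_on \<Omega>. 0 \<le> w x" using w(2) by eventually_elim linarith
    show "AE x in lebesgue_on \<Omega>. x \<in> U \<longrightarrow> 1 \<le> w x" using w(2) U(4) by eventually_elim auto
  qed
qed

text \<open>Since the majorants are nonnegative, their sum is at least 1 wherever one of them is,
  hence almost everywhere on the union of the relatively open sets. The series bound for
  \<open>Wt\<close> controls the norm of the sum.\<close>

lemma Cap_UN_eq_0:
  fixes P :: "nat \<Rightarrow> 'a set"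
  assumes "\<And>n. Cap \<Omega> p (P n) = 0"
  shows "Cap \<Omega> p (\<Union>n. P n) = 0"
proof (rule Cap_eq_0I)
  fix e :: real assume e: "e > 0"
  let ?M = "lebesgue_on \<Omega>"
  define q where "q = 2 powr p"
  have q: "q > 0" by (simp add: q_def)
  \<comment> \<open>Solved so that a majorant of norm at most \<open>maj_const * \<eta> n\<close>,
    multiplied by its series weight, contributes at most \<open>e * (1 / 2) ^ Suc n\<close>.\<close>
  define \<eta> where "\<eta> n = e * (1 / 2) ^ Suc n / (maj_const * q ^ Suc n)" for n
  have \<eta>: "\<eta> n > 0" for n using e q maj_const_pos by (simp add: \<eta>_def)
  define Q where "Q n w U \<longleftrightarrow>
      w \<in> Wt \<Omega> p \<and> sob_normp \<Omega> p w \<le> maj_const * \<eta> n \<and> (AE x in ?M. 0 \<le> w x) \<and>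
      openin (top_of_set (closure \<Omega>)) U \<and> P n \<subseteq> U \<and> (AE x in ?M. x \<in> U \<longrightarrow> 1 \<le> w x)" for n w U
  have "\<exists>w U. Q n w U" for n
  proof -
    have "Cap \<Omega> p (P n) < ennreal (\<eta> n)" using assms \<eta>[of n] by simp
    then show ?thesis unfolding Q_def by (rule Cap_less_majorant) blast
  qed
  then obtain w U where wU: "\<And>n. Q n (w n) (U n)" by metis
  have w: "w n \<in> Wt \<Omega> p" "sob_normp \<Omega> p (w n) \<le> maj_const * \<eta> n"
    "AE x in ?M. 0 \<le> w n x" "openin (top_of_set (closure \<Omega>)) (U n)" "P n \<subseteq> U n"
    "AE x in ?M. x \<in> U n \<longrightarrow> 1 \<le> w n x" for n
    using wU[of n] unfolding Q_def by blast+
  have geo: "(\<lambda>n. e * (1 / 2) ^ Suc n) sums (e * 1)" by (intro sums_mult power_half_series)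
  have "(2 powr p) ^ Suc n * sob_normp \<Omega> p (w n) \<le> e * (1 / 2) ^ Suc n" for n
  proof -
    have "q ^ Suc n * sob_normp \<Omega> p (w n) \<le> q ^ Suc n * (maj_const * \<eta> n)"
      using w(2)[of n] q by (intro mult_left_mono) auto
    also have "\<dots> = e * (1 / 2) ^ Suc n" using q maj_const_pos by (simp add: \<eta>_def)
    finally show ?thesis by (simp add: q_def)
  qed
  from Wt_series[of w, OF w(1) this sums_summable[OF geo]]
  obtain v where v: "v \<in> Wt \<Omega> p" "AE x in ?M. (\<lambda>n. w n x) sums v x" "sob_normp \<Omega> p v \<le> (\<Sum>n. e * (1 / 2) ^ Suc n)" .
  have "AE x in ?M. \<forall>n. 0 \<le> w n x" "AE x in ?M. \<forall>n. x \<in> U n \<longrightarrow> 1 \<le> w n x"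
    using w(3,6) by (simp_all add: AE_all_countable)
  with v(2) have "AE x in ?M. x \<in> (\<Union>n. U n) \<longrightarrow> 1 \<le> v x"
  proof eventually_elim
    case (elim x)
    show ?case
    proof
      assume "x \<in> (\<Union>n. U n)"
      then obtain n where n: "x \<in> U n" by blast
      have "1 \<le> w n x" using elim n by blast
      also have "\<dots> = sum (\<lambda>n. w n x) {n}" by simp
      also have "\<dots> \<le> (\<Sum>n. w n x)" using elim sums_summable by (intro sum_le_suminf) auto
      finally show "1 \<le> v x" using elim by (simp add: sums_iff)
    qed
  qed
  moreover have "openin (top_of_set (closure \<Omega>)) (\<Union>n. U n)" using w(4) by blast
  moreover have "(\<Union>n. P n) \<subseteq> (\<Union>n. U n)" using w(5) by blast
  ultimately have "v \<in> Ycap \<Omega> p (\<Union>n. P n)" unfolding Ycap_iff using v(1) by blast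
  then show "\<exists>w\<in>Ycap \<Omega> p (\<Union>n. P n). sob_normp \<Omega> p w \<le> e"
    using v(3) sums_unique[OF geo] by auto
qed

text \<open>The preimage under \<open>f\<close> is relatively open only within the complement of
  \<open>V\<close>, which need not itself be open; adjoining all of \<open>V\<close> repairs
  this.\<close>

lemma openin_union_preimage:
  fixes f :: "'a \<Rightarrow> real"
  assumes V: "openin (top_of_set (closure \<Omega>)) V" and f: "continuous_on (closure \<Omega> - V) f" and T: "open T"
  shows "openin (top_of_set (closure \<Omega>)) (V \<union> {x \<in> closure \<Omega>. f x \<in> T})"
proof -
  obtain W where W: "open W" "V = closure \<Omega> \<inter> W" using V by (auto simp: openin_open)
  obtain Q where Q: "open Q" "(closure \<Omega> - V) \<inter> f -` T = (closure \<Omega> - V) \<inter> Q"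
    using continuous_openin_preimage_gen[OF f T] by (auto simp: openin_open)
  have "V \<union> {x \<in> closure \<Omega>. f x \<in> T} = closure \<Omega> \<inter> (W \<union> Q)" 
    using Q(2) W(2) by blast
  then show ?thesis using W(1) Q(1) by (auto simp: openin_open)
qed

text \<open>The gap \<open>\<delta>\<close> below 1 is what turns closeness in norm into small
  capacity: the majorant of the difference is divided by it.\<close>

lemma Cap_sublevel_eq_0:
  assumes A: "A \<subseteq> closure \<Omega>" and u: "u \<in> Wt \<Omega> p" and ut: "quasi_cont \<Omega> p (closure \<Omega>) ut"
    and eq: "AE x in lebesgue_on \<Omega>. ut x = u x" and cl: "u \<in> sob_closure \<Omega> p (Ycap \<Omega> p A)" and \<delta>: "\<delta> > 0"
  shows "Cap \<Omega> p {x \<in> A. ut x < 1 - \<delta>} = 0"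
proof (rule Cap_eq_0I)
  fix e :: real assume e: "e > 0"
  let ?M = "lebesgue_on \<Omega>"
  define q where "q = 2 powr p"
  define c where "c = (1 / \<delta>) powr p"
  have q: "q > 0" and c: "c > 0" using \<delta> by (simp_all add: q_def c_def)
  \<comment> \<open>Makes the final bound \<open>(q * maj_const * (c + 1)) * \<eta>\<close> equal to
    \<open>e\<close>; \<open>c\<close> is the p-th power of the scaling factor
    \<open>1 / \<delta>\<close>.\<close>
  define \<eta> where "\<eta> = e / (q * maj_const * (c + 1))"
  have \<eta>: "\<eta> > 0" using e q c maj_const_pos by (simp add: \<eta>_def)
  obtain V where V: "openin (top_of_set (closure \<Omega>)) V" "Cap \<Omega> p V < ennreal \<eta>" "continuous_on (closure \<Omega> - V) ut"
    using ut \<eta> unfolding quasi_cont_def by blast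
  obtain w U where w: "w \<in> Wt \<Omega> p" "sob_normp \<Omega> p w \<le> maj_const * \<eta>" "AE x in ?M. 0 \<le> w x"
    "openin (top_of_set (closure \<Omega>)) U" "V \<subseteq> U" "AE x in ?M. x \<in> U \<longrightarrow> 1 \<le> w x"
    using Cap_less_majorant[OF V(2)] .
  obtain y where y: "y \<in> Ycap \<Omega> p A" "sob_normp \<Omega> p (\<lambda>x. u x - y x) < \<eta>"
    using cl \<eta> unfolding sob_closure_def by blast
  obtain G where G: "y \<in> Wt \<Omega> p" "openin (top_of_set (closure \<Omega>)) G" "A \<subseteq> G" "AE x in ?M. x \<in> G \<longrightarrow> 1 \<le> y x"
    using y(1) unfolding Ycap_iff by blast
  obtain m where m: "m \<in> Wt \<Omega> p" "AE x in ?M. \<bar>u x - y x\<bar> \<le> m x" "sob_normp \<Omega> p m \<le> maj_const * \<eta>"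
    using Wt_majorant[OF Wt_diff[OF u G(1)] y(2)] .
  let ?z = "\<lambda>x. (1 / \<delta>) * m x + w x"
  \<comment> \<open>On \<open>G\<close> the function \<open>y\<close> is at least 1 almost
    everywhere; points of \<open>V\<close> are served by \<open>w\<close>, and outside
    \<open>V\<close> the condition on \<open>ut\<close> passes to \<open>u\<close> almost
    everywhere, which is all that admissibility asks for.\<close>
  let ?O = "G \<inter> (V \<union> {x \<in> closure \<Omega>. ut x \<in> {..<1 - \<delta>}})"
  have z: "?z \<in> Wt \<Omega> p" using Wt_add[OF Wt_scale[OF m(1)] w(1)] .
  have O: "openin (top_of_set (closure \<Omega>)) ?O"
    by (intro openin_Int G(2) openin_union_preimage V) simp
  have "AE x in ?M. x \<in> ?O \<longrightarrow> 1 \<le> ?z x"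
    using w(3,6) G(4) m(2) eq
  proof eventually_elim
    case (elim x)
    have m0: "0 \<le> m x" using elim(4) by linarith
    show ?case
    proof
      assume x: "x \<in> ?O"
      show "1 \<le> ?z x"
      proof (cases "x \<in> V")
        case True
        then have "1 \<le> w x" using elim(2) w(5) by blast
        then show ?thesis using m0 \<delta> by (simp add: add_increasing)
      next
        case False
        then have "u x < 1 - \<delta>" "1 \<le> y x" using x elim by auto
        then have "\<delta> \<le> m x" using elim(4) by linarith
        then have "1 \<le> (1 / \<delta>) * m x" using \<delta> by (simp add: field_simps)
        then show ?thesis using elim(1) by linarith
      qed
    qed
  qed
  moreover have "{x \<in> A. ut x < 1 - \<delta>} \<subseteq> ?O" using A G(3) by auto
  ultimately have "?z \<in> Ycap \<Omega> p {x \<in> A. ut x < 1 - \<delta>}"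
    unfolding Ycap_iff using z O by blast
  moreover have "sob_normp \<Omega> p ?z \<le> e"
  proof -
    have "sob_normp \<Omega> p ?z \<le> q * (c * sob_normp \<Omega> p m + sob_normp \<Omega> p w)"
      using sob_normp_add_le[OF sobolev_scale[OF Wt_sobolev[OF m(1)]] Wt_sobolev[OF w(1)], of "1 / \<delta>"] \<delta>
      unfolding sob_normp_scale[OF Wt_sobolev[OF m(1)]] by (simp add: q_def c_def)
    also have "\<dots> \<le> q * (c * (maj_const * \<eta>) + maj_const * \<eta>)"
      using q c m(3) w(2) by (intro mult_left_mono add_mono) auto
    also have "\<dots> = (q * maj_const * (c + 1)) * \<eta>" by (simp add: algebra_simps)
    also have "\<dots> = e" using q c maj_const_pos by (simp add: \<eta>_def add_pos_pos less_imp_neq[THEN not_sym])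
    finally show ?thesis .
  qed
  ultimately show "\<exists>w\<in>Ycap \<Omega> p {x \<in> A. ut x < 1 - \<delta>}. sob_normp \<Omega> p w \<le> e" by blast
qed

lemma quasi_everywhere_of_closure:
  assumes A: "A \<subseteq> closure \<Omega>" and u: "u \<in> Wt \<Omega> p" and ut: "quasi_cont \<Omega> p (closure \<Omega>) ut"
    and eq: "AE x in lebesgue_on \<Omega>. ut x = u x" and cl: "u \<in> sob_closure \<Omega> p (Ycap \<Omega> p A)"
  shows "Cap \<Omega> p {x \<in> A. ut x < 1} = 0"
proof -
  have "{x \<in> A. ut x < 1} = (\<Union>n. {x \<in> A. ut x < 1 - 1 / real (Suc n)})"
  proof (intro equalityI subsetI)
    fix x assume "x \<in> {x \<in> A. ut x < 1}"
    then obtain n where "1 / real (Suc n) < 1 - ut x" and "x \<in> A"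
      using reals_Archimedean[of "1 - ut x"] by (auto simp: inverse_eq_divide)
    then show "x \<in> (\<Union>n. {x \<in> A. ut x < 1 - 1 / real (Suc n)})" by (auto intro!: exI[of _ n])
  next
    fix x assume "x \<in> (\<Union>n. {x \<in> A. ut x < 1 - 1 / real (Suc n)})"
    then obtain n where "x \<in> A" "ut x < 1 - 1 / real (Suc n)" by blast
    moreover have "1 / real (Suc n) > 0" by simp
    ultimately have "ut x < 1" by linarith
    then show "x \<in> {x \<in> A. ut x < 1}" using \<open>x \<in> A\<close> by simp
  qed
  then show ?thesis
    using Cap_UN_eq_0[of "\<lambda>n. {x \<in> A. ut x < 1 - 1 / real (Suc n)}"]
      Cap_sublevel_eq_0[OF A u ut eq cl] by simp
qed

lemma Ycap_approx_of_quasi_everywhere: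
  assumes A: "A \<subseteq> closure \<Omega>" and u: "u \<in> Wt \<Omega> p" and ut: "quasi_cont \<Omega> p (closure \<Omega>) ut"
    and eq: "AE x in lebesgue_on \<Omega>. ut x = u x" and P: "Cap \<Omega> p P = 0" "\<And>x. x \<in> A - P \<Longrightarrow> ut x \<ge> 1"
    and e: "e > 0"
  shows "\<exists>y\<in>Ycap \<Omega> p A. sob_normp \<Omega> p (\<lambda>x. u x - y x) < e"
proof -
  let ?M = "lebesgue_on \<Omega>" and ?N = "sob_normp \<Omega> p"
  define q where "q = 2 powr p"
  have q: "q > 0" by (simp add: q_def)
  note C = maj_const_pos and su = Wt_sobolev[OF u]
  \<comment> \<open>The final estimate reads \<open>D * \<epsilon> + E * \<eta>\<close>.
    \<open>D\<close> collects the contributions of \<open>u - c\<close> and \<open>m\<close>, which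
    do not involve \<open>B\<close>, so \<open>\<epsilon>\<close> can be fixed before
    \<open>c\<close> and \<open>B\<close> are chosen.\<close>
  define D where "D = q + q * (q * (maj_const * (q * 2)))"
  define \<epsilon> where "\<epsilon> = e / (3 * D)"
  have den: "D > 0" using q C by (simp add: D_def add_pos_pos)
  have \<epsilon>: "\<epsilon> > 0" using e den by (simp add: \<epsilon>_def)
  obtain c where c: "cont_sob c" "?N (\<lambda>x. u x - c x) < \<epsilon>" using Wt_approx[OF u \<epsilon>] .
  note cW = cont_sob_Wt[OF c(1)]
  obtain B where B: "B \<ge> 0" "AE x in ?M. \<bar>c x\<bar> \<le> B" using cont_sob_bounded[OF c(1)] .
  \<comment> \<open>Solves \<open>t powr p * (?N u + 1) = \<epsilon>\<close>; the summand 1 covers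
    the case of norm 0.\<close>
  define t where "t = (\<epsilon> / (?N u + 1)) powr (1 / p)"
  have N1: "?N u + 1 > 0" using sob_normp_nonneg[of u] by linarith
  have t: "t > 0" "t powr p * ?N u < \<epsilon>"
  proof -
    show "t > 0" using \<epsilon> N1 by (simp add: t_def)
    have "t powr p = \<epsilon> / (?N u + 1)" using \<epsilon> N1 p_gt_1 by (simp add: t_def powr_powr)
    then have "t powr p * (?N u + 1) = \<epsilon>" using N1 by simp
    moreover have "t powr p > 0" using \<open>t > 0\<close> by simp
    ultimately show "t powr p * ?N u < \<epsilon>" unfolding distrib_left by linarith
  qed
  \<comment> \<open>This is \<open>(1 + t) * u x - c x\<close>, written as a sum of two functions of
    small norm.\<close>
  let ?u' = "\<lambda>x. (u x - c x) + t * u x"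
  have u'W: "?u' \<in> Wt \<Omega> p" using Wt_add[OF Wt_diff[OF u cW] Wt_scale[OF u]] .
  have "?N ?u' \<le> q * (?N (\<lambda>x. u x - c x) + t powr p * ?N u)"
    using sob_normp_add_le[OF Wt_sobolev[OF Wt_diff[OF u cW]] sobolev_scale[OF su], of t] t(1)
    unfolding sob_normp_scale[OF su] by (simp add: q_def)
  also have "\<dots> < q * (\<epsilon> + \<epsilon>)" using c(2) t(2) q by (intro mult_strict_left_mono add_strict_mono)
  finally have "?N ?u' < q * 2 * \<epsilon>" by simp
  then obtain m where m: "m \<in> Wt \<Omega> p" "AE x in ?M. \<bar>?u' x\<bar> \<le> m x" "?N m \<le> maj_const * (q * 2 * \<epsilon>)"
    using Wt_majorant[OF u'W] by blast
  define b where "b = (1 + B) powr p"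
  have b: "b > 0" using B by (simp add: b_def)
  \<comment> \<open>Collects the contributions of \<open>w\<close> and \<open>w'\<close>, which
    carry the factor \<open>b\<close> coming from \<open>1 + B\<close>; \<open>\<eta>\<close> is
    chosen against it now that \<open>B\<close> is known.\<close>
  define E where "E = q * (q * (b * (q * (maj_const * 2))))"
  define \<eta> where "\<eta> = e / (3 * E)"
  have E: "E > 0" using q b C by (simp add: E_def)
  then have \<eta>: "\<eta> > 0" using e by (simp add: \<eta>_def)
  obtain V where V: "openin (top_of_set (closure \<Omega>)) V" "Cap \<Omega> p V < ennreal \<eta>" "continuous_on (closure \<Omega> - V) ut"
    using ut \<eta> unfolding quasi_cont_def by blast
  obtain w U where w: "w \<in> Wt \<Omega> p" "?N w \<le> maj_const * \<eta>" "AE x in ?M. 0 \<le> w x"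
    "openin (top_of_set (closure \<Omega>)) U" "V \<subseteq> U" "AE x in ?M. x \<in> U \<longrightarrow> 1 \<le> w x"
    using Cap_less_majorant[OF V(2)] .
  have "Cap \<Omega> p P < ennreal \<eta>" using P(1) \<eta> by simp
  then obtain w' U' where w': "w' \<in> Wt \<Omega> p" "?N w' \<le> maj_const * \<eta>" "AE x in ?M. 0 \<le> w' x"
    "openin (top_of_set (closure \<Omega>)) U'" "P \<subseteq> U'" "AE x in ?M. x \<in> U' \<longrightarrow> 1 \<le> w' x"
    by (rule Cap_less_majorant)
  let ?r = "\<lambda>x. m x + (1 + B) * (w x + w' x)"
  let ?y = "\<lambda>x. c x + ?r x"
  \<comment> \<open>Since \<open>1 / (1 + t) < 1\<close>, the strict inequality still holds at all
    points of \<open>A\<close> outside \<open>P\<close>, while \<open>U'\<close> takes care of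
    \<open>P\<close>.\<close>
  let ?O = "U' \<union> (V \<union> {x \<in> closure \<Omega>. ut x \<in> {1 / (1 + t)<..}})"
  note ww = Wt_add[OF w(1) w'(1)]
  have rW: "?r \<in> Wt \<Omega> p" by (rule Wt_add[OF m(1) Wt_scale[OF ww]])
  have yW: "?y \<in> Wt \<Omega> p" by (rule Wt_add[OF cW rW])
  have O: "openin (top_of_set (closure \<Omega>)) ?O"
    by (intro openin_Un w'(4) openin_union_preimage V) simp
  have AO: "A \<subseteq> ?O"
  proof
    fix x assume x: "x \<in> A"
    show "x \<in> ?O"
    proof (cases "x \<in> P")
      case True
      then show ?thesis using w'(5) by blast
    next
      case False
      then have "ut x \<ge> 1" using P(2) x by blast
      moreover have "1 / (1 + t) < 1" using t(1) by simp
      ultimately show ?thesis using x A by auto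
    qed
  qed
  have "AE x in ?M. x \<in> ?O \<longrightarrow> 1 \<le> ?y x"
    using w(3,6) w'(3,6) m(2) eq B(2)
  proof eventually_elim
    case (elim x)
    have m0: "0 \<le> m x" using elim(5) by linarith
    show ?case
    proof
      assume x: "x \<in> ?O"
      show "1 \<le> ?y x"
      proof (cases "x \<in> V \<or> x \<in> U'")
        case True
        \<comment> \<open>On the exceptional sets nothing is known about \<open>u\<close>; there
          \<open>(1 + B) * (w x + w' x)\<close> outweighs the lower bound \<open>- B\<close> of
          \<open>c\<close>.\<close>
        then have "1 \<le> w x + w' x" using elim w(5) by auto
        from mult_left_mono[OF this, of "1 + B"] B(1)
        have "1 + B \<le> (1 + B) * (w x + w' x)" by simp
        moreover have "- B \<le> c x" using elim(7) by linarith
        ultimately have "1 \<le> c x + (1 + B) * (w x + w' x)" by linarith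
        then show ?thesis using m0 by linarith
      next
        case False
        \<comment> \<open>Off the exceptional sets \<open>c x + ?u' x\<close> is exactly
          \<open>(1 + t) * u x\<close>, and replacing \<open>?u'\<close> by its majorant
          \<open>m\<close> can only increase the sum.\<close>
        then have "1 / (1 + t) < u x" using x elim(6) by auto
        then have "1 < (1 + t) * u x" using t(1) by (simp add: field_simps)
        then have "1 < c x + ?u' x" by (simp add: algebra_simps)
        moreover have "0 \<le> (1 + B) * (w x + w' x)" using B(1) elim by simp
        ultimately show ?thesis using elim(5) by linarith
      qed
    qed
  qed
  then have "?y \<in> Ycap \<Omega> p A" unfolding Ycap_iff using yW O AO by blast
  moreover have "?N (\<lambda>x. u x - ?y x) < e"
  proof -
    have "?N (\<lambda>x. w x + w' x) \<le> q * (?N w + ?N w')"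
      unfolding q_def by (rule sob_normp_add_le[OF Wt_sobolev[OF w(1)] Wt_sobolev[OF w'(1)]])
    also have "\<dots> \<le> q * (maj_const * \<eta> + maj_const * \<eta>)"
      using q w(2) w'(2) by (intro mult_left_mono add_mono) auto
    finally have 1: "?N (\<lambda>x. w x + w' x) \<le> q * (maj_const * 2) * \<eta>" by (simp add: mult_ac)
    have "?N ?r \<le> q * (?N m + b * ?N (\<lambda>x. w x + w' x))"
      using sob_normp_add_le[OF Wt_sobolev[OF m(1)] sobolev_scale[OF Wt_sobolev[OF ww]], of "1 + B"] B(1)
      unfolding sob_normp_scale[OF Wt_sobolev[OF ww]] by (simp add: q_def b_def)
    also have "\<dots> \<le> q * (maj_const * (q * 2 * \<epsilon>) + b * (q * (maj_const * 2) * \<eta>))"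
      using q b m(3) 1 by (intro mult_left_mono add_mono) auto
    finally have 2: "?N ?r \<le> q * (maj_const * (q * 2 * \<epsilon>) + b * (q * (maj_const * 2) * \<eta>))" .
    have "?N (\<lambda>x. (u x - c x) - ?r x) \<le> q * (?N (\<lambda>x. u x - c x) + ?N ?r)"
      unfolding q_def by (rule sob_normp_diff_le[OF Wt_sobolev[OF Wt_diff[OF u cW]] Wt_sobolev[OF rW]])
    also have "\<dots> \<le> q * (\<epsilon> + q * (maj_const * (q * 2 * \<epsilon>) + b * (q * (maj_const * 2) * \<eta>)))"
      using q c(2) 2 by (intro mult_left_mono add_mono) auto
    also have "\<dots> = D * \<epsilon> + E * \<eta>"
      by (simp add: D_def E_def algebra_simps)
    also have "\<dots> = e / 3 + e / 3"
      using den E by (simp add: \<epsilon>_def \<eta>_def)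
    also have "\<dots> < e" using e by simp
    finally show ?thesis by (simp add: diff_diff_eq)
  qed
  ultimately show ?thesis by (intro bexI[of _ ?y])
qed

end

theorem mainTheorem14:
  fixes \<Omega> :: "'a::euclidean_space set" and p :: real
    and A :: "'a set" and u ut :: "'a \<Rightarrow> real"
  assumes "open \<Omega>" and "\<Omega> \<noteq> {}" and "1 < p"
    and "A \<subseteq> closure \<Omega>"
    and "u \<in> Wt \<Omega> p"
    and "quasi_cont \<Omega> p (closure \<Omega>) ut"
    and "AE x in lebesgue_on \<Omega>. ut x = u x"
  shows "u \<in> sob_closure \<Omega> p (Ycap \<Omega> p A) \<longleftrightarrow>
         (\<exists>P. P \<subseteq> closure \<Omega> \<and> Cap \<Omega> p P = 0 \<and> (\<forall>x\<in>A - P. ut x \<ge> 1))"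
proof -
  interpret sobolev_domain \<Omega> p
    using assms(1,3) by unfold_locales
  show ?thesis
  proof
    assume "u \<in> sob_closure \<Omega> p (Ycap \<Omega> p A)"
    then have "Cap \<Omega> p {x \<in> A. ut x < 1} = 0"
      by (rule quasi_everywhere_of_closure[OF assms(4-7)])
    then show "\<exists>P. P \<subseteq> closure \<Omega> \<and> Cap \<Omega> p P = 0 \<and> (\<forall>x\<in>A - P. ut x \<ge> 1)"
      using assms(4) by (intro exI[of _ "{x \<in> A. ut x < 1}"]) auto
  next
    assume "\<exists>P. P \<subseteq> closure \<Omega> \<and> Cap \<Omega> p P = 0 \<and> (\<forall>x\<in>A - P. ut x \<ge> 1)"
    then show "u \<in> sob_closure \<Omega> p (Ycap \<Omega> p A)"
      using Ycap_approx_of_quasi_everywhere[OF assms(4-7)] Wt_sobolev[OF assms(5)]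
      unfolding sob_closure_def by blast
  qed
qed

end
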